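(* Let $n\geq 2$. There exist computable constants $\delta_n,c_n>0$, depending only on $n$, such that if $A\subset\mathbb R^n$ is a Lebesgue measurable set of positive measure with $\delta(A)\leq\delta_n$, then $$\delta(A)^{\alpha_n}\geq c_n\,\frac{|\operatorname{co}(A)\setminus A|}{|A|},\qquad \alpha_n:=\frac{1}{8\cdot 16^{n-2}\,n!\,(n-1)!}.$$
   Context: $|\cdot|$ denotes Lebesgue measure on $\mathbb R^n$; for sets that may be non-measurable (such as $A+A$) it denotes outer Lebesgue measure. $A+A:=\{a+b:a,b\in A\}$, $cA:=\{ca:a\in A\}$ for $c>0$, and $\operatorname{co}(A)$ is the convex hull of $A$. The deficit of $A$ (with $|A|>0$) is $\delta(A):=\frac{|\frac12(A+A)|}{|A|}-1=\frac{|A+A|}{|2A|}-1$. *)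

theory Defs
  imports "HOL-Analysis.Analysis" "HOL-Analysis.Finite_Function_Topology"
begin

text \<open>
  The constants form a computable sequence in \<open>n\<close>, so \<open>n\<close> is quantified after them, and the
  dimension cannot be a type. \<open>\<real>\<^sup>n\<close> is the subspace of those \<open>x :: nat \<Rightarrow>\<^sub>0 real\<close> whose
  coordinates vanish outside \<open>{..<n}\<close>; the vector space operations, the Minkowski sum and the
  convex hull are the ones of the type.
\<close>

definition vec_of :: "nat \<Rightarrow> (nat \<Rightarrow> real) \<Rightarrow> (nat \<Rightarrow>\<^sub>0 real)" where
  "vec_of n f = Abs_poly_mapping (\<lambda>i. if i < n then f i else 0)"

definition borel_lebesgue :: "nat \<Rightarrow> (nat \<Rightarrow>\<^sub>0 real) measure" where
  "borel_lebesgue n = embed_measure (\<Pi>\<^sub>M i\<in>{..<n}. lborel) (vec_of n)"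

definition lebesgue_space :: "nat \<Rightarrow> (nat \<Rightarrow>\<^sub>0 real) measure" where
  "lebesgue_space n = completion (borel_lebesgue n)"

definition vol :: "nat \<Rightarrow> (nat \<Rightarrow>\<^sub>0 real) set \<Rightarrow> ennreal" where
  "vol n A = outer_measure_of (lebesgue_space n) A"

lemma vol_measurable: "A \<in> sets (lebesgue_space n) \<Longrightarrow> vol n A = emeasure (lebesgue_space n) A"
  by (simp add: vol_def)

lemma lookup_vec_of: "Poly_Mapping.lookup (vec_of n f) i = (if i < n then f i else 0)"
  unfolding vec_of_def by (subst Abs_poly_mapping_inverse) auto

lemma inj_on_vec_of: "inj_on (vec_of n) (space (\<Pi>\<^sub>M i\<in>{..<n}. lborel))"
proof (rule inj_onI)
  fix f g assume fg: "f \<in> space (\<Pi>\<^sub>M i\<in>{..<n}. lborel)" "g \<in> space (\<Pi>\<^sub>M i\<in>{..<n}. lborel)"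
    and eq: "vec_of n f = vec_of n g"
  have "f i = g i" if "i \<in> {..<n}" for i
    using arg_cong[OF eq, of "\<lambda>x. Poly_Mapping.lookup x i"] that by (simp add: lookup_vec_of)
  with fg show "f = g"
    by (auto simp: space_PiM intro: PiE_ext)
qed

lemma space_lebesgue_space:
  "space (lebesgue_space n) = {x. \<forall>i\<ge>n. Poly_Mapping.lookup x i = 0}"
proof -
  have "x \<in> vec_of n ` ({..<n} \<rightarrow>\<^sub>E UNIV)" if "\<forall>i\<ge>n. Poly_Mapping.lookup x i = 0"
    for x :: "nat \<Rightarrow>\<^sub>0 real"
  proof
    show "x = vec_of n (restrict (Poly_Mapping.lookup x) {..<n})"
      using that by (intro poly_mapping_eqI) (simp add: lookup_vec_of)
  qed auto
  then show ?thesis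
    by (auto simp: lebesgue_space_def borel_lebesgue_def space_embed_measure space_PiM lookup_vec_of)
qed

lemma vol_borel:
  assumes "A \<in> sets (borel_lebesgue n)"
  shows "vol n A = emeasure (borel_lebesgue n) A"
  using assms unfolding vol_def lebesgue_space_def
  by (simp add: sets_completionI_sets)

lemma vol_box:
  assumes le: "\<And>i. i < n \<Longrightarrow> a i \<le> b i"
  shows "vol n {x \<in> space (lebesgue_space n). \<forall>i<n. Poly_Mapping.lookup x i \<in> {a i..b i}}
    = ennreal (\<Prod>i<n. b i - a i)" (is "vol n ?B = _")
proof -
  interpret product_sigma_finite "\<lambda>_::nat. lborel :: real measure" by standard
  let ?P = "\<Pi>\<^sub>M i\<in>{..<n}. (lborel :: real measure)"
  let ?C = "Pi\<^sub>E {..<n} (\<lambda>i. {a i..b i})"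
  have C: "?C \<in> sets ?P" by (intro sets_PiM_I_finite) auto
  have sub: "?C \<subseteq> space ?P" using C by (rule sets.sets_into_space)
  have sp: "space (lebesgue_space n) = vec_of n ` space ?P"
    by (simp add: lebesgue_space_def borel_lebesgue_def space_embed_measure)
  have ext: "f \<in> extensional {..<n}" if "f \<in> space ?P" for f
    using that by (simp add: space_PiM PiE_def)
  have mem: "vec_of n f \<in> ?B \<longleftrightarrow> f \<in> ?C" if f: "f \<in> space ?P" for f
  proof -
    have "vec_of n f \<in> ?B \<longleftrightarrow> (\<forall>i<n. f i \<in> {a i..b i})"
      using f by (simp add: sp lookup_vec_of)
    also have "\<dots> \<longleftrightarrow> f \<in> ?C"
      using ext[OF f] unfolding PiE_iff by blast
    finally show ?thesis .
  qed
  have B: "?B = vec_of n ` ?C"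
  proof (intro subset_antisym subsetI)
    fix x assume x: "x \<in> ?B"
    then obtain f where "f \<in> space ?P" "x = vec_of n f" unfolding sp by blast
    with x mem show "x \<in> vec_of n ` ?C" by blast
  next
    fix x assume "x \<in> vec_of n ` ?C"
    then obtain f where "f \<in> ?C" "x = vec_of n f" by blast
    with sub mem show "x \<in> ?B" by blast
  qed
  have sB: "?B \<in> sets (borel_lebesgue n)"
    unfolding B borel_lebesgue_def by (rule in_sets_embed_measure[OF C])
  have "vol n ?B = emeasure (borel_lebesgue n) ?B"
    by (rule vol_borel[OF sB])
  also have "\<dots> = emeasure ?P (vec_of n -` ?B \<inter> space ?P)"
    using sB unfolding borel_lebesgue_def by (rule emeasure_embed_measure'[OF inj_on_vec_of])
  also have "vec_of n -` ?B \<inter> space ?P = ?C"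
    by (intro set_eqI) (use mem sub in \<open>auto simp only: vimage_eq Int_iff\<close>)
  also have "emeasure ?P ?C = (\<Prod>i<n. emeasure lborel {a i..b i})"
    by (rule emeasure_PiM) auto
  also have "\<dots> = (\<Prod>i<n. ennreal (b i - a i))"
    using le by (intro prod.cong) auto
  also have "\<dots> = ennreal (\<Prod>i<n. b i - a i)"
    using le by (intro prod_ennreal) auto
  finally show ?thesis .
qed


text \<open>
  Subtraction on \<^typ>\<open>ennreal\<close> is truncated at \<open>0\<close>, which is harmless as
  \<open>A \<subseteq> (A + A) / 2\<close>. The deficit may be \<open>\<infinity>\<close>. Where it is undefined in the usual sense, for
  \<open>vol n A = \<infinity>\<close>, its value here is \<open>0\<close>, and then \<open>vol n B / vol n A = 0\<close> for every \<open>B\<close>.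
\<close>

definition deficit :: "nat \<Rightarrow> (nat \<Rightarrow>\<^sub>0 real) set \<Rightarrow> ennreal" where
  "deficit n A = vol n ((*\<^sub>R) (1/2) ` (A + A)) / vol n A - 1"

definition alpha :: "nat \<Rightarrow> real" where
  "alpha n = 1 / (8 * 16 ^ (n - 2) * fact n * fact (n - 1))"


text \<open>Kleene's \<open>\<mu>\<close>-recursive functions: \<open>recf_eval r xs y\<close> means that \<open>r\<close> is defined at the
  arguments \<open>xs\<close> with value \<open>y\<close>.\<close>

datatype recf = Zero | Succ | Proj nat | Comp recf "recf list" | PrimRec recf recf | Mu recf

inductive recf_eval :: "recf \<Rightarrow> nat list \<Rightarrow> nat \<Rightarrow> bool" where
  Zero: "recf_eval Zero xs 0"
| Succ: "recf_eval Succ [x] (Suc x)"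
| Proj: "i < length xs \<Longrightarrow> recf_eval (Proj i) xs (xs ! i)"
| Comp: "list_all2 (\<lambda>g y. recf_eval g xs y) gs ys \<Longrightarrow> recf_eval f ys z \<Longrightarrow> recf_eval (Comp f gs) xs z"
| PrimRec_0: "recf_eval f xs y \<Longrightarrow> recf_eval (PrimRec f g) (0 # xs) y"
| PrimRec_Suc: "recf_eval (PrimRec f g) (m # xs) y \<Longrightarrow> recf_eval g (m # y # xs) z
    \<Longrightarrow> recf_eval (PrimRec f g) (Suc m # xs) z"
| Mu: "recf_eval f (m # xs) 0 \<Longrightarrow> (\<forall>l<m. \<exists>y>0. recf_eval f (l # xs) y) \<Longrightarrow> recf_eval (Mu f) xs m"

definition computable2 :: "(nat \<Rightarrow> nat \<Rightarrow> nat) \<Rightarrow> bool" where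
  "computable2 f \<longleftrightarrow> (\<exists>r. \<forall>n k. recf_eval r [n, k] (f n k))"

text \<open>A sequence of reals is computable if a recursive double sequence of rationals approximates
  its \<open>n\<close>th term up to \<open>2\<^sup>-\<^sup>k\<close>, uniformly in \<open>n\<close> and \<open>k\<close>.\<close>

definition computable_real_seq :: "(nat \<Rightarrow> real) \<Rightarrow> bool" where
  "computable_real_seq x \<longleftrightarrow>
    (\<exists>p q d. computable2 p \<and> computable2 q \<and> computable2 d \<and>
      (\<forall>n k. \<bar>x n - (real (p n k) - real (q n k)) / real (Suc (d n k))\<bar> \<le> 1 / 2 ^ k))"

end

theory Submission
  imports Defs
begin

text \<open>
  Write \<open>h\<^sub>x y = (x + y) / 2\<close>. For every \<open>x \<in> A\<close> the set \<open>h\<^sub>x A\<close> has volume at most \<open>\<delta> |A|\<close> outside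
  \<open>A\<close>, and a composition of such contractions still loses at most \<open>2 \<delta> |A|\<close>.

  Choosing the points \<open>x\<^sub>0, \<dots>, x\<^sub>n\<close> of \<open>A\<close> greedily, all of \<open>A\<close> has bounded coordinates with respect
  to them. Contracting towards \<open>x\<^sub>0\<close> or \<open>x\<^sub>j\<close> in the \<open>j\<close>-th of \<open>n\<close> steps yields a parallelepiped \<open>Q\<close>
  all of whose vertices lie in \<open>A\<close>. On the torus obtained from \<open>Q\<close>, the set \<open>E = A \<inter> Q\<close> is almost
  invariant under doubling, because the half-size copies of \<open>Q\<close> at its corners tile \<open>Q\<close>; comparing
  with \<open>h\<^sub>x\<close> for \<open>x \<in> E\<close> shows that \<open>E\<close> is almost invariant under translation by each of its own
  elements. The almost periods then form a subgroup of finite index of a divisible group, hence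
  everything is an almost period and \<open>E\<close> fills nearly all of \<open>Q\<close>.

  Finally every point of the convex hull is within \<open>O(\<delta>\<^sup>1\<^sup>/\<^sup>n)\<close> of a point of \<open>A\<close>, towards which a small
  copy of \<open>Q\<close> is nearly filled by \<open>A\<close>. So the hull shrunk by a factor \<open>1 - O(\<delta>\<^sup>1\<^sup>/\<^sup>n)\<close> is contained in
  \<open>(A + A) / 2\<close>, which bounds its volume. This gives the exponent \<open>1/n\<close>, larger than \<open>\<alpha>\<^sub>n\<close>.
\<close>

subsection \<open>Midpoint contractions\<close>

text \<open>The frame bounds the volume of \<open>A\<close> by a multiple of that of
  \<open>Q\<close>, but gives no lower bound: a priori \<open>A\<close> could be spread very thinly
  over \<open>Q\<close>. All errors are multiples of \<open>d\<close> times the volume of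
  \<open>A\<close>, so no step may cost a factor depending on how much larger \<open>Q\<close> is.
  This rules out counting arguments whose error grows with the number of translates, and is why
  almost periods are used: below half the volume of \<open>E\<close>, the defect of a translation
  either is tiny or cannot occur at all, so sums of almost periods are again almost periods with the
  same bound, however many are added. Only after \<open>E\<close> is known to fill 15/16 of
  \<open>Q\<close> are errors compared with the volume of \<open>Q\<close>. The rate comes from one
  comparison: a copy of \<open>Q\<close> scaled by \<open>2 ^ -l\<close> is still mostly filled as
  long as \<open>d\<close> is small against \<open>2 ^ -(n * l)\<close>. Scales are powers of two
  because every copy is the image of a word of contractions.\<close>

definition contr :: "'a::real_vector \<Rightarrow> 'a \<Rightarrow> 'a" where
  "contr x y = (1/2) *\<^sub>R (x + y)"

lemma foldr_contr_affine:
  "foldr contr xs y = foldr contr xs 0 + (1/2) ^ length xs *\<^sub>R y"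
  by (induction xs) (simp_all add: contr_def scaleR_add_right)

lemma foldr_contr_replicate:
  "foldr contr (replicate k x) y = (1 - (1/2) ^ k) *\<^sub>R x + (1/2) ^ k *\<^sub>R y"
proof (induction k)
  case (Suc k)
  have "foldr contr (replicate (Suc k) x) y
    = (1/2) *\<^sub>R (x + ((1 - (1/2) ^ k) *\<^sub>R x + (1/2) ^ k *\<^sub>R y))"
    by (simp only: replicate_Suc foldr_Cons o_apply Suc contr_def[of x])
  also have "\<dots> = (1/2 + (1/2) * (1 - (1/2) ^ k)) *\<^sub>R x + (1/2) ^ Suc k *\<^sub>R y"
    by (simp add: scaleR_add_right scaleR_add_left add.assoc)
  also have "1/2 + (1/2) * (1 - (1/2) ^ k) = 1 - (1/2::real) ^ Suc k"
    by (simp add: field_simps)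
  finally show ?case .
qed simp

text \<open>\<open>foldr\<close> applies the last entry first, so \<open>p j\<close> enters with
  weight \<open>2 ^ -(j + 1)\<close>. Changing one letter therefore shifts the image by a vector
  that does not depend on the other letters; this makes the images of the words in
  \<open>cornered_translate\<close> the vertices of a parallelepiped.\<close>

lemma foldr_contr_map:
  "foldr contr (map p [0..<m]) y = (\<Sum>j<m. (1/2) ^ (j + 1) *\<^sub>R p j) + (1/2) ^ m *\<^sub>R y"
proof (induction m arbitrary: y)
  case (Suc m)
  have "foldr contr (map p [0..<Suc m]) y = foldr contr (map p [0..<m]) (contr (p m) y)" by simp
  also have "\<dots> = (\<Sum>j<m. (1/2) ^ (j + 1) *\<^sub>R p j) + (1/2) ^ m *\<^sub>R contr (p m) y"
    by (rule Suc)
  also have "(1/2) ^ m *\<^sub>R contr (p m) y = (1/2) ^ (m + 1) *\<^sub>R p m + (1/2) ^ Suc m *\<^sub>R y"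
    by (simp add: contr_def scaleR_add_right)
  finally show ?case by (simp add: add.assoc)
qed simp

lemma suminf_const_ennreal_eq_top:
  fixes c :: ennreal
  assumes "c \<noteq> 0"
  shows "suminf (\<lambda>k::nat. c) = \<infinity>"
  using assms by (simp add: ennreal_mult_top flip: nn_integral_count_space_nat)

subsection \<open>Volumes on finite-dimensional spaces\<close>

text \<open>The geometric argument uses only these properties of Lebesgue measure. The type is a
  mere real vector space, so everything is relative to \<open>space M\<close>. Translation
  invariance is the case \<open>c = 1\<close> of \<open>emeasure_affine\<close>; sigma-finiteness is
  what Fubini needs in \<open>integral_psi\<close>.\<close>

locale finite_dim_volume = sigma_finite_measure M for M :: "'a::real_vector measure" +
  fixes n :: nat and X :: "nat \<Rightarrow> 'a \<Rightarrow> real" and e :: "nat \<Rightarrow> 'a"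
  assumes n_pos: "0 < n"
    and subspace_space: "subspace (space M)"
    and linear_X: "linear (X i)"
    and X_measurable: "i < n \<Longrightarrow> X i \<in> borel_measurable M"
    and e_space: "i < n \<Longrightarrow> e i \<in> space M"
    and X_e: "i < n \<Longrightarrow> j < n \<Longrightarrow> X i (e j) = (if i = j then 1 else 0)"
    and X_eqI: "x \<in> space M \<Longrightarrow> (\<And>i. i < n \<Longrightarrow> X i x = 0) \<Longrightarrow> x = 0"
    and measurable_coordI: "(\<And>x. x \<in> space M \<Longrightarrow> f x \<in> space M) \<Longrightarrow>
      (\<And>i. i < n \<Longrightarrow> (\<lambda>x. X i (f x)) \<in> borel_measurable M) \<Longrightarrow> f \<in> measurable M M"
    and measurable_plus: "(\<lambda>(x, y). x + y) \<in> measurable (M \<Otimes>\<^sub>M M) M"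
    and emeasure_affine: "c \<noteq> 0 \<Longrightarrow> v \<in> space M \<Longrightarrow> S \<in> sets M \<Longrightarrow>
      emeasure M ((\<lambda>x. v + c *\<^sub>R x) ` S) = ennreal (\<bar>c\<bar> ^ n) * emeasure M S"
    and box_finite: "emeasure M {x \<in> space M. \<forall>i<n. \<bar>X i x\<bar> \<le> r} < \<infinity>"
begin

lemma add_space [simp, intro]: "x \<in> space M \<Longrightarrow> y \<in> space M \<Longrightarrow> x + y \<in> space M"
  using subspace_space by (rule subspace_add)

lemma diff_space [simp, intro]: "x \<in> space M \<Longrightarrow> y \<in> space M \<Longrightarrow> x - y \<in> space M"
  using subspace_space by (rule subspace_diff)

lemma scale_space [simp, intro]: "x \<in> space M \<Longrightarrow> c *\<^sub>R x \<in> space M"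
  using subspace_space by (rule subspace_scale)

lemma zero_space [simp, intro]: "0 \<in> space M"
  using subspace_space by (rule subspace_0)

lemma uminus_space [simp, intro]: "x \<in> space M \<Longrightarrow> - x \<in> space M"
  using subspace_space by (rule subspace_neg)

lemma sum_space: "(\<And>i. i \<in> I \<Longrightarrow> f i \<in> space M) \<Longrightarrow> sum f I \<in> space M"
  using subspace_space by (rule subspace_sum)

lemmas X_simps = linear_add[OF linear_X] linear_diff[OF linear_X] linear_scale[OF linear_X]
  linear_0[OF linear_X] linear_sum[OF linear_X]

lemma measurable_affine [measurable]:
  assumes v: "v \<in> space M"
  shows "(\<lambda>x. v + c *\<^sub>R x) \<in> measurable M M"
proof (rule measurable_coordI)
  fix i assume "i < n"
  note X_measurable[OF this, measurable]
  show "(\<lambda>x. X i (v + c *\<^sub>R x)) \<in> borel_measurable M"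
    by (simp add: X_simps)
qed (use v in auto)

lemma affine_image_eq:
  assumes c: "c \<noteq> 0" and v: "v \<in> space M" and S: "S \<subseteq> space M"
  shows "(\<lambda>x. v + c *\<^sub>R x) ` S = {y \<in> space M. (- ((1/c) *\<^sub>R v)) + (1/c) *\<^sub>R y \<in> S}"
proof (intro subset_antisym subsetI)
  fix y assume "y \<in> (\<lambda>x. v + c *\<^sub>R x) ` S"
  then obtain x where "x \<in> S" "y = v + c *\<^sub>R x" by blast
  then show "y \<in> {y \<in> space M. (- ((1/c) *\<^sub>R v)) + (1/c) *\<^sub>R y \<in> S}"
    using c v S by (auto simp: scaleR_add_right)
next
  fix y assume "y \<in> {y \<in> space M. (- ((1/c) *\<^sub>R v)) + (1/c) *\<^sub>R y \<in> S}"
  moreover have "y = v + c *\<^sub>R (- ((1/c) *\<^sub>R v) + (1/c) *\<^sub>R y)"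
    using c by (simp add: scaleR_add_right scaleR_diff_right)
  ultimately show "y \<in> (\<lambda>x. v + c *\<^sub>R x) ` S" by blast
qed

lemma affine_sets:
  assumes c: "c \<noteq> 0" and v: "v \<in> space M" and S: "S \<in> sets M"
  shows "(\<lambda>x. v + c *\<^sub>R x) ` S \<in> sets M"
proof -
  have [measurable]: "(\<lambda>x. (- ((1/c) *\<^sub>R v)) + (1/c) *\<^sub>R x) \<in> measurable M M"
    using v by (intro measurable_affine) auto
  note S[measurable]
  show ?thesis
    unfolding affine_image_eq[OF c v sets.sets_into_space[OF S]] by measurable
qed

lemma affine_fmeasurable:
  assumes "c \<noteq> 0" "v \<in> space M" "S \<in> fmeasurable M"
  shows "(\<lambda>x. v + c *\<^sub>R x) ` S \<in> fmeasurable M"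
  using assms by (auto simp: fmeasurable_def affine_sets emeasure_affine ennreal_mult_less_top)

lemma measure_affine:
  assumes "c \<noteq> 0" "v \<in> space M" "S \<in> sets M"
  shows "measure M ((\<lambda>x. v + c *\<^sub>R x) ` S) = \<bar>c\<bar> ^ n * measure M S"
  using assms by (simp add: measure_def emeasure_affine enn2real_mult)

lemma measure_affine_preimage:
  assumes "c \<noteq> 0" "v \<in> space M" "S \<in> sets M"
  shows "measure M {x \<in> space M. v + c *\<^sub>R x \<in> S} = measure M S / \<bar>c\<bar> ^ n"
proof -
  have P: "{x \<in> space M. v + c *\<^sub>R x \<in> S} \<in> sets M"
    using assms measurable_affine[of v c] by measurable
  have "(\<lambda>x. v + c *\<^sub>R x) ` {x \<in> space M. v + c *\<^sub>R x \<in> S} = S"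
  proof (intro subset_antisym subsetI)
    fix y assume y: "y \<in> S"
    then have "y \<in> space M" using assms sets.sets_into_space by blast
    moreover have "v + c *\<^sub>R ((1/c) *\<^sub>R (y - v)) = y" using assms by simp
    ultimately show "y \<in> (\<lambda>x. v + c *\<^sub>R x) ` {x \<in> space M. v + c *\<^sub>R x \<in> S}"
      using y assms by (intro image_eqI[of _ _ "(1/c) *\<^sub>R (y - v)"]) auto
  qed auto
  with measure_affine[OF assms(1,2) P] assms show ?thesis by (simp add: field_simps)
qed

lemma affine_preimage_fmeasurable:
  assumes c: "c \<noteq> 0" and v: "v \<in> space M" and S: "S \<in> fmeasurable M"
  shows "{x \<in> space M. v + c *\<^sub>R x \<in> S} \<in> fmeasurable M"
proof -
  have "S \<subseteq> space M" using S by (auto dest: fmeasurableD sets.sets_into_space)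
  then have "{x \<in> space M. v + c *\<^sub>R x \<in> S} = (\<lambda>x. (- ((1/c) *\<^sub>R v)) + (1/c) *\<^sub>R x) ` S"
    using affine_image_eq[of "1/c" "- ((1/c) *\<^sub>R v)" S] c v by simp
  then show ?thesis using c v S by (simp only:) (intro affine_fmeasurable, auto)
qed

lemma foldr_contr_space:
  "set xs \<subseteq> space M \<Longrightarrow> y \<in> space M \<Longrightarrow> foldr contr xs y \<in> space M"
  by (induction xs) (auto simp: contr_def)

lemma measurable_foldr_contr:
  assumes "set xs \<subseteq> space M"
  shows "foldr contr xs \<in> measurable M M"
proof -
  have "foldr contr xs = (\<lambda>y. foldr contr xs 0 + (1/2) ^ length xs *\<^sub>R y)"
    by (rule ext) (rule foldr_contr_affine)
  with measurable_affine[of "foldr contr xs 0" "(1/2) ^ length xs"] assms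
  show ?thesis by (simp add: foldr_contr_space)
qed

lemma measure_foldr_contr:
  assumes "set xs \<subseteq> space M" "S \<in> sets M"
  shows "measure M (foldr contr xs ` S) = (1/2) ^ (n * length xs) * measure M S"
    and "foldr contr xs ` S \<in> sets M"
    and "S \<in> fmeasurable M \<Longrightarrow> foldr contr xs ` S \<in> fmeasurable M"
proof -
  have eq: "foldr contr xs ` S = (\<lambda>y. foldr contr xs 0 + (1/2) ^ length xs *\<^sub>R y) ` S"
    by (intro image_cong refl foldr_contr_affine)
  have v: "foldr contr xs 0 \<in> space M" using assms by (simp add: foldr_contr_space)
  show "measure M (foldr contr xs ` S) = (1/2) ^ (n * length xs) * measure M S"
    unfolding eq by (subst measure_affine) (use v assms in \<open>auto simp: power_mult mult.commute[of n]\<close>)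
  show "foldr contr xs ` S \<in> sets M"
    unfolding eq by (rule affine_sets) (use v assms in auto)
  show "foldr contr xs ` S \<in> fmeasurable M" if "S \<in> fmeasurable M"
    unfolding eq by (rule affine_fmeasurable) (use v that in auto)
qed

lemma sets_all_less:
  assumes "\<And>i. i < n \<Longrightarrow> {x \<in> space M. P i x} \<in> sets M"
  shows "{x \<in> space M. \<forall>i<n. P i x} \<in> sets M"
proof -
  have "{x \<in> space M. \<forall>i\<in>{..<n}. P i x} \<in> sets M"
    using assms by (intro sets.sets_Collect_finite_All) simp_all
  then show ?thesis by (simp only: Ball_def lessThan_iff)
qed

lemma box_sets: "{x \<in> space M. \<forall>i<n. \<bar>X i x\<bar> \<le> r} \<in> sets M"
proof (rule sets_all_less)
  fix i assume "i < n"
  note X_measurable[OF this, measurable]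
  show "{x \<in> space M. \<bar>X i x\<bar> \<le> r} \<in> sets M" by measurable
qed

text \<open>The translates of a bounded piece of the hyperplane by \<open>w / (k + 1)\<close> are
  disjoint, since \<open>f\<close> separates them, have equal measure and all lie in one box of
  finite measure.\<close>

lemma hyperplane_null:
  fixes f :: "'a \<Rightarrow> real"
  assumes f: "linear f" "f \<in> borel_measurable M" and w: "w \<in> space M" "f w \<noteq> 0"
  shows "emeasure M {x \<in> space M. f x = c} = 0"
proof -
  note f(2)[measurable]
  define H where "H r = {x \<in> space M. f x = c \<and> (\<forall>i<n. \<bar>X i x\<bar> \<le> real r)}" for r :: nat
  have H_sets: "H r \<in> sets M" for r
  proof -
    have "H r = (f -` {c} \<inter> space M) \<inter> {x \<in> space M. \<forall>i<n. \<bar>X i x\<bar> \<le> real r}"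
      by (auto simp: H_def)
    also have "\<dots> \<in> sets M" by (rule sets.Int[OF measurable_sets[OF f(2)] box_sets]) simp
    finally show ?thesis .
  qed
  have "emeasure M (H r) = 0" for r
  proof -
    define T where "T k = (\<lambda>x. (1 / real (Suc k)) *\<^sub>R w + 1 *\<^sub>R x) ` H r" for k
    obtain s where s: "\<bar>X i w\<bar> \<le> s" if "i < n" for i
    proof
      show "\<bar>X i w\<bar> \<le> (\<Sum>j<n. \<bar>X j w\<bar>)" if "i < n" for i
        using that by (intro member_le_sum) auto
    qed
    have T_sets: "T k \<in> sets M" for k
      unfolding T_def by (rule affine_sets) (use w H_sets in auto)
    have T_em: "emeasure M (T k) = emeasure M (H r)" for k
      unfolding T_def by (subst emeasure_affine) (use w H_sets in auto)
    have disj: "disjoint_family T"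
    proof (unfold disjoint_family_on_def, intro ballI impI equals0I)
      fix k l x assume kl: "k \<noteq> l" and x: "x \<in> T k \<inter> T l"
      have fT: "f x = f w / real (Suc m) + c" if "x \<in> T m" for m
        using that by (auto simp: T_def H_def linear_add[OF f(1)] linear_scale[OF f(1)])
      have "f w / real (Suc k) = f w / real (Suc l)" using fT[of k] fT[of l] x by auto
      with w have "real (Suc k) = real (Suc l)" by (simp add: field_simps)
      with kl show False by simp
    qed
    have sub: "(\<Union>k. T k) \<subseteq> {x \<in> space M. \<forall>i<n. \<bar>X i x\<bar> \<le> s + real r}"
    proof safe
      fix k y assume "y \<in> T k"
      then obtain x where x: "x \<in> H r" "y = (1 / real (Suc k)) *\<^sub>R w + x" by (auto simp: T_def)
      then show "y \<in> space M" using w by (auto simp: H_def)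
      fix i assume i: "i < n"
      have "\<bar>X i y\<bar> \<le> \<bar>X i w\<bar> / real (Suc k) + \<bar>X i x\<bar>"
        using x by (simp add: X_simps) (metis abs_divide abs_of_nat abs_triangle_ineq of_nat_Suc)
      also have "\<bar>X i w\<bar> / real (Suc k) \<le> \<bar>X i w\<bar> / 1" by (intro divide_left_mono) auto
      finally show "\<bar>X i y\<bar> \<le> s + real r" using s[OF i] x i by (fastforce simp: H_def)
    qed
    have "suminf (\<lambda>k. emeasure M (T k)) = emeasure M (\<Union>k. T k)"
      using T_sets disj by (intro suminf_emeasure) auto
    also have "\<dots> \<le> emeasure M {x \<in> space M. \<forall>i<n. \<bar>X i x\<bar> \<le> s + real r}"
      by (rule emeasure_mono[OF sub box_sets])
    also have "\<dots> < \<infinity>" by (rule box_finite)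
    finally have fin: "suminf (\<lambda>k::nat. emeasure M (H r)) < \<infinity>" by (simp add: T_em)
    show ?thesis
    proof (rule ccontr)
      assume "emeasure M (H r) \<noteq> 0"
      then have "suminf (\<lambda>k::nat. emeasure M (H r)) = \<infinity>"
        by (rule suminf_const_ennreal_eq_top)
      with fin show False by simp
    qed
  qed
  then have "emeasure M (\<Union>r. H r) = 0"
    using H_sets by (intro emeasure_UN_eq_0) auto
  moreover have "{x \<in> space M. f x = c} = (\<Union>r. H r)"
  proof (intro subset_antisym subsetI)
    fix x assume "x \<in> {x \<in> space M. f x = c}"
    then have "x \<in> space M" "c = f x" by auto
    obtain r where "(\<Sum>j<n. \<bar>X j x\<bar>) \<le> real r" using real_arch_simple by blast
    moreover have "\<bar>X i x\<bar> \<le> (\<Sum>j<n. \<bar>X j x\<bar>)" if "i < n" for i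
      using that by (intro member_le_sum) auto
    ultimately have "\<forall>i<n. \<bar>X i x\<bar> \<le> real r" by (meson order_trans)
    then show "x \<in> (\<Union>r. H r)" using \<open>x \<in> space M\<close> \<open>c = f x\<close> by (auto simp: H_def)
  qed (auto simp: H_def)
  ultimately show ?thesis by simp
qed

end

subsection \<open>Sets with small doubling\<close>

text \<open>\<^term>\<open>A0\<close> stands for a Borel subset of full measure of \<^term>\<open>A\<close>, and \<^term>\<open>B\<close> for a Borel hull of
  the set of midpoints, which need not be measurable itself.\<close>

locale small_doubling = finite_dim_volume M n X e
  for M :: "'a::real_vector measure" and n X e +
  fixes A A0 B :: "'a set" and d :: real
  assumes A_space: "A \<subseteq> space M"
    and A0_fmeas: "A0 \<in> fmeasurable M"
    and A0_sub: "A0 \<subseteq> A"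
    and A0_pos: "0 < measure M A0"
    and B_fmeas: "B \<in> fmeasurable M"
    and contr_B: "x \<in> A \<Longrightarrow> y \<in> A \<Longrightarrow> contr x y \<in> B"
    and measure_B: "measure M B \<le> (1 + d) * measure M A0"
begin

abbreviation a where "a \<equiv> measure M A0"

lemma A0_sets [measurable]: "A0 \<in> sets M"
  using A0_fmeas by auto

lemma A0_B: "A0 \<subseteq> B"
proof
  fix x assume "x \<in> A0"
  with A0_sub contr_B[of x x] show "x \<in> B" by (auto simp: contr_def scaleR_2[symmetric])
qed

lemma d_nonneg: "0 \<le> d"
proof -
  have "a \<le> measure M B"
    using A0_B B_fmeas by (intro measure_mono_fmeasurable) auto
  with measure_B have "0 \<le> d * a" by (simp add: algebra_simps)
  with A0_pos show ?thesis by (simp add: zero_le_mult_iff)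
qed

section \<open>Almost invariance under words of contractions, and frames adapted to the set\<close>

lemma measure_contr_diff:
  assumes x: "x \<in> A"
  shows "measure M (contr x ` A0 - A0) \<le> d * a"
proof -
  have im: "contr x ` A0 = foldr contr [x] ` A0" by simp
  have s: "contr x ` A0 \<in> sets M"
    unfolding im using x A_space by (intro measure_foldr_contr) auto
  have "measure M (contr x ` A0 - A0) \<le> measure M (B - A0)"
    using contr_B[OF x] A0_sub B_fmeas s
    by (intro measure_mono_fmeasurable fmeasurable_Diff) auto
  also have "\<dots> = measure M B - a"
    using A0_B B_fmeas A0_fmeas by (intro measure_Diff) (auto simp: fmeasurable_def)
  also have "\<dots> \<le> d * a" using measure_B by (simp add: algebra_simps)
  finally show ?thesis .
qed

text \<open>What the tail of the word has lost is shrunk by \<open>2 ^ -n\<close>, hence at least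
  halved, by the next contraction, which adds a loss of at most \<open>d * a\<close>. The geometric
  series makes the bound independent of the length of the word.\<close>

lemma measure_foldr_contr_diff:
  assumes "set xs \<subseteq> A"
  shows "measure M (foldr contr xs ` A0 - A0) \<le> 2 * d * a"
  using assms
proof (induction xs)
  case Nil
  then show ?case using d_nonneg by simp
next
  case (Cons x xs)
  let ?R = "foldr contr xs ` A0"
  have xs: "set xs \<subseteq> space M" and x: "x \<in> A" "x \<in> space M" using Cons.prems A_space by auto
  have R: "?R \<in> fmeasurable M" using xs A0_fmeas by (intro measure_foldr_contr) auto
  have im: "contr x ` S = foldr contr [x] ` S" for S by simp
  have m: "measure M (contr x ` S) = (1/2) ^ n * measure M S"
    "contr x ` S \<in> fmeasurable M" if "S \<in> fmeasurable M" for S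
    unfolding im using x that measure_foldr_contr[of "[x]" S] by (auto simp: fmeasurableD)
  have R': "?R - A0 \<in> fmeasurable M" using R by (intro fmeasurable_Diff) auto
  have "foldr contr (x # xs) ` A0 - A0 \<subseteq> (contr x ` A0 - A0) \<union> contr x ` (?R - A0)"
    by auto
  then have "measure M (foldr contr (x # xs) ` A0 - A0)
      \<le> measure M ((contr x ` A0 - A0) \<union> contr x ` (?R - A0))"
    using m[OF A0_fmeas] m[OF R'] m[OF R]
    by (intro measure_mono_fmeasurable)
       (auto simp: image_comp[symmetric] image_image[symmetric] fmeasurableD simp flip: image_comp
         intro!: fmeasurable.Un fmeasurable_Diff)
  also have "\<dots> \<le> measure M (contr x ` A0 - A0) + measure M (contr x ` (?R - A0))"
    using m[OF A0_fmeas] m[OF R'] by (intro measure_Un_le) (auto simp: fmeasurableD)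
  also have "\<dots> \<le> d * a + (1/2) ^ n * (2 * d * a)"
    using measure_contr_diff[OF x(1)] m(1)[OF R'] Cons by (intro add_mono) auto
  also have "(1/2) ^ n * (2 * d * a) \<le> (1/2) ^ 1 * (2 * d * a)"
    using n_pos d_nonneg A0_pos by (intro mult_right_mono power_decreasing) auto
  finally show ?case by simp
qed

text \<open>The previous bound pulled back to the domain, at the price of the reciprocal Jacobian.
  In this form it shows that some points of \<open>A0\<close> stay in \<open>A0\<close> under
  several words at once.\<close>

lemma measure_foldr_contr_bad:
  assumes "set xs \<subseteq> A"
  shows "measure M {y \<in> A0. foldr contr xs y \<notin> A0} \<le> 2 ^ (n * length xs) * (2 * d * a)"
    and "{y \<in> A0. foldr contr xs y \<notin> A0} \<in> sets M"
proof -
  let ?S = "{y \<in> A0. foldr contr xs y \<notin> A0}"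
  have xs: "set xs \<subseteq> space M" using assms A_space by auto
  note measurable_foldr_contr[OF xs, measurable]
  have "?S = {y \<in> space M. y \<in> A0 \<and> foldr contr xs y \<notin> A0}"
    using A0_sub A_space by auto
  also have "\<dots> \<in> sets M" by measurable
  finally show S: "?S \<in> sets M" .
  have "(1/2) ^ (n * length xs) * measure M ?S = measure M (foldr contr xs ` ?S)"
    using xs S by (simp add: measure_foldr_contr)
  also have "\<dots> \<le> measure M (foldr contr xs ` A0 - A0)"
    using measure_foldr_contr[OF xs S] measure_foldr_contr(3)[OF xs A0_sets A0_fmeas]
    by (intro measure_mono_fmeasurable fmeasurable_Diff) auto
  also have "\<dots> \<le> 2 * d * a" by (rule measure_foldr_contr_diff[OF assms])
  finally show "measure M ?S \<le> 2 ^ (n * length xs) * (2 * d * a)"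
    by (simp add: power_one_over field_simps)
qed

text \<open>If \<open>f\<close> were unbounded on \<open>A\<close>, points \<open>g k\<close> of
  \<open>A\<close> could be chosen whose values of \<open>f\<close> grow by more than the width of a
  slab \<open>T m\<close> of positive measure. The contractions of this slab towards the
  \<open>g k\<close> would then be disjoint, of equal measure, and all inside
  \<open>B\<close>.\<close>

lemma functional_bounded:
  fixes f :: "'a \<Rightarrow> real"
  assumes f: "linear f" "f \<in> borel_measurable M"
  shows "\<exists>c. \<forall>x\<in>A. \<bar>f x\<bar> \<le> c"
proof (rule ccontr)
  assume unb: "\<not> ?thesis"
  define T where "T m = {x \<in> A0. \<bar>f x\<bar> \<le> real m}" for m :: nat
  note f(2)[measurable]
  have T_sets: "T m \<in> sets M" for m
  proof -
    have "T m = {x \<in> space M. x \<in> A0 \<and> \<bar>f x\<bar> \<le> real m}"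
      using A0_sub A_space by (auto simp: T_def)
    also have "\<dots> \<in> sets M" by measurable
    finally show ?thesis .
  qed
  have "\<exists>m. emeasure M (T m) \<noteq> 0"
  proof (rule ccontr)
    assume "\<nexists>m. emeasure M (T m) \<noteq> 0"
    then have "emeasure M (\<Union>m. T m) = 0"
      using T_sets by (intro emeasure_UN_eq_0) auto
    moreover have "(\<Union>m. T m) = A0"
      using real_arch_simple by (auto simp: T_def)
    ultimately show False using A0_pos by (simp add: measure_def)
  qed
  then obtain m where m: "emeasure M (T m) \<noteq> 0" by blast
  have "\<exists>g. \<forall>k. g k \<in> A \<and> \<bar>f (g k)\<bar> + 2 * real m < \<bar>f (g (Suc k))\<bar>"
  proof (rule dependent_nat_choice[where P = "\<lambda>_ x. x \<in> A"])
    show "\<exists>x. x \<in> A" using unb by blast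
    fix x :: 'a and k :: nat assume "x \<in> A"
    from unb have "\<not> (\<forall>y\<in>A. \<bar>f y\<bar> \<le> \<bar>f x\<bar> + 2 * real m)" by blast
    then show "\<exists>y. y \<in> A \<and> \<bar>f x\<bar> + 2 * real m < \<bar>f y\<bar>" by force
  qed
  then obtain g where g: "\<And>k. g k \<in> A" "\<And>k. \<bar>f (g k)\<bar> + 2 * real m < \<bar>f (g (Suc k))\<bar>" by blast
  have gap: "\<bar>f (g k)\<bar> + 2 * real m < \<bar>f (g l)\<bar>" if "k < l" for k l
    using that
  proof (induction l)
    case (Suc l)
    then show ?case using g(2)[of l] by (cases "k = l") auto
  qed simp
  define D where "D k = contr (g k) ` T m" for k
  have gs: "set [g k] \<subseteq> space M" for k using g A_space by auto
  have D_foldr: "D k = foldr contr [g k] ` T m" for k by (simp add: D_def)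
  have D_sets: "D k \<in> sets M" for k
    unfolding D_foldr by (rule measure_foldr_contr(2)[OF gs T_sets])
  have D_em: "emeasure M (D k) = ennreal ((1/2) ^ n) * emeasure M (T m)" for k
  proof -
    have "D k = (\<lambda>x. (1/2) *\<^sub>R g k + (1/2) *\<^sub>R x) ` T m"
      by (simp add: D_def contr_def scaleR_add_right)
    then show ?thesis using gs[of k] T_sets emeasure_affine[of "1/2" "(1/2) *\<^sub>R g k" "T m"] by simp
  qed
  have "disjoint_family D"
  proof -
    have "D k \<inter> D l = {}" if "k < l" for k l
    proof (rule ccontr)
      assume "D k \<inter> D l \<noteq> {}"
      then obtain x y where xy: "x \<in> T m" "y \<in> T m" "contr (g k) x = contr (g l) y"
        by (auto simp: D_def)
      then have "f (g k) + f x = f (g l) + f y"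
        by (simp add: contr_def flip: linear_add[OF f(1)])
      with xy gap[OF that] show False by (auto simp: T_def)
    qed
    then show ?thesis
      unfolding disjoint_family_on_def by (metis Int_commute linorder_neqE_nat)
  qed
  then have "suminf (\<lambda>k. emeasure M (D k)) = emeasure M (\<Union>k. D k)"
    using D_sets by (intro suminf_emeasure) auto
  also have "\<dots> \<le> emeasure M B"
    using g(1) A0_sub contr_B B_fmeas by (intro emeasure_mono) (auto simp: D_def T_def)
  also have "\<dots> < \<infinity>" using B_fmeas by (simp add: fmeasurable_def)
  finally have "suminf (\<lambda>k::nat. ennreal ((1/2) ^ n) * emeasure M (T m)) < \<infinity>" by (simp add: D_em)
  moreover have "ennreal ((1/2) ^ n) * emeasure M (T m) \<noteq> 0" using m by simp
  ultimately show False using suminf_const_ennreal_eq_top by fastforce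
qed

lemma not_in_hyperplane:
  fixes f :: "'a \<Rightarrow> real"
  assumes f: "linear f" "f \<in> borel_measurable M" and w: "w \<in> space M" "f w \<noteq> 0"
  shows "\<exists>x\<in>A. f x \<noteq> c"
proof (rule ccontr)
  assume "\<not> ?thesis"
  then have sub: "A0 \<subseteq> {x \<in> space M. f x = c}" using A0_sub A_space by auto
  have "f -` {c} \<inter> space M \<in> sets M" by (rule measurable_sets[OF f(2)]) simp
  also have "f -` {c} \<inter> space M = {x \<in> space M. f x = c}" by auto
  finally have "emeasure M A0 \<le> emeasure M {x \<in> space M. f x = c}"
    by (intro emeasure_mono sub)
  with hyperplane_null[OF assms] A0_pos show False by (simp add: measure_def)
qed

text \<open>The supremum of \<open>\<bar>f (x - x0)\<bar>\<close> is finite and positive but need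
  not be attained, hence the factor 2.\<close>

lemma frame_step:
  fixes f :: "'a \<Rightarrow> real"
  assumes x0: "x0 \<in> A" and f: "linear f" "f \<in> borel_measurable M" and w: "w \<in> space M" "f w \<noteq> 0"
  shows "\<exists>v. x0 + v \<in> A \<and> f v \<noteq> 0 \<and> (\<forall>x\<in>A. \<bar>f (x - x0)\<bar> \<le> 2 * \<bar>f v\<bar>)"
proof -
  define S where "S = (\<lambda>x. \<bar>f (x - x0)\<bar>) ` A"
  obtain c where c: "\<forall>x\<in>A. \<bar>f x\<bar> \<le> c" using functional_bounded[OF f] by blast
  have bdd: "bdd_above S"
  proof (rule bdd_aboveI)
    fix y assume "y \<in> S"
    then obtain x where "x \<in> A" "y = \<bar>f x - f x0\<bar>" by (auto simp: S_def linear_diff[OF f(1)])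
    then show "y \<le> c + c" using bspec[OF c, of x] bspec[OF c x0] by simp
  qed
  obtain x1 where x1: "x1 \<in> A" "f x1 \<noteq> f x0" using not_in_hyperplane[OF f w] by blast
  have "0 < \<bar>f (x1 - x0)\<bar>" using x1 by (simp add: linear_diff[OF f(1)])
  also have "\<dots> \<le> Sup S" using x1 bdd by (intro cSup_upper) (auto simp: S_def)
  finally have pos: "0 < Sup S" .
  then have "\<exists>y\<in>S. Sup S / 2 < y"
    using x1 by (intro less_cSupD) (auto simp: S_def)
  then obtain x where x: "x \<in> A" "Sup S / 2 < \<bar>f (x - x0)\<bar>" by (auto simp: S_def)
  have "\<bar>f (y - x0)\<bar> \<le> 2 * \<bar>f (x - x0)\<bar>" if "y \<in> A" for y
  proof -
    have "\<bar>f (y - x0)\<bar> \<le> Sup S" using that bdd by (intro cSup_upper) (auto simp: S_def)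
    with x show ?thesis by simp
  qed
  with x pos show ?thesis by (intro exI[of _ "x - x0"]) auto
qed

text \<open>Besides duality and boundedness, two clauses drive the induction. The residual has
  vanishing coordinates below \<open>k\<close>, so it is zero at \<open>k = n\<close>. The
  \<open>t i\<close> vanish on the later \<open>e j\<close>, so the next functional takes the value
  1 at \<open>e k\<close> and is not zero.\<close>

definition partial_frame :: "'a \<Rightarrow> (nat \<Rightarrow> 'a) \<Rightarrow> (nat \<Rightarrow> 'a \<Rightarrow> real) \<Rightarrow> nat \<Rightarrow> bool" where
  "partial_frame x0 u t k \<longleftrightarrow>
    (\<forall>i<k. x0 + u i \<in> A \<and> u i \<in> space M \<and> linear (t i) \<and> t i \<in> borel_measurable M) \<and>
    (\<forall>i<k. \<forall>j<k. t i (u j) = (if i = j then 1 else 0)) \<and>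
    (\<forall>x\<in>A. \<forall>i<k. \<bar>t i (x - x0)\<bar> \<le> 2 * 3 ^ k) \<and>
    (\<forall>x\<in>space M. \<forall>j<k. X j (x - (\<Sum>i<k. t i x *\<^sub>R u i)) = 0) \<and>
    (\<forall>i<k. \<forall>j<n. k \<le> j \<longrightarrow> t i (e j) = 0)"

text \<open>Gram-Schmidt without an inner product: the next functional is the \<open>k\<close>-th coordinate of the
  residual, and the next vector nearly maximises it on \<^term>\<open>A\<close>.\<close>

lemma partial_frame_Suc:
  assumes x0: "x0 \<in> A" and fr: "partial_frame x0 u t k" and k: "k < n"
  shows "\<exists>u' t'. partial_frame x0 u' t' (Suc k)"
proof -
  define P where "P x = x - (\<Sum>i<k. t i x *\<^sub>R u i)" for x
  define f where "f x = X k (P x)" for x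
  have u: "x0 + u i \<in> A" "u i \<in> space M" and t: "linear (t i)" "t i \<in> borel_measurable M"
    if "i < k" for i
    using fr that by (auto simp: partial_frame_def)
  have tu: "t i (u j) = (if i = j then 1 else 0)" if "i < k" "j < k" for i j
    using fr that by (auto simp: partial_frame_def)
  have bd: "\<bar>t i (x - x0)\<bar> \<le> 2 * 3 ^ k" if "i < k" "x \<in> A" for i x
    using fr that by (auto simp: partial_frame_def)
  have res: "X j (P x) = 0" if "x \<in> space M" "j < k" for j x
    using fr that by (auto simp: partial_frame_def P_def)
  have te: "t i (e j) = 0" if "i < k" "k \<le> j" "j < n" for i j
    using fr that by (auto simp: partial_frame_def)
  have f_eq: "f x = X k x - (\<Sum>i<k. t i x * X k (u i))" for x
    by (simp add: f_def P_def X_simps)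
  have f_lin: "linear f"
    by (rule linearI) (auto simp: f_eq X_simps t linear_add linear_scale sum.distrib
      sum_distrib_left algebra_simps cong: sum.cong_simp)
  have f_meas: "f \<in> borel_measurable M"
    unfolding f_eq using X_measurable[OF k] t(2)
    by (intro borel_measurable_diff borel_measurable_sum borel_measurable_times) auto
  have f_e: "f (e j) = (if j = k then 1 else 0)" if "k \<le> j" "j < n" for j
    using that te k by (simp add: f_eq X_e)
  have f_u: "f (u j) = 0" if "j < k" for j
  proof -
    have "(\<Sum>i<k. t i (u j) *\<^sub>R u i) = (\<Sum>i<k. if i = j then u i else 0)"
      using that by (intro sum.cong) (auto simp: tu)
    then have "P (u j) = 0" using that by (simp add: P_def)
    then show ?thesis by (simp add: f_def X_simps)
  qed
  obtain v where v: "x0 + v \<in> A" "f v \<noteq> 0" "\<And>x. x \<in> A \<Longrightarrow> \<bar>f (x - x0)\<bar> \<le> 2 * \<bar>f v\<bar>"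
    using frame_step[OF x0 f_lin f_meas e_space[OF k]] f_e[of k] k by auto
  have v_space: "v \<in> space M"
  proof -
    have "(x0 + v) - x0 \<in> space M" using v(1) x0 A_space by blast
    then show ?thesis by simp
  qed
  define s where "s x = f x / f v" for x
  have s_lin: "linear s"
    by (rule linearI) (auto simp: s_def linear_add[OF f_lin] linear_scale[OF f_lin] add_divide_distrib)
  have s_meas: "s \<in> borel_measurable M"
    unfolding s_def using f_meas by measurable
  have s_bd: "\<bar>s (x - x0)\<bar> \<le> 2" if "x \<in> A" for x
    using v(3)[OF that] v(2) by (simp add: s_def field_simps)
  define u' where "u' i = (if i = k then v else u i)" for i
  \<comment> \<open>The correction makes the old functionals vanish at \<open>v\<close>. As
    \<open>x0 + v\<close> is in \<open>A\<close>, \<open>t i v\<close> obeys the old bound, and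
    \<open>\<bar>s\<bar> \<le> 2\<close> on \<open>A - x0\<close>; the bound grows by the factor
    \<open>1 + 2\<close>, whence the powers of 3.\<close>
  define t' where "t' i x = (if i = k then s x else t i x - t i v * s x)" for i x
  have u'_k: "u' k = v" "\<And>i. i < k \<Longrightarrow> u' i = u i" by (auto simp: u'_def)
  have t'_k: "t' k = s" "\<And>i. i < k \<Longrightarrow> t' i = (\<lambda>x. t i x - t i v * s x)" by (auto simp: t'_def)
  have lt: "i < Suc k \<longleftrightarrow> i < k \<or> i = k" for i by auto
  have "partial_frame x0 u' t' (Suc k)"
    unfolding partial_frame_def
  proof (intro conjI allI impI ballI)
    fix i assume i: "i < Suc k"
    show "x0 + u' i \<in> A" "u' i \<in> space M"
      using i u v v_space by (auto simp: u'_def)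
    show "linear (t' i)"
      using i s_lin t by (auto simp: lt t'_k intro!: linear_compose_sub linear_compose_scale_right[where 'b=real, unfolded real_scaleR_def])
    show "t' i \<in> borel_measurable M"
      using i s_meas t by (auto simp: lt t'_k)
    fix j assume j: "j < Suc k"
    have sv: "s v = 1" using v by (simp add: s_def)
    have su: "s (u j) = 0" if "j < k" using that by (simp add: s_def f_u)
    show "t' i (u' j) = (if i = j then 1 else 0)"
      using i j sv su tu unfolding lt by (auto simp: u'_k t'_k)
  next
    fix x i assume x: "x \<in> A" and i: "i < Suc k"
    show "\<bar>t' i (x - x0)\<bar> \<le> 2 * 3 ^ Suc k"
    proof (cases "i = k")
      case True
      have "(1::real) \<le> 3 ^ Suc k" by (rule one_le_power) simp
      then have "(2::real) \<le> 2 * 3 ^ Suc k" by simp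
      with True s_bd[OF x] show ?thesis by (simp add: t'_k)
    next
      case False
      with i have ik: "i < k" by simp
      have "\<bar>t i v\<bar> * \<bar>s (x - x0)\<bar> \<le> (2 * 3 ^ k) * 2"
        using bd[OF ik v(1)] s_bd[OF x] by (intro mult_mono) auto
      then have "\<bar>t i v * s (x - x0)\<bar> \<le> 2 * (2 * 3 ^ k)" by (simp add: abs_mult)
      with bd[OF ik x] ik show ?thesis by (simp add: t'_k)
    qed
  next
    fix x j assume x: "x \<in> space M" and j: "j < Suc k"
    have "(\<Sum>i<Suc k. t' i x *\<^sub>R u' i) = (\<Sum>i<k. (t i x - t i v * s x) *\<^sub>R u i) + s x *\<^sub>R v"
      by (simp add: u'_k t'_k)
    also have "\<dots> = (\<Sum>i<k. t i x *\<^sub>R u i) - s x *\<^sub>R (\<Sum>i<k. t i v *\<^sub>R u i) + s x *\<^sub>R v"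
      by (simp add: scaleR_diff_left sum_subtractf scaleR_sum_right mult.commute)
    finally have "x - (\<Sum>i<Suc k. t' i x *\<^sub>R u' i) = P x - s x *\<^sub>R P v"
      by (simp add: P_def scaleR_diff_right)
    then have "X j (x - (\<Sum>i<Suc k. t' i x *\<^sub>R u' i)) = X j (P x) - s x * X j (P v)"
      by (simp add: X_simps)
    also have "\<dots> = 0"
      using j res[OF x] res[OF v_space] v(2) by (auto simp: lt s_def f_def)
    finally show "X j (x - (\<Sum>i<Suc k. t' i x *\<^sub>R u' i)) = 0" .
  next
    fix i j assume "i < Suc k" "j < n" "Suc k \<le> j"
    then show "t' i (e j) = 0"
      using te[of i j] f_e[of j] by (auto simp: t'_def s_def)
  qed
  then show ?thesis by blast
qed

lemma frame_exists:
  obtains x0 u t where "x0 \<in> A" "partial_frame x0 u t n"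
    "\<And>x. x \<in> space M \<Longrightarrow> x = (\<Sum>i<n. t i x *\<^sub>R u i)"
proof -
  obtain x0 where x0: "x0 \<in> A"
    using A0_sub A0_pos by (cases "A0 = {}") auto
  have "\<exists>u t. partial_frame x0 u t k" if "k \<le> n" for k
    using that
  proof (induction k)
    case 0
    then show ?case by (simp add: partial_frame_def)
  next
    case (Suc k)
    then show ?case using partial_frame_Suc[OF x0] by (metis Suc_leD Suc_le_lessD)
  qed
  then obtain u t where ut: "partial_frame x0 u t n" by blast
  have "x = (\<Sum>i<n. t i x *\<^sub>R u i)" if x: "x \<in> space M" for x
  proof -
    have "x - (\<Sum>i<n. t i x *\<^sub>R u i) = 0"
      using ut x by (intro X_eqI diff_space sum_space) (auto simp: partial_frame_def)
    then show ?thesis by simp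
  qed
  with x0 ut show ?thesis by (rule that)
qed

end

subsection \<open>The torus spanned by the corners\<close>

text \<open>The corners are the vertices of the parallelepiped spanned by \<open>u\<close>,
  including the origin for empty \<open>s\<close>. The bound on the coordinates is a power of two
  because it is undone by contractions towards the origin.\<close>

locale cornered = small_doubling M n X e A A0 B d
  for M :: "'a::real_vector measure" and n X e A A0 B d +
  fixes u :: "nat \<Rightarrow> 'a" and t :: "nat \<Rightarrow> 'a \<Rightarrow> real" and q :: nat
  assumes u_space: "i < n \<Longrightarrow> u i \<in> space M"
    and t_lin: "i < n \<Longrightarrow> linear (t i)"
    and t_meas: "i < n \<Longrightarrow> t i \<in> borel_measurable M"
    and t_u: "i < n \<Longrightarrow> j < n \<Longrightarrow> t i (u j) = (if i = j then 1 else 0)"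
    and expansion: "x \<in> space M \<Longrightarrow> x = (\<Sum>i<n. t i x *\<^sub>R u i)"
    and corner: "s \<subseteq> {..<n} \<Longrightarrow> (\<Sum>i\<in>s. u i) \<in> A"
    and t_bound: "x \<in> A \<Longrightarrow> i < n \<Longrightarrow> \<bar>t i x\<bar> \<le> 2 ^ q"
begin

definition Q where "Q = {x \<in> space M. \<forall>i<n. 0 \<le> t i x \<and> t i x < 1}"

text \<open>Reduction modulo the lattice generated by the \<open>u i\<close>: addition followed by
  \<open>fr\<close> is the group law of the torus on \<open>Q\<close>.\<close>

definition fr where "fr x = x - (\<Sum>i<n. of_int \<lfloor>t i x\<rfloor> *\<^sub>R u i)"

definition E where "E = A0 \<inter> Q"

definition b where "b = measure M E"

text \<open>Half the measure of the symmetric difference of \<open>E\<close> and its torus translate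
  by \<open>x\<close>. It is subadditive and even, like a seminorm; the almost periods are the
  \<open>x\<close> where it is small.\<close>

definition psi where "psi x = measure M {y \<in> E. fr (x + y) \<notin> E}"

text \<open>A contraction towards a point of \<open>E\<close> loses at most \<open>d * a\<close>,
  doubling at most \<open>2 ^ n * (d * a)\<close>; the outer factor \<open>2 ^ n\<close> undoes the
  contraction in \<open>psi_E\<close>.\<close>

definition k1 where "k1 = 2 ^ n * ((1 + 2 ^ n) * (d * a))"

section \<open>Frame coordinates, lattice reduction and translations of the torus\<close>

lemma t_simps:
  assumes "i < n"
  shows "t i (x + y) = t i x + t i y" "t i (x - y) = t i x - t i y" "t i (- x) = - t i x"
    "t i (c *\<^sub>R x) = c * t i x" "t i 0 = 0"
  using t_lin[OF assms]
  by (auto simp: linear_add linear_diff linear_scale linear_0 linear_neg)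

lemma t_sum:
  assumes i: "i < n" and s: "s \<subseteq> {..<n}"
  shows "t i (\<Sum>j\<in>s. c j *\<^sub>R u j) = (if i \<in> s then c i else 0)"
proof -
  have fin: "finite s" using s finite_subset by blast
  have "t i (\<Sum>j\<in>s. c j *\<^sub>R u j) = (\<Sum>j\<in>s. c j * t i (u j))"
    using i by (simp add: linear_sum[OF t_lin] t_simps)
  also have "\<dots> = (\<Sum>j\<in>s. if i = j then c j else 0)"
    using i s by (intro sum.cong) (auto simp: t_u)
  finally show ?thesis using fin by simp
qed

lemma t_sum_u:
  assumes "i < n" "s \<subseteq> {..<n}"
  shows "t i (\<Sum>j\<in>s. u j) = (if i \<in> s then 1 else 0)"
  using t_sum[OF assms, of "\<lambda>_. 1"] by simp

lemma coord_eqI: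
  assumes "x \<in> space M" "y \<in> space M" "\<And>i. i < n \<Longrightarrow> t i x = t i y"
  shows "x = y"
proof -
  have "x = (\<Sum>i<n. t i x *\<^sub>R u i)" by (rule expansion) fact
  also have "\<dots> = (\<Sum>i<n. t i y *\<^sub>R u i)" using assms by (intro sum.cong) auto
  also have "\<dots> = y" by (rule expansion[symmetric]) fact
  finally show ?thesis .
qed

lemma fr_space [simp, intro]: "x \<in> space M \<Longrightarrow> fr x \<in> space M"
  unfolding fr_def using u_space by (intro diff_space sum_space scale_space) auto

lemma t_fr: "i < n \<Longrightarrow> t i (fr x) = frac (t i x)"
  by (simp add: fr_def t_simps t_sum frac_def)

lemma Q_space: "Q \<subseteq> space M" by (auto simp: Q_def)

lemma fr_Q: "x \<in> space M \<Longrightarrow> fr x \<in> Q"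
  by (auto simp: Q_def t_fr frac_lt_1)

lemma fr_id: "x \<in> Q \<Longrightarrow> fr x = x"
  by (rule coord_eqI) (auto simp: Q_def t_fr frac_eq)

lemma fr_eqI:
  assumes "x \<in> space M" "y \<in> space M" "\<And>i. i < n \<Longrightarrow> t i x - t i y \<in> \<int>"
  shows "fr x = fr y"
proof (rule coord_eqI)
  fix i assume i: "i < n"
  have "frac (t i y + (t i x - t i y)) = frac (t i y)"
    using assms(3)[OF i] by (rule frac_add_int_right)
  with i show "t i (fr x) = t i (fr y)" by (simp add: t_fr)
qed (use assms in auto)

lemma fr_diff_Ints: "i < n \<Longrightarrow> t i x - t i (fr x) \<in> \<int>"
  by (simp add: t_fr frac_def)

lemma fr_add:
  assumes "x \<in> space M" "y \<in> space M"
  shows "fr (fr x + y) = fr (x + y)" "fr (y + fr x) = fr (y + x)"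
proof -
  have "t i (fr x) - t i x \<in> \<int>" if "i < n" for i
    using fr_diff_Ints[OF that, of x] by (metis Ints_minus minus_diff_eq)
  then show "fr (fr x + y) = fr (x + y)" "fr (y + fr x) = fr (y + x)"
    using assms by (auto intro!: fr_eqI simp: t_simps)
qed

lemma measurable_fr [measurable]: "fr \<in> measurable M M"
proof (rule measurable_coordI)
  fix i assume i: "i < n"
  have "(\<lambda>x. X i (fr x)) = (\<lambda>x. X i x - (\<Sum>j<n. of_int \<lfloor>t j x\<rfloor> * X i (u j)))"
    by (simp add: fr_def X_simps)
  also have "\<dots> \<in> borel_measurable M"
  proof (intro borel_measurable_diff borel_measurable_sum borel_measurable_times X_measurable i)
    fix j assume "j \<in> {..<n}"
    with t_meas have [measurable]: "t j \<in> borel_measurable M" by auto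
    show "(\<lambda>x. real_of_int \<lfloor>t j x\<rfloor>) \<in> borel_measurable M" by measurable
  qed auto
  finally show "(\<lambda>x. X i (fr x)) \<in> borel_measurable M" .
qed auto

lemma measurable_translation [measurable]:
  assumes "x \<in> space M" shows "(\<lambda>y. x + y) \<in> measurable M M"
  using measurable_affine[OF assms, of 1] by simp

lemma Q_sets [measurable]: "Q \<in> sets M"
  unfolding Q_def
proof (rule sets_all_less)
  fix i assume "i < n"
  note t_meas[OF this, measurable]
  show "{x \<in> space M. 0 \<le> t i x \<and> t i x < 1} \<in> sets M" by measurable
qed

lemma Q_fmeas: "Q \<in> fmeasurable M"
proof -
  define r where "r = (\<Sum>j<n. \<Sum>i<n. \<bar>X j (u i)\<bar>)"
  have "Q \<subseteq> {x \<in> space M. \<forall>i<n. \<bar>X i x\<bar> \<le> r}"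
  proof safe
    fix x j assume x: "x \<in> Q" and j: "j < n"
    have "X j x = X j (\<Sum>i<n. t i x *\<^sub>R u i)" using expansion x Q_space by (metis subsetD)
    also have "\<dots> = (\<Sum>i<n. t i x * X j (u i))" by (simp add: X_simps)
    also have "\<bar>\<dots>\<bar> \<le> (\<Sum>i<n. \<bar>t i x * X j (u i)\<bar>)" by (rule sum_abs)
    also have "\<dots> \<le> (\<Sum>i<n. 1 * \<bar>X j (u i)\<bar>)"
    proof (rule sum_mono)
      fix i assume "i \<in> {..<n}"
      then have "\<bar>t i x\<bar> \<le> 1" using x by (auto simp: Q_def)
      then show "\<bar>t i x * X j (u i)\<bar> \<le> 1 * \<bar>X j (u i)\<bar>"
        unfolding abs_mult by (rule mult_right_mono) simp
    qed
    also have "\<dots> \<le> r" unfolding r_def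
      using j by (simp, intro member_le_sum) (auto intro!: sum_nonneg)
    finally show "\<bar>X j x\<bar> \<le> r" .
  qed (use Q_space in auto)
  then have "emeasure M Q \<le> emeasure M {x \<in> space M. \<forall>i<n. \<bar>X i x\<bar> \<le> r}"
    by (intro emeasure_mono box_sets)
  with box_finite[of r] show ?thesis by (auto simp: fmeasurable_def)
qed

lemma measure_cube:
  assumes v: "v \<in> space M" and c: "c > 0"
  defines "C \<equiv> {x \<in> space M. \<forall>i<n. t i v \<le> t i x \<and> t i x < t i v + c}"
  shows "C \<in> fmeasurable M" "measure M C = c ^ n * measure M Q"
proof -
  have C: "C = (\<lambda>x. v + c *\<^sub>R x) ` Q"
  proof (intro subset_antisym subsetI)
    fix x assume x: "x \<in> C"
    have "x = v + c *\<^sub>R ((1/c) *\<^sub>R (x - v))" using c by simp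
    moreover have "(1/c) *\<^sub>R (x - v) \<in> Q"
      using x v c by (auto simp: C_def Q_def t_simps field_simps)
    ultimately show "x \<in> (\<lambda>x. v + c *\<^sub>R x) ` Q" by blast
  next
    fix x assume "x \<in> (\<lambda>x. v + c *\<^sub>R x) ` Q"
    then show "x \<in> C" using v c by (auto simp: C_def Q_def t_simps)
  qed
  show "C \<in> fmeasurable M" unfolding C by (rule affine_fmeasurable) (use v c Q_fmeas in auto)
  show "measure M C = c ^ n * measure M Q"
    unfolding C by (subst measure_affine) (use v c in auto)
qed

lemma E_sets [measurable]: "E \<in> sets M" by (simp add: E_def)

lemma E_fmeas: "E \<in> fmeasurable M"
  using A0_fmeas by (auto simp: E_def intro: fmeasurable_Int_fmeasurable)

lemma E_sub: "E \<subseteq> Q" "E \<subseteq> A0" "E \<subseteq> A" "E \<subseteq> space M"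
  using A0_sub A_space by (auto simp: E_def)

lemma fr_preimage_sets:
  assumes "x \<in> space M" "S \<in> sets M" "T \<in> sets M"
  shows "{y \<in> T. fr (x + y) \<in> S} \<in> sets M" "{y \<in> T. fr (x + y) \<notin> S} \<in> sets M"
proof -
  note assms(2,3)[measurable]
  have [measurable]: "(\<lambda>y. fr (x + y)) \<in> measurable M M"
    using measurable_compose[OF measurable_translation[OF assms(1)] measurable_fr] .
  have "{y \<in> T. fr (x + y) \<in> S} = {y \<in> space M. y \<in> T \<and> fr (x + y) \<in> S}"
    "{y \<in> T. fr (x + y) \<notin> S} = {y \<in> space M. y \<in> T \<and> fr (x + y) \<notin> S}"
    using sets.sets_into_space[OF assms(3)] by auto
  then show "{y \<in> T. fr (x + y) \<in> S} \<in> sets M" "{y \<in> T. fr (x + y) \<notin> S} \<in> sets M"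
    by simp_all
qed

text \<open>Sort the points \<open>x\<close> of the preimage by the lattice vector \<open>l\<close>
  that \<open>fr\<close> subtracts from \<open>y + x\<close>. On each of the countably many pieces
  \<open>D l\<close> the map is an ordinary translation, and the images \<open>F l\<close> partition
  \<open>S\<close>.\<close>

lemma measure_torus_translation:
  assumes y: "y \<in> space M" and S: "S \<in> sets M" "S \<subseteq> Q"
  shows "measure M {x \<in> Q. fr (y + x) \<in> S} = measure M S"
proof -
  define L where "L = {l \<in> space M. \<forall>i<n. t i l \<in> \<int>}"
  have count: "countable L"
  proof (rule countableI')
    show "inj_on (\<lambda>l. to_nat (map (\<lambda>i. \<lfloor>t i l\<rfloor>) [0..<n])) L"
    proof (rule inj_onI)
      fix l l' assume l: "l \<in> L" "l' \<in> L"
        and "to_nat (map (\<lambda>i. \<lfloor>t i l\<rfloor>) [0..<n]) = to_nat (map (\<lambda>i. \<lfloor>t i l'\<rfloor>) [0..<n])"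
      then have "\<lfloor>t i l\<rfloor> = \<lfloor>t i l'\<rfloor>" if "i < n" for i using that by simp
      moreover have "t i l = of_int \<lfloor>t i l\<rfloor>" "t i l' = of_int \<lfloor>t i l'\<rfloor>" if "i < n" for i
        using l that by (auto simp: L_def elim!: Ints_cases)
      ultimately have "t i l = t i l'" if "i < n" for i using that by metis
      then show "l = l'" using l by (intro coord_eqI) (auto simp: L_def)
    qed
  qed
  define D where "D l = {x \<in> Q. y - l + x \<in> S}" for l
  define F where "F l = (\<lambda>x. (y - l) + 1 *\<^sub>R x) ` D l" for l
  have L_space: "l \<in> space M" if "l \<in> L" for l using that by (simp add: L_def)
  have D_sets: "D l \<in> sets M" if "l \<in> L" for l
  proof -
    note S(1)[measurable]
    have [measurable]: "(\<lambda>x. y - l + x) \<in> measurable M M"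
      using y L_space[OF that] by (intro measurable_translation) auto
    have "D l = {x \<in> space M. x \<in> Q \<and> y - l + x \<in> S}" using Q_space by (auto simp: D_def)
    then show ?thesis by simp
  qed
  have F_sets: "F l \<in> sets M" if "l \<in> L" for l
    unfolding F_def using y L_space[OF that] D_sets[OF that] by (intro affine_sets) auto
  have FD: "emeasure M (F l) = emeasure M (D l)" if "l \<in> L" for l
    unfolding F_def using y L_space[OF that] D_sets[OF that] by (subst emeasure_affine) auto
  have frL: "fr (x - l) = fr x" if "x \<in> space M" "l \<in> L" for x l
    using that by (intro fr_eqI) (auto simp: L_def t_simps)
  have L_diff: "x - fr x \<in> L" if "x \<in> space M" for x
    using that by (auto simp: L_def t_simps fr_diff_Ints)
  have D_l: "l = (y + x) - fr (y + x)" "fr (y + x) \<in> S" if "x \<in> D l" "l \<in> L" for x l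
  proof -
    have x: "x \<in> space M" "y - l + x \<in> S" using that Q_space by (auto simp: D_def)
    then have "fr (y + x - l) = y + x - l" using S by (intro fr_id) (auto simp: algebra_simps)
    then have eq: "fr (y + x) = y + x - l" using frL[of "y + x" l] x y that by simp
    then show "l = (y + x) - fr (y + x)" by simp
    have "y + x - l = y - l + x" by simp
    with x show "fr (y + x) \<in> S" by (simp only: eq)
  qed
  have UD: "(\<Union>l\<in>L. D l) = {x \<in> Q. fr (y + x) \<in> S}"
  proof (intro subset_antisym subsetI)
    fix x assume x: "x \<in> {x \<in> Q. fr (y + x) \<in> S}"
    then have "x \<in> D ((y + x) - fr (y + x))" by (simp add: D_def)
    moreover have "(y + x) - fr (y + x) \<in> L" using x y Q_space by (intro L_diff) auto
    ultimately show "x \<in> (\<Union>l\<in>L. D l)" by blast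
  next
    fix x assume "x \<in> (\<Union>l\<in>L. D l)"
    then show "x \<in> {x \<in> Q. fr (y + x) \<in> S}" using D_l(2) by (auto simp: D_def)
  qed
  have F_l: "l = fr (z - y) - (z - y)" if z: "z \<in> F l" and l: "l \<in> L" for z l
  proof -
    obtain x where x: "x \<in> Q" "z = y - l + x" using z by (auto simp: F_def D_def)
    have "z - y = x - l" using x by simp
    then have "fr (z - y) = x" using frL[of x l] x l Q_space fr_id by auto
    with x show ?thesis by simp
  qed
  have UF: "(\<Union>l\<in>L. F l) = S"
  proof (intro subset_antisym subsetI)
    fix z assume z: "z \<in> S"
    then have zs: "z \<in> space M" using S Q_space by auto
    define l where "l = fr (z - y) - (z - y)"
    have "- l \<in> L" using L_diff[of "z - y"] zs y by (simp add: l_def)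
    then have "l \<in> L" using uminus_space[of "- l"] by (auto simp: L_def t_simps)
    moreover have "z \<in> F l"
      unfolding F_def
    proof
      show "z = (y - l) + 1 *\<^sub>R fr (z - y)" by (simp add: l_def)
      then show "fr (z - y) \<in> D l" using z zs y fr_Q[of "z - y"] by (simp add: D_def)
    qed
    ultimately show "z \<in> (\<Union>l\<in>L. F l)" by blast
  qed (auto simp: F_def D_def)
  have disj: "disjoint_family_on D L" "disjoint_family_on F L"
    unfolding disjoint_family_on_def using D_l(1) F_l by (metis disjoint_iff)+
  have "emeasure M {x \<in> Q. fr (y + x) \<in> S} = (\<integral>\<^sup>+l. emeasure M (D l) \<partial>count_space L)"
    unfolding UD[symmetric] by (intro emeasure_UN_countable D_sets count disj)
  also have "\<dots> = (\<integral>\<^sup>+l. emeasure M (F l) \<partial>count_space L)"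
    by (intro nn_integral_cong) (simp add: FD)
  also have "\<dots> = emeasure M S"
    unfolding UF[symmetric] by (intro emeasure_UN_countable[symmetric] F_sets count disj)
  finally show ?thesis by (simp add: measure_def)
qed

section \<open>Almost invariance under doubling on the torus\<close>

lemma measure_split:
  assumes "S \<in> fmeasurable M" "T \<in> sets M"
  shows "measure M (S \<inter> T) + measure M (S - T) = measure M S"
proof -
  have "measure M (S - (S \<inter> T)) = measure M S - measure M (S \<inter> T)"
    using assms by (intro measure_Diff) (auto simp: fmeasurable_def)
  moreover have "S - (S \<inter> T) = S - T" by auto
  ultimately show ?thesis by simp
qed

lemma contr_E:
  assumes x: "x \<in> A"
  shows "contr x ` E \<in> fmeasurable M" "measure M (contr x ` E) = (1/2) ^ n * b"
    "measure M (contr x ` E - A0) \<le> d * a"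
proof -
  have x': "set [x] \<subseteq> space M" using x A_space by auto
  have im: "contr x ` S = foldr contr [x] ` S" for S by simp
  show f: "contr x ` E \<in> fmeasurable M" unfolding im
    using measure_foldr_contr(3)[OF x' E_sets E_fmeas] .
  show "measure M (contr x ` E) = (1/2) ^ n * b" unfolding im
    using measure_foldr_contr(1)[OF x' E_sets] by (simp add: b_def)
  have "measure M (contr x ` E - A0) \<le> measure M (contr x ` A0 - A0)"
    using E_sub(2) f measure_foldr_contr(3)[OF x' A0_sets A0_fmeas]
    by (intro measure_mono_fmeasurable fmeasurable_Diff) auto
  also have "\<dots> \<le> d * a" by (rule measure_contr_diff[OF x])
  finally show "measure M (contr x ` E - A0) \<le> d * a" .
qed

lemma t_contr: "i < n \<Longrightarrow> t i (contr x y) = (t i x + t i y) / 2"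
  by (simp add: contr_def t_simps)

lemma contr_Q: "x \<in> Q \<Longrightarrow> y \<in> Q \<Longrightarrow> contr x y \<in> Q"
  unfolding Q_def mem_Collect_eq
proof (intro conjI allI impI; elim conjE)
  assume "x \<in> space M" "y \<in> space M"
  then show "contr x y \<in> space M" by (auto simp: contr_def)
next
  fix i assume i: "i < n" and "\<forall>i<n. 0 \<le> t i x \<and> t i x < 1" "\<forall>i<n. 0 \<le> t i y \<and> t i y < 1"
  then have "0 \<le> t i x \<and> t i x < 1" "0 \<le> t i y \<and> t i y < 1" by blast+
  then show "0 \<le> t i (contr x y)" "t i (contr x y) < 1" using i by (auto simp: t_contr)
qed

text \<open>The \<^term>\<open>2 ^ n\<close> half-size copies of \<^term>\<open>E\<close> at the corners tile \<^term>\<open>Q\<close>, so that almost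
  nothing of \<^term>\<open>E\<close> lies outside them: \<^term>\<open>E\<close> is almost invariant under doubling on the torus.\<close>

lemma measure_doubling_defect:
  shows "measure M {w \<in> E. fr (2 *\<^sub>R w) \<notin> E} \<le> 2 ^ n * (d * a)"
    and "{w \<in> E. fr (2 *\<^sub>R w) \<notin> E} \<in> sets M"
proof -
  define c where "c s = (\<Sum>i\<in>s. u i)" for s
  \<comment> \<open>The part of \<open>E\<close> in the half-size cell at corner \<open>c s\<close>.
    If such a point is \<open>contr (c s) y\<close> with \<open>y\<close> in \<open>E\<close>, then
    its double is \<open>c s + y\<close>, which reduces to \<open>y\<close> since \<open>c s\<close>
    is a lattice vector. So a point whose double leaves \<open>E\<close> lies outside the copy
    \<open>h s\<close>.\<close>
  define W where "W s = {w \<in> E. {i. i < n \<and> 1/2 \<le> t i w} = s}" for s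
  define h where "h s = contr (c s) ` E" for s
  let ?I = "Pow {..<n}"
  have c_A: "c s \<in> A" if "s \<in> ?I" for s unfolding c_def using that by (intro corner) auto
  have tc: "t i (c s) = (if i \<in> s then 1 else 0)" if "s \<in> ?I" "i < n" for i s
    unfolding c_def using that by (intro t_sum_u) auto
  have W_sets: "W s \<in> sets M" if s: "s \<in> ?I" for s
  proof -
    have "{i. i < n \<and> 1/2 \<le> t i w} = s \<longleftrightarrow> (\<forall>i<n. (1/2 \<le> t i w) = (i \<in> s))" for w
      using s by blast
    then have "W s = E \<inter> {w \<in> space M. \<forall>i<n. (1/2 \<le> t i w) = (i \<in> s)}"
      using E_sub(4) unfolding W_def by blast
    moreover have "{w \<in> space M. \<forall>i<n. (1/2 \<le> t i w) = (i \<in> s)} \<in> sets M"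
    proof (rule sets_all_less)
      fix i assume "i < n"
      note t_meas[OF this, measurable]
      show "{w \<in> space M. (1/2 \<le> t i w) = (i \<in> s)} \<in> sets M" by measurable
    qed
    ultimately show ?thesis by (simp only: sets.Int E_sets)
  qed
  have hW: "h s \<inter> A0 \<subseteq> W s" "h s \<subseteq> Q" if s: "s \<in> ?I" for s
  proof -
    have *: "w \<in> Q \<and> {i. i < n \<and> 1/2 \<le> t i w} = s" if w: "w \<in> h s" for w
    proof -
      obtain y where y: "y \<in> E" "w = contr (c s) y" using w by (auto simp: h_def)
      have yQ: "y \<in> Q" using y E_sub by auto
      have "c s \<in> space M" "y \<in> space M" using y c_A[OF s] A_space E_sub by auto
      then have "w \<in> space M" using y by (simp add: contr_def)
      moreover have "0 \<le> t i w \<and> t i w < 1 \<and> (1/2 \<le> t i w \<longleftrightarrow> i \<in> s)" if "i < n" for i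
        using yQ that tc[OF s that] y by (auto simp: t_contr Q_def)
      ultimately show ?thesis using s by (auto simp: Q_def)
    qed
    then show "h s \<inter> A0 \<subseteq> W s" "h s \<subseteq> Q" by (auto simp: W_def E_def)
  qed
  have h_fmeas: "h s \<in> fmeasurable M" if "s \<in> ?I" for s
    unfolding h_def using contr_E[OF c_A[OF that]] by auto
  have bad: "{w \<in> E. fr (2 *\<^sub>R w) \<notin> E} \<subseteq> (\<Union>s\<in>?I. W s - h s)"
  proof
    fix w assume w: "w \<in> {w \<in> E. fr (2 *\<^sub>R w) \<notin> E}"
    define s where "s = {i. i < n \<and> 1/2 \<le> t i w}"
    have s: "s \<in> ?I" by (auto simp: s_def)
    have "w \<notin> h s"
    proof
      assume "w \<in> h s"
      then obtain y where y: "y \<in> E" "w = contr (c s) y" by (auto simp: h_def)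
      have "y \<in> space M" "c s \<in> space M" using y c_A[OF s] A_space E_sub by auto
      then have "fr (2 *\<^sub>R w) = fr y"
        using y(2) tc[OF s] by (intro fr_eqI) (auto simp: contr_def t_simps)
      also have "\<dots> = y" using y E_sub by (intro fr_id) auto
      finally show False using w y by simp
    qed
    with w show "w \<in> (\<Union>s\<in>?I. W s - h s)" using s by (auto simp: W_def s_def)
  qed
  have W_fmeas: "W s \<in> fmeasurable M" if "s \<in> ?I" for s
    using E_fmeas _ W_sets[OF that] by (rule fmeasurableI2) (auto simp: W_def)
  have sumW: "(\<Sum>s\<in>?I. measure M (W s)) = b"
  proof -
    have "(\<Sum>s\<in>?I. measure M (W s)) = measure M (\<Union>s\<in>?I. W s)"
      using W_fmeas
      by (intro measure_UNION'[symmetric])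
         (auto simp: pairwise_def disjnt_def W_def)
    also have "(\<Union>s\<in>?I. W s) = E" by (auto simp: W_def)
    finally show ?thesis by (simp add: b_def)
  qed
  \<comment> \<open>\<open>h s\<close> has measure \<open>(1/2) ^ n * b\<close> and all but
    \<open>d * a\<close> of it lies in \<open>W s\<close>. In the sum over the \<open>2 ^ n\<close>
    corners the terms in \<open>b\<close> cancel.\<close>
  have each: "measure M (W s - h s) \<le> measure M (W s) - ((1/2) ^ n * b - d * a)" if s: "s \<in> ?I" for s
  proof -
    have "measure M (h s \<inter> A0) + measure M (h s - A0) = (1/2) ^ n * b"
      using measure_split[OF h_fmeas[OF s] A0_sets] contr_E(2)[OF c_A[OF s]] by (simp add: h_def)
    moreover have "measure M (h s - A0) \<le> d * a" using contr_E(3)[OF c_A[OF s]] by (simp add: h_def)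
    moreover have "measure M (h s \<inter> A0) \<le> measure M (W s \<inter> h s)"
      using hW(1)[OF s] W_fmeas[OF s] h_fmeas[OF s]
      by (intro measure_mono_fmeasurable fmeasurable_Int_fmeasurable) (auto simp: fmeasurableD)
    moreover have "measure M (W s \<inter> h s) + measure M (W s - h s) = measure M (W s)"
      using h_fmeas[OF s] s by (intro measure_split W_fmeas) auto
    ultimately show ?thesis by linarith
  qed
  have "(\<lambda>w. 2 *\<^sub>R w) \<in> measurable M M"
    using measurable_affine[of 0 2] by simp
  from measurable_compose[OF this measurable_fr]
  have [measurable]: "(\<lambda>w. fr (2 *\<^sub>R w)) \<in> measurable M M" .
  have "{w \<in> E. fr (2 *\<^sub>R w) \<notin> E} = {w \<in> space M. w \<in> E \<and> fr (2 *\<^sub>R w) \<notin> E}"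
    using E_sub by auto
  also have "\<dots> \<in> sets M" by measurable
  finally show S: "{w \<in> E. fr (2 *\<^sub>R w) \<notin> E} \<in> sets M" .
  have "measure M {w \<in> E. fr (2 *\<^sub>R w) \<notin> E} \<le> measure M (\<Union>s\<in>?I. W s - h s)"
    using bad S W_fmeas h_fmeas
    by (intro measure_mono_fmeasurable fmeasurable.finite_UN fmeasurable_Diff)
       (auto simp: fmeasurableD)
  also have "\<dots> \<le> (\<Sum>s\<in>?I. measure M (W s - h s))"
    using W_sets h_fmeas by (intro measure_UNION_le) (auto simp: fmeasurableD)
  also have "\<dots> \<le> (\<Sum>s\<in>?I. measure M (W s) - ((1/2) ^ n * b - d * a))"
    by (rule sum_mono[OF each])
  also have "\<dots> = b - 2 ^ n * ((1/2) ^ n * b - d * a)"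
    by (simp add: sum_subtractf sumW card_Pow)
  also have "\<dots> = 2 ^ n * (d * a)"
    by (simp add: power_one_over field_simps)
  finally show "measure M {w \<in> E. fr (2 *\<^sub>R w) \<notin> E} \<le> 2 ^ n * (d * a)" .
qed

section \<open>Almost periods of \<open>E\<close>\<close>

lemma psi_sets: "x \<in> space M \<Longrightarrow> {y \<in> E. fr (x + y) \<notin> E} \<in> sets M"
  by (intro fr_preimage_sets E_sets)

lemma psi_fmeas: "x \<in> space M \<Longrightarrow> {y \<in> E. fr (x + y) \<notin> E} \<in> fmeasurable M"
  using E_fmeas by (rule fmeasurableI2) (auto intro: psi_sets)

text \<open>For \<open>w = contr x y\<close> the double of \<open>w\<close> is \<open>x + y\<close>.
  If \<open>x + y\<close> leaves \<open>E\<close> modulo the lattice, then \<open>w\<close> either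
  is outside \<open>A0\<close>, or is a point of \<open>E\<close> whose double leaves
  \<open>E\<close>; both sets are small.\<close>

lemma psi_E:
  assumes x: "x \<in> E"
  shows "psi x \<le> k1"
proof -
  have xA: "x \<in> A" and xs: "x \<in> space M" and x': "set [x] \<subseteq> space M" using x E_sub by auto
  let ?S = "{y \<in> E. fr (x + y) \<notin> E}"
  have im: "contr x ` S = foldr contr [x] ` S" for S by simp
  have S: "?S \<in> sets M" "?S \<in> fmeasurable M" using xs by (auto intro: psi_sets psi_fmeas)
  have cS: "contr x ` ?S \<in> sets M" unfolding im by (rule measure_foldr_contr(2)[OF x' S(1)])
  have "(1/2) ^ n * psi x = measure M (contr x ` ?S)"
    unfolding im using measure_foldr_contr(1)[OF x' S(1)] by (simp add: psi_def)
  also have "\<dots> \<le> measure M ((contr x ` E - A0) \<union> {w \<in> E. fr (2 *\<^sub>R w) \<notin> E})"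
  proof (intro measure_mono_fmeasurable fmeasurable.Un)
    show "contr x ` ?S \<subseteq> (contr x ` E - A0) \<union> {w \<in> E. fr (2 *\<^sub>R w) \<notin> E}"
    proof
      fix w assume "w \<in> contr x ` ?S"
      then obtain y where y: "y \<in> E" "fr (x + y) \<notin> E" "w = contr x y" by auto
      then have "w \<in> Q" using x E_sub by (auto intro: contr_Q)
      moreover have "2 *\<^sub>R w = x + y" using y by (simp add: contr_def)
      ultimately show "w \<in> (contr x ` E - A0) \<union> {w \<in> E. fr (2 *\<^sub>R w) \<notin> E}"
        using y by (auto simp: E_def)
    qed
    show "contr x ` E - A0 \<in> fmeasurable M" using contr_E[OF xA] by (auto intro: fmeasurable_Diff)
    show "{w \<in> E. fr (2 *\<^sub>R w) \<notin> E} \<in> fmeasurable M"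
      using E_fmeas by (rule fmeasurableI2) (auto intro: measure_doubling_defect)
  qed (use cS in auto)
  also have "\<dots> \<le> measure M (contr x ` E - A0) + measure M {w \<in> E. fr (2 *\<^sub>R w) \<notin> E}"
    using contr_E(1)[OF xA] measure_doubling_defect(2) by (intro measure_Un_le) auto
  also have "\<dots> \<le> d * a + 2 ^ n * (d * a)"
    using contr_E(3)[OF xA] measure_doubling_defect(1) by (rule add_mono)
  finally show ?thesis by (simp add: k1_def power_one_over field_simps)
qed

lemma phi_psi:
  assumes "x \<in> space M"
  shows "measure M {y \<in> E. fr (x + y) \<in> E} = b - psi x"
proof -
  have "E \<inter> {y \<in> E. fr (x + y) \<in> E} = {y \<in> E. fr (x + y) \<in> E}"
    "E - {y \<in> E. fr (x + y) \<in> E} = {y \<in> E. fr (x + y) \<notin> E}" by auto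
  with measure_split[OF E_fmeas, of "{y \<in> E. fr (x + y) \<in> E}"] fr_preimage_sets(1)[OF assms E_sets E_sets]
  show ?thesis by (simp add: psi_def b_def)
qed

text \<open>A point lost by the translation by \<open>x + y\<close> is lost by \<open>x\<close>, or
  is carried by \<open>x\<close> to a point lost by \<open>y\<close>; translation preserves the
  measure of the latter set.\<close>

lemma psi_add:
  assumes x: "x \<in> space M" and y: "y \<in> space M"
  shows "psi (x + y) \<le> psi x + psi y"
proof -
  let ?T = "{z \<in> E. fr (y + z) \<notin> E}"
  have T: "?T \<in> sets M" "?T \<subseteq> Q" using psi_sets[OF y] E_sub by auto
  have P: "{z \<in> Q. fr (x + z) \<in> ?T} \<in> sets M" by (rule fr_preimage_sets(1)[OF x T(1) Q_sets])
  have "{z \<in> E. fr (x + y + z) \<notin> E} \<subseteq> {z \<in> E. fr (x + z) \<notin> E} \<union> {z \<in> Q. fr (x + z) \<in> ?T}"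
  proof
    fix z assume z: "z \<in> {z \<in> E. fr (x + y + z) \<notin> E}"
    then have "fr (y + fr (x + z)) = fr (x + y + z)"
      using fr_add(2)[of "x + z" y] x y E_sub by (auto simp: algebra_simps)
    with z show "z \<in> {z \<in> E. fr (x + z) \<notin> E} \<union> {z \<in> Q. fr (x + z) \<in> ?T}" using E_sub by auto
  qed
  then have "psi (x + y) \<le> measure M ({z \<in> E. fr (x + z) \<notin> E} \<union> {z \<in> Q. fr (x + z) \<in> ?T})"
    unfolding psi_def using P psi_fmeas[OF x] x y
    by (intro measure_mono_fmeasurable fmeasurable.Un psi_sets psi_fmeas fmeasurableI2[OF Q_fmeas _ P]) auto
  also have "\<dots> \<le> measure M {z \<in> E. fr (x + z) \<notin> E} + measure M {z \<in> Q. fr (x + z) \<in> ?T}"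
    using P psi_sets[OF x] by (intro measure_Un_le) auto
  also have "measure M {z \<in> Q. fr (x + z) \<in> ?T} = measure M ?T"
    by (rule measure_torus_translation[OF x T])
  finally show ?thesis by (simp add: psi_def)
qed

lemma psi_minus:
  assumes x: "x \<in> space M"
  shows "psi (- x) = psi x"
proof -
  let ?T = "{z \<in> E. fr (- x + z) \<in> E}"
  have T: "?T \<in> sets M" "?T \<subseteq> Q"
    using fr_preimage_sets(1)[OF uminus_space[OF x] E_sets E_sets] E_sub by auto
  have "b - psi (- x) = measure M ?T" using phi_psi[of "- x"] x by simp
  also have "\<dots> = measure M {z \<in> Q. fr (x + z) \<in> ?T}"
    by (rule measure_torus_translation[OF x T, symmetric])
  also have "{z \<in> Q. fr (x + z) \<in> ?T} = {z \<in> E. fr (x + z) \<in> E}"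
  proof -
    have "fr (- x + fr (x + z)) = z" if "z \<in> Q" for z
      using fr_add(2)[of "x + z" "- x"] that x Q_space fr_id by auto
    then show ?thesis using E_sub by auto
  qed
  also have "measure M {z \<in> E. fr (x + z) \<in> E} = b - psi x" by (rule phi_psi[OF x])
  finally show ?thesis by simp
qed

lemma psi_cong:
  assumes "x \<in> space M" "y \<in> space M" "fr x = fr y"
  shows "psi x = psi y"
proof -
  have "fr (x + z) = fr (y + z)" if "z \<in> E" for z
    using fr_add(1)[of x z] fr_add(1)[of y z] assms that E_sub by auto
  then have "{z \<in> E. fr (x + z) \<notin> E} = {z \<in> E. fr (y + z) \<notin> E}" by auto
  then show ?thesis by (simp add: psi_def)
qed

text \<open>Fubini for the pairs \<open>(x, y)\<close> with \<open>y\<close> and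
  \<open>fr (x + y)\<close> in \<open>E\<close>. For fixed \<open>y\<close> in \<open>E\<close> the
  admissible \<open>x\<close> form a torus translate of \<open>E\<close>, of measure
  \<open>b\<close>.\<close>

lemma integral_psi:
  "(\<integral>\<^sup>+x. indicator Q x * ennreal (b - psi x) \<partial>M) = ennreal (b * b)"
proof -
  interpret PP: pair_sigma_finite M M ..
  define Z where "Z = {z \<in> space (M \<Otimes>\<^sub>M M). fst z \<in> Q \<and> snd z \<in> E \<and> fr (fst z + snd z) \<in> E}"
  have [measurable]: "(\<lambda>z. fst z + snd z) \<in> measurable (M \<Otimes>\<^sub>M M) M"
    using measurable_plus by (simp add: case_prod_beta')
  have [measurable]: "(\<lambda>z. fr (fst z + snd z)) \<in> measurable (M \<Otimes>\<^sub>M M) M"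
    by (rule measurable_compose[OF _ measurable_fr]) fact
  have Z: "Z \<in> sets (M \<Otimes>\<^sub>M M)" unfolding Z_def by measurable
  have "emeasure (M \<Otimes>\<^sub>M M) Z = (\<integral>\<^sup>+x. emeasure M (Pair x -` Z) \<partial>M)"
    by (rule emeasure_pair_measure_alt[OF Z])
  also have "\<dots> = (\<integral>\<^sup>+x. indicator Q x * ennreal (b - psi x) \<partial>M)"
  proof (rule nn_integral_cong)
    fix x assume x: "x \<in> space M"
    show "emeasure M (Pair x -` Z) = indicator Q x * ennreal (b - psi x)"
    proof (cases "x \<in> Q")
      case True
      then have "Pair x -` Z = {y \<in> E. fr (x + y) \<in> E}"
        using x E_sub(4) by (auto simp: Z_def space_pair_measure)
      moreover have "{y \<in> E. fr (x + y) \<in> E} \<in> fmeasurable M"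
        using E_fmeas by (rule fmeasurableI2) (use fr_preimage_sets(1)[OF x E_sets E_sets] in auto)
      ultimately show ?thesis
        using True phi_psi[OF x] by (simp add: emeasure_eq_measure2)
    next
      case False
      then have "Pair x -` Z = {}" by (auto simp: Z_def)
      with False show ?thesis by simp
    qed
  qed
  finally have 1: "emeasure (M \<Otimes>\<^sub>M M) Z = (\<integral>\<^sup>+x. indicator Q x * ennreal (b - psi x) \<partial>M)" .
  have "emeasure (M \<Otimes>\<^sub>M M) Z = (\<integral>\<^sup>+y. emeasure M ((\<lambda>x. (x, y)) -` Z) \<partial>M)"
    by (rule PP.emeasure_pair_measure_alt2[OF Z])
  also have "\<dots> = (\<integral>\<^sup>+y. ennreal b * indicator E y \<partial>M)"
  proof (rule nn_integral_cong)
    fix y assume y: "y \<in> space M"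
    show "emeasure M ((\<lambda>x. (x, y)) -` Z) = ennreal b * indicator E y"
    proof (cases "y \<in> E")
      case True
      then have "(\<lambda>x. (x, y)) -` Z = {x \<in> Q. fr (y + x) \<in> E}"
        using y Q_space by (auto simp: Z_def space_pair_measure add.commute)
      moreover have "{x \<in> Q. fr (y + x) \<in> E} \<in> fmeasurable M"
        using Q_fmeas by (rule fmeasurableI2) (use fr_preimage_sets(1)[OF y E_sets Q_sets] in auto)
      ultimately show ?thesis
        using True measure_torus_translation[OF y E_sets E_sub(1)]
        by (simp add: emeasure_eq_measure2 b_def)
    next
      case False
      then have "(\<lambda>x. (x, y)) -` Z = {}" by (auto simp: Z_def)
      with False show ?thesis by simp
    qed
  qed
  also have "\<dots> = ennreal b * emeasure M E" by (simp add: nn_integral_cmult_indicator)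
  also have "\<dots> = ennreal (b * b)"
    using E_fmeas by (simp add: emeasure_eq_measure2 b_def ennreal_mult)
  finally show ?thesis using 1 by simp
qed

text \<open>If \<^term>\<open>psi\<close> took an intermediate value at \<^term>\<open>x\<close>, it would be intermediate on the
  translate of \<^term>\<open>E\<close> by \<^term>\<open>x\<close>, which is then disjoint from \<^term>\<open>E\<close>; together the two
  contribute too much to the integral.\<close>

lemma psi_dichotomy:
  assumes x: "x \<in> space M" and half: "psi x \<le> b / 2" and b: "4 * k1 < b"
  shows "psi x \<le> 2 * k1"
proof (rule ccontr)
  assume neg: "\<not> ?thesis"
  define F where "F = {z \<in> Q. fr (- x + z) \<in> E}"
  have F_sets: "F \<in> sets M" unfolding F_def using x by (intro fr_preimage_sets) auto
  have F_meas: "measure M F = b"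
    unfolding F_def b_def using x E_sub by (intro measure_torus_translation) auto
  have F_fmeas: "F \<in> fmeasurable M"
    using Q_fmeas by (rule fmeasurableI2) (use F_sets in \<open>auto simp: F_def\<close>)
  have k1: "0 \<le> k1" using d_nonneg by (simp add: k1_def)
  have F_psi: "psi z \<le> psi x + k1" "psi x \<le> psi z + k1" if "z \<in> F" for z
  proof -
    define y where "y = fr (- x + z)"
    have y: "y \<in> E" "y \<in> space M" and z: "z \<in> space M"
      using that E_sub(4) Q_space by (auto simp: F_def y_def)
    have "fr (x + y) = fr (x + (- x + z))" unfolding y_def using x z by (intro fr_add) auto
    then have fz: "psi z = psi (x + y)" using x y z by (intro psi_cong) auto
    have "psi (x + y) \<le> psi x + psi y" using x y by (intro psi_add)
    moreover have "psi (x + y + - y) \<le> psi (x + y) + psi (- y)" using x y by (intro psi_add) auto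
    moreover have "psi (- y) = psi y" using y by (intro psi_minus)
    moreover have "psi y \<le> k1" using y by (intro psi_E)
    ultimately show "psi z \<le> psi x + k1" "psi x \<le> psi z + k1" using fz by simp_all
  qed
  \<comment> \<open>On \<open>F\<close>, \<open>psi\<close> is at least \<open>psi x - k1\<close>,
    which exceeds \<open>k1\<close>, whereas on \<open>E\<close> it is at most
    \<open>k1\<close>.\<close>
  have disj: "E \<inter> F = {}"
    using F_psi(2) psi_E neg by fastforce
  \<comment> \<open>Lower bounds for the integrand \<open>b - psi\<close>: \<open>b - k1\<close> on
    \<open>E\<close> and, as \<open>psi x \<le> b / 2\<close>, \<open>b / 2 - k1\<close> on
    \<open>F\<close>. Comparison with \<open>b * b\<close> would force
    \<open>b \<le> 4 * k1\<close>.\<close>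
  have "ennreal ((b - k1) * b + (b / 2 - k1) * b)
      = ennreal (b - k1) * emeasure M E + ennreal (b / 2 - k1) * emeasure M F"
    using E_fmeas F_fmeas F_meas b k1
    by (simp add: emeasure_eq_measure2 b_def[symmetric] ennreal_mult[symmetric])
  also have "\<dots> = (\<integral>\<^sup>+z. ennreal (b - k1) * indicator E z + ennreal (b / 2 - k1) * indicator F z \<partial>M)"
    using F_sets by (simp add: nn_integral_add nn_integral_cmult_indicator)
  also have "\<dots> \<le> (\<integral>\<^sup>+z. indicator Q z * ennreal (b - psi z) \<partial>M)"
  proof (rule nn_integral_mono)
    fix z assume "z \<in> space M"
    consider "z \<in> E" "z \<notin> F" | "z \<notin> E" "z \<in> F" | "z \<notin> E" "z \<notin> F" using disj by blast
    then show "ennreal (b - k1) * indicator E z + ennreal (b / 2 - k1) * indicator F z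
      \<le> indicator Q z * ennreal (b - psi z)"
    proof cases
      case 1
      then have "z \<in> Q" using E_sub by auto
      with 1 psi_E[of z] show ?thesis by (simp add: ennreal_leI)
    next
      case 2
      then have "z \<in> Q" by (simp add: F_def)
      with 2 F_psi(1)[of z] half show ?thesis by (simp add: ennreal_leI)
    qed simp
  qed
  also have "\<dots> = ennreal (b * b)" by (rule integral_psi)
  finally have "(b - k1) * b + (b / 2 - k1) * b \<le> b * b"
    by (subst (asm) ennreal_le_iff) auto
  then have "b * (b / 2 - 2 * k1) \<le> 0" by (simp add: algebra_simps)
  moreover have "0 < b * (b / 2 - 2 * k1)" using b k1 by (intro mult_pos_pos) auto
  ultimately show False by simp
qed

text \<open>Adding \<open>x\<close> once more gives a defect of at most \<open>4 * k1\<close>, below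
  \<open>b / 2\<close>, and the dichotomy resets it to \<open>2 * k1\<close>. So errors do not
  accumulate with \<open>m\<close>.\<close>

lemma psi_scale:
  assumes x: "x \<in> space M" and small: "psi x \<le> 2 * k1" and b: "8 * k1 < b"
  shows "psi (real m *\<^sub>R x) \<le> 2 * k1"
proof (induction m)
  case 0
  have "{y \<in> E. fr (0 + y) \<notin> E} = {}" using E_sub fr_id by auto
  then have "psi 0 = 0" by (simp only: psi_def measure_empty)
  then show ?case using d_nonneg by (simp add: k1_def)
next
  case (Suc m)
  have k1: "0 \<le> k1" using d_nonneg by (simp add: k1_def)
  have "psi (real (Suc m) *\<^sub>R x) = psi (x + real m *\<^sub>R x)" by (simp add: scaleR_add_left)
  also have "\<dots> \<le> psi x + psi (real m *\<^sub>R x)" using x by (intro psi_add) auto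
  also have "\<dots> \<le> b / 2" using Suc small b by simp
  finally show ?case using x b k1 by (intro psi_dichotomy) auto
qed

text \<open>By pigeonhole some multiple of every vector is an almost period of \<^term>\<open>E\<close>, and vectors
  are divisible.\<close>

lemma psi_small:
  assumes v: "v \<in> space M" and b: "8 * k1 < b"
  shows "psi v \<le> 2 * k1"
proof -
  have k1: "0 \<le> k1" using d_nonneg by (simp add: k1_def)
  with b have b_pos: "0 < b" by simp
  obtain m :: nat where m: "measure M Q < real m * b"
    using reals_Archimedean3[OF b_pos] by blast
  \<comment> \<open>The factorial makes every difference of two indices below \<open>m\<close> a
    divisor: whichever pair the pigeonhole yields, \<open>v\<close> is an integer multiple of
    \<open>real (j - i) *\<^sub>R w\<close>.\<close>
  define w where "w = (1 / fact m) *\<^sub>R v"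
  have w: "w \<in> space M" using v by (simp add: w_def)
  \<comment> \<open>The torus translate of \<open>E\<close> by \<open>real j *\<^sub>R w\<close>. A
    point common to two translates exhibits \<open>real (j - i) *\<^sub>R w\<close>, modulo the
    lattice, as a difference of two points of \<open>E\<close>, whose defect is at most
    \<open>2 * k1\<close>.\<close>
  define F where "F j = {z \<in> Q. fr ((- real j) *\<^sub>R w + z) \<in> E}" for j :: nat
  have F_sets: "F j \<in> sets M" for j unfolding F_def using w by (intro fr_preimage_sets) auto
  have F_meas: "measure M (F j) = b" for j
    unfolding F_def b_def using w E_sub by (intro measure_torus_translation) auto
  have F_fmeas: "F j \<in> fmeasurable M" for j
    using Q_fmeas by (rule fmeasurableI2) (use F_sets in \<open>auto simp: F_def\<close>)
  have "\<exists>i j. i < j \<and> j < m \<and> F i \<inter> F j \<noteq> {}"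
  proof (rule ccontr)
    assume "\<not> ?thesis"
    then have disj: "F i \<inter> F j = {}" if "i < m" "j < m" "i \<noteq> j" for i j
      using that by (metis Int_commute linorder_neqE_nat)
    have "real m * b = (\<Sum>j<m. measure M (F j))" by (simp add: F_meas)
    also have "\<dots> = measure M (\<Union>j<m. F j)"
      using F_fmeas disj by (intro measure_UNION'[symmetric]) (auto simp: pairwise_def disjnt_def)
    also have "\<dots> \<le> measure M Q"
      using F_sets Q_fmeas by (intro measure_mono_fmeasurable) (auto simp: F_def)
    finally show False using m by simp
  qed
  then obtain i j z where ij: "i < j" "j < m" and z: "z \<in> F i" "z \<in> F j" by blast
  define x where "x = fr ((- real i) *\<^sub>R w + z)"
  define y where "y = fr ((- real j) *\<^sub>R w + z)"
  have xy: "x \<in> E" "y \<in> E" "x \<in> space M" "y \<in> space M" and zs: "z \<in> space M"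
    using z Q_space E_sub(4) by (auto simp: F_def x_def y_def)
  have "fr (x + - y) = fr (real (j - i) *\<^sub>R w)"
  proof (rule fr_eqI)
    fix l assume l: "l < n"
    have "t l (x + - y) - t l (real (j - i) *\<^sub>R w)
      = (t l ((- real j) *\<^sub>R w + z) - t l y) - (t l ((- real i) *\<^sub>R w + z) - t l x)"
      using l ij by (simp add: t_simps of_nat_diff algebra_simps)
    also have "\<dots> \<in> \<int>" unfolding x_def y_def by (intro Ints_diff fr_diff_Ints l)
    finally show "t l (x + - y) - t l (real (j - i) *\<^sub>R w) \<in> \<int>" .
  qed (use xy w in auto)
  then have "psi (real (j - i) *\<^sub>R w) = psi (x + - y)" using xy w by (intro psi_cong) auto
  also have "\<dots> \<le> psi x + psi (- y)" using xy by (intro psi_add) auto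
  also have "\<dots> \<le> k1 + k1" using xy psi_minus[of y] psi_E by (intro add_mono) auto
  finally have small: "psi (real (j - i) *\<^sub>R w) \<le> 2 * k1" by simp
  have "(j - i) dvd fact m" using ij by (intro dvd_fact) auto
  then obtain l where l: "fact m = (j - i) * l" by (elim dvdE)
  have "v = (fact m) *\<^sub>R w" by (simp add: w_def)
  also have "(fact m :: real) = of_nat (fact m)" by (simp only: of_nat_fact)
  also have "\<dots> *\<^sub>R w = real l *\<^sub>R (real (j - i) *\<^sub>R w)" unfolding l by simp
  finally show ?thesis using psi_scale[OF _ small b, of l] w by simp
qed

text \<open>Once \<open>psi\<close> is at most \<open>2 * k1\<close> everywhere,
  \<open>integral_psi\<close> gives \<open>(b - 2 * k1) * measure M Q \<le> b * b\<close>, and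
  \<open>2 * k1\<close> is less than \<open>b / 16\<close>.\<close>

lemma dense_in_Q:
  assumes b: "32 * k1 < b"
  shows "15 / 16 * measure M Q \<le> b"
proof -
  have k1: "0 \<le> k1" using d_nonneg by (simp add: k1_def)
  have "ennreal ((b - 2 * k1) * measure M Q) = (\<integral>\<^sup>+z. ennreal (b - 2 * k1) * indicator Q z \<partial>M)"
    using b k1 Q_fmeas by (simp add: nn_integral_cmult_indicator emeasure_eq_measure2 ennreal_mult)
  also have "\<dots> \<le> (\<integral>\<^sup>+z. indicator Q z * ennreal (b - psi z) \<partial>M)"
  proof (rule nn_integral_mono)
    fix z assume "z \<in> space M"
    then have "psi z \<le> 2 * k1" using b k1 by (intro psi_small) auto
    then show "ennreal (b - 2 * k1) * indicator Q z \<le> indicator Q z * ennreal (b - psi z)"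
      by (auto simp: indicator_def ennreal_leI)
  qed
  also have "\<dots> = ennreal (b * b)" by (rule integral_psi)
  finally have le: "(b - 2 * k1) * measure M Q \<le> b * b"
    by (subst (asm) ennreal_le_iff) auto
  have "b * (15 / 16 * measure M Q) = (15 / 16 * b) * measure M Q" by simp
  also have "\<dots> \<le> (b - 2 * k1) * measure M Q" using b by (intro mult_right_mono) auto
  finally have "b * (15 / 16 * measure M Q) \<le> b * b" using le by simp
  then show ?thesis using b k1 by (subst (asm) mult_le_cancel_left_pos) auto
qed

text \<open>Contracting \<open>A0\<close> \<open>q + 1\<close> times towards the origin and then
  once towards the opposite vertex leaves all coordinates within 1/4 of 1/2, so the image lies in
  \<open>Q\<close>, and it is almost contained in \<open>A0\<close>.\<close>

lemma b_lower:
  "(1/2) ^ (n * (q + 2)) * a - 2 * d * a \<le> b"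
proof -
  define xs where "xs = (\<Sum>i<n. u i) # replicate (q + 1) (\<Sum>i\<in>{}. u i)"
  have xs: "set xs \<subseteq> A" unfolding xs_def using corner[of "{..<n}"] corner[of "{}"] by auto
  then have xs': "set xs \<subseteq> space M" using A_space by auto
  have len: "length xs = q + 2" by (simp add: xs_def)
  have fold_eq: "foldr contr xs y = (1/2) *\<^sub>R (\<Sum>i<n. u i) + (1/2) ^ (q + 2) *\<^sub>R y" for y
  proof -
    have "foldr contr xs y = contr (\<Sum>i<n. u i) (foldr contr (replicate (q + 1) 0) y)"
      by (simp add: xs_def)
    also have "\<dots> = contr (\<Sum>i<n. u i) ((1/2) ^ (q + 1) *\<^sub>R y)"
      by (simp only: foldr_contr_replicate) simp
    finally show ?thesis by (simp add: contr_def scaleR_add_right)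
  qed
  have sub: "foldr contr xs ` A0 \<subseteq> Q"
  proof
    fix z assume "z \<in> foldr contr xs ` A0"
    then obtain y where y: "y \<in> A" "z = foldr contr xs y" using A0_sub by auto
    then have zs: "z \<in> space M" using xs' A_space by (auto intro: foldr_contr_space)
    have "0 \<le> t i z \<and> t i z < 1" if i: "i < n" for i
    proof -
      have "t i z = 1/2 + (1/2) ^ (q + 2) * t i y"
        using i y(2) by (simp add: fold_eq t_simps t_sum_u)
      moreover have "\<bar>(1/2) ^ (q + 2) * t i y\<bar> \<le> (1/2) ^ (q + 2) * 2 ^ q"
        unfolding abs_mult using t_bound[OF y(1) i] by (intro mult_mono) auto
      moreover have "(1/2) ^ (q + 2) * 2 ^ q = (1/4 :: real)"
        by (simp add: power_add power_one_over)
      ultimately show ?thesis by linarith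
    qed
    with zs show "z \<in> Q" by (auto simp: Q_def)
  qed
  have fm: "foldr contr xs ` A0 \<in> fmeasurable M" by (rule measure_foldr_contr(3)[OF xs' A0_sets A0_fmeas])
  have "(1/2) ^ (n * (q + 2)) * a = measure M (foldr contr xs ` A0)"
    using measure_foldr_contr(1)[OF xs' A0_sets] by (simp add: len)
  also have "\<dots> = measure M (foldr contr xs ` A0 \<inter> A0) + measure M (foldr contr xs ` A0 - A0)"
    by (rule measure_split[OF fm A0_sets, symmetric])
  also have "measure M (foldr contr xs ` A0 \<inter> A0) \<le> b"
    unfolding b_def using sub E_fmeas fm
    by (intro measure_mono_fmeasurable) (auto simp: E_def)
  also have "measure M (foldr contr xs ` A0 - A0) \<le> 2 * d * a" by (rule measure_foldr_contr_diff[OF xs])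
  finally show ?thesis by simp
qed

text \<open>The exponent yields \<open>32 * k1 < b\<close> through \<open>b_lower\<close>: the
  coefficient \<open>32 * (2 ^ n * (1 + 2 ^ n)) + 2\<close> of \<open>d\<close> is at most
  \<open>66 * 4 ^ n\<close>, less than \<open>2 ^ (2 * n + 7)\<close>.\<close>

lemma Q_dense:
  assumes d: "d * 2 ^ (n * (q + 2) + 2 * n + 7) \<le> 1"
  shows "measure M (Q - A0) \<le> measure M Q / 16"
proof -
  have dpos: "0 \<le> d" by (rule d_nonneg)
  let ?x = "d * 2 ^ (n * (q + 2))"
  have "(2::real) ^ (n * (q + 2) + 2 * n + 7) = 2 ^ (n * (q + 2)) * (2 ^ (2 * n) * 128)"
    by (simp only: power_add) simp
  with d have "?x * (2 ^ (2 * n) * 128) \<le> 1" by (simp only: mult.assoc)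
  moreover have x_nonneg: "0 \<le> ?x" using dpos by simp
  have p: "(1::real) \<le> 2 ^ n" "(2::real) ^ (2 * n) = 2 ^ n * 2 ^ n" by (simp_all add: power_add mult_2)
  have "32 * (2 ^ n * (1 + 2 ^ n)) + 2 < (2::real) ^ (2 * n) * 128"
  proof -
    have "(2::real) ^ n \<le> 2 ^ n * 2 ^ n" using p(1) by simp
    moreover have "(1::real) \<le> 2 ^ n * 2 ^ n" using p(1) by (metis mult_mono' mult_1 zero_le_one)
    moreover have "32 * (2 ^ n * (1 + 2 ^ n)) + 2 = 32 * 2 ^ n + 32 * (2 ^ n * 2 ^ n) + (2::real)"
      by (simp add: algebra_simps)
    ultimately show ?thesis unfolding p by linarith
  qed
  then have "?x * (32 * (2 ^ n * (1 + 2 ^ n)) + 2) < ?x * (2 ^ (2 * n) * 128)" if "d \<noteq> 0"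
    using dpos that by (intro mult_strict_left_mono) auto
  then have "d = 0 \<or> ?x * (32 * (2 ^ n * (1 + 2 ^ n)) + 2) < ?x * (2 ^ (2 * n) * 128)" by blast
  ultimately have "?x * (32 * (2 ^ n * (1 + 2 ^ n)) + 2) < 1" by auto
  then have "32 * (2 ^ n * (1 + 2 ^ n)) * d + 2 * d < (1/2) ^ (n * (q + 2))"
    by (simp add: power_one_over field_simps)
  then have "(32 * (2 ^ n * (1 + 2 ^ n)) * d + 2 * d) * a < (1/2) ^ (n * (q + 2)) * a"
    using A0_pos by (intro mult_strict_right_mono)
  then have "32 * k1 < b" using b_lower by (simp add: k1_def algebra_simps)
  then have "15 / 16 * measure M Q \<le> b" by (rule dense_in_Q)
  moreover have "measure M (Q \<inter> A0) + measure M (Q - A0) = measure M Q"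
    by (rule measure_split[OF Q_fmeas A0_sets])
  ultimately show ?thesis by (simp add: b_def E_def Int_commute)
qed

end

subsection \<open>Filling the convex hull\<close>

text \<open>Caratheodory's theorem, with a finite spanning set in the role of the dimension. A
  representing set of least size cannot be affinely dependent.\<close>

lemma caratheodory_span:
  fixes A :: "'a::real_vector set"
  assumes B: "finite B" "A \<subseteq> span B" and z: "z \<in> convex hull A"
  shows "\<exists>S. finite S \<and> S \<subseteq> A \<and> card S \<le> card B + 1 \<and> z \<in> convex hull S"
proof -
  define P where "P k \<longleftrightarrow> (\<exists>S. finite S \<and> S \<subseteq> A \<and> card S = k \<and> z \<in> convex hull S)" for k
  obtain S0 w0 where S0: "finite S0" "S0 \<subseteq> A" "\<forall>x\<in>S0. 0 \<le> w0 x" "sum w0 S0 = 1"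
    "(\<Sum>v\<in>S0. w0 v *\<^sub>R v) = z"
    using z unfolding convex_hull_explicit by blast
  then have "z \<in> convex hull S0" by (auto simp: convex_hull_finite)
  with S0 have "P (card S0)" by (auto simp: P_def)
  then have "P (LEAST k. P k)" by (rule LeastI)
  then obtain S where S: "finite S" "S \<subseteq> A" "card S = (LEAST k. P k)" "z \<in> convex hull S"
    by (auto simp: P_def)
  have "card S \<le> card B + 1"
  proof (rule ccontr)
    assume big: "\<not> card S \<le> card B + 1"
    then obtain s where s: "s \<in> S" by (metis all_not_in_conv card.empty le0)
    let ?D = "(\<lambda>x. - s + x) ` (S - {s})"
    have "card ?D = card S - 1"
      using s S by (subst card_image) (auto simp: inj_on_def)
    moreover have "?D \<subseteq> span B"
      using S B s by (auto intro!: span_diff)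
    ultimately have "dependent ?D"
      using independent_span_bound[OF B(1), of ?D] big by fastforce
    then have "affine_dependent S" using affine_dependent_iff_dependent2[OF s] by simp
    then obtain w where w: "sum w S = 0" "\<exists>v\<in>S. w v \<noteq> 0" "(\<Sum>v\<in>S. w v *\<^sub>R v) = 0"
      using affine_dependent_explicit_finite[OF S(1)] by blast
    obtain c where c: "\<forall>x\<in>S. 0 \<le> c x" "sum c S = 1" "(\<Sum>v\<in>S. c v *\<^sub>R v) = z"
      using S by (auto simp: convex_hull_finite)
    define I where "I = {v \<in> S. 0 < w v}"
    have "I \<noteq> {}"
    proof
      assume "I = {}"
      then have "\<forall>v\<in>S. 0 \<le> - w v" by (force simp: I_def)
      moreover have "(\<Sum>v\<in>S. - w v) = 0" using w by (simp add: sum_negf)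
      ultimately have "\<forall>v\<in>S. - w v = 0" using S(1) by (simp add: sum_nonneg_eq_0_iff)
      with w show False by auto
    qed
    \<comment> \<open>The largest multiple of the dependency that can be subtracted with all weights
      staying nonnegative; it makes the weight of a minimising point vanish.\<close>
    define r where "r = Min ((\<lambda>v. c v / w v) ` I)"
    have fin: "finite I" using S by (simp add: I_def)
    then have "r \<in> (\<lambda>v. c v / w v) ` I" unfolding r_def using \<open>I \<noteq> {}\<close> by (intro Min_in) auto
    then obtain v where v: "v \<in> I" "r = c v / w v" by blast
    have r_le: "r \<le> c x / w x" if "x \<in> I" for x
      unfolding r_def using that fin by (intro Min_le) auto
    have r0: "0 \<le> r" using v c by (auto simp: I_def)
    define c' where "c' x = c x - r * w x" for x
    have c'0: "0 \<le> c' x" if "x \<in> S" for x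
    proof (cases "x \<in> I")
      case True
      then show ?thesis using r_le[OF True] by (auto simp: c'_def I_def field_simps)
    next
      case False
      then have "r * w x \<le> 0" using r0 that by (auto simp: I_def mult_le_0_iff)
      then show ?thesis using c that by (fastforce simp: c'_def)
    qed
    have c'v: "c' v = 0" using v by (auto simp: c'_def I_def)
    have vS: "v \<in> S" using v by (simp add: I_def)
    have "sum c' S = 1" using c w by (simp add: c'_def sum_subtractf flip: sum_distrib_left)
    moreover have "(\<Sum>x\<in>S. c' x *\<^sub>R x) = z"
    proof -
      have "(\<Sum>x\<in>S. c' x *\<^sub>R x) = (\<Sum>x\<in>S. c x *\<^sub>R x) - r *\<^sub>R (\<Sum>x\<in>S. w x *\<^sub>R x)"
        by (simp add: c'_def scaleR_diff_left sum_subtractf scaleR_sum_right)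
      then show ?thesis using c w by simp
    qed
    ultimately have "sum c' (S - {v}) = 1" "(\<Sum>x\<in>S - {v}. c' x *\<^sub>R x) = z"
      using S(1) vS c'v by (simp_all add: sum_diff1)
    with c'0 have "z \<in> convex hull (S - {v})"
      using S(1) by (auto simp: convex_hull_finite intro!: exI[of _ c'])
    then have "P (card S - 1)" unfolding P_def using S vS by (intro exI[of _ "S - {v}"]) auto
    then have "card S \<le> card S - 1" unfolding S(3) by (rule Least_le)
    with vS S(1) show False by (metis card_gt_0_iff empty_iff diff_less less_one linorder_not_le)
  qed
  with S show ?thesis by blast
qed

section \<open>Points of the hull are close to the set, and a shrunk hull consists of
  midpoints\<close>

context cornered
begin

definition near where "near s z \<longleftrightarrow> (\<exists>y\<in>A. \<forall>i<n. \<bar>t i (z - y)\<bar> \<le> s)"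

text \<open>The word \<open>x\<close> followed by \<open>k\<close> letters \<open>y\<close> maps
  \<open>A0\<close> onto a set too large to lie outside \<open>A0\<close>. Its image is clustered
  around \<open>contr x y\<close>, so some point of \<open>A0\<close> is that close.\<close>

lemma near_midpoint:
  assumes k: "2 * d < (1/2) ^ (n * (k + 1))" and x: "x \<in> A" and y: "y \<in> A"
  shows "near (2 ^ q * (1/2) ^ k) (contr x y)"
proof -
  define xs where "xs = x # replicate k y"
  have xs: "set xs \<subseteq> A" using x y by (auto simp: xs_def)
  then have xs': "set xs \<subseteq> space M" using A_space by auto
  have len: "length xs = k + 1" by (simp add: xs_def)
  have "\<not> foldr contr xs ` A0 \<inter> A0 = {}"
  proof
    assume "foldr contr xs ` A0 \<inter> A0 = {}"
    then have "foldr contr xs ` A0 - A0 = foldr contr xs ` A0" by auto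
    with measure_foldr_contr_diff[OF xs] measure_foldr_contr(1)[OF xs' A0_sets]
    have "(1/2) ^ (n * (k + 1)) * a \<le> 2 * d * a" by (simp only: len)
    moreover have "2 * d * a < (1/2) ^ (n * (k + 1)) * a"
      using k A0_pos by (intro mult_strict_right_mono)
    ultimately show False by simp
  qed
  then obtain z where z: "z \<in> A0" "foldr contr xs z \<in> A0" by auto
  have "foldr contr xs z = contr x ((1 - (1/2) ^ k) *\<^sub>R y + (1/2) ^ k *\<^sub>R z)"
    by (simp add: xs_def foldr_contr_replicate[symmetric])
  then have diff: "contr x y - foldr contr xs z = ((1/2) ^ k / 2) *\<^sub>R (y - z)"
    by (simp add: contr_def algebra_simps)
  have "\<bar>t i (contr x y - foldr contr xs z)\<bar> \<le> 2 ^ q * (1/2) ^ k" if i: "i < n" for i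
  proof -
    have "\<bar>t i (y - z)\<bar> \<le> 2 * 2 ^ q"
      using t_bound[OF y i] t_bound[of z i] z A0_sub i by (auto simp: t_simps)
    then have "(1/2) ^ k / 2 * \<bar>t i (y - z)\<bar> \<le> (1/2) ^ k / 2 * (2 * 2 ^ q)"
      by (intro mult_left_mono) auto
    then show ?thesis unfolding diff using i by (simp add: t_simps abs_mult)
  qed
  with z A0_sub show ?thesis by (auto simp: near_def)
qed

text \<open>Reading the binary digits of \<open>s\<close>, a point of the segment is the midpoint of
  an endpoint and another point of the segment. Each step halves the previous error and adds
  \<open>r\<close> by \<open>near_midpoint\<close>, so the error tends to
  \<open>2 * r\<close>.\<close>

lemma near_segment:
  assumes k: "2 * d < (1/2) ^ (n * (k + 1))" and x: "x \<in> A" and y: "y \<in> A"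
    and s: "0 \<le> s" "s \<le> 1"
  shows "near (4 * (2 ^ q * (1/2) ^ k)) ((1 - s) *\<^sub>R x + s *\<^sub>R y)"
proof -
  define r where "r = 2 ^ q * (1/2 :: real) ^ k"
  have "near (2 * 2 ^ q * (1/2) ^ m + 2 * r) ((1 - s) *\<^sub>R x + s *\<^sub>R y)" for m
    using s
  proof (induction m arbitrary: s)
    case 0
    have "\<bar>t i ((1 - s) *\<^sub>R x + s *\<^sub>R y - x)\<bar> \<le> 2 * 2 ^ q + 2 * r" if i: "i < n" for i
    proof -
      have "t i ((1 - s) *\<^sub>R x + s *\<^sub>R y - x) = s * (t i y - t i x)"
        using i by (simp add: t_simps algebra_simps)
      also have "\<bar>\<dots>\<bar> \<le> 1 * \<bar>t i y - t i x\<bar>" unfolding abs_mult using 0 by (intro mult_right_mono) auto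
      also have "\<dots> \<le> 2 * 2 ^ q" using t_bound[OF x i] t_bound[OF y i] by auto
      also have "\<dots> \<le> 2 * 2 ^ q + 2 * r" by (simp add: r_def)
      finally show ?thesis .
    qed
    with x show ?case by (auto simp: near_def)
  next
    case (Suc m)
    have "\<exists>p\<in>A. \<exists>s'. 0 \<le> s' \<and> s' \<le> 1 \<and>
      (1 - s) *\<^sub>R x + s *\<^sub>R y = contr p ((1 - s') *\<^sub>R x + s' *\<^sub>R y)"
    proof (cases "s \<le> 1/2")
      case True
      have "(1 - s) *\<^sub>R x + s *\<^sub>R y = contr x ((1 - 2 * s) *\<^sub>R x + (2 * s) *\<^sub>R y)"
      proof -
        have "1/2 + (1/2) * (1 - 2 * s) = 1 - s" by (simp add: field_simps)
        then have "(1/2) *\<^sub>R x + ((1/2) * (1 - 2 * s)) *\<^sub>R x = (1 - s) *\<^sub>R x"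
          unfolding scaleR_left_distrib[symmetric] by (rule arg_cong)
        then show ?thesis by (simp add: contr_def scaleR_add_right flip: add.assoc)
      qed
      with True Suc.prems x show ?thesis by (intro bexI[of _ x] exI[of _ "2 * s"]) auto
    next
      case False
      have "(1 - s) *\<^sub>R x + s *\<^sub>R y = contr y ((1 - (2 * s - 1)) *\<^sub>R x + (2 * s - 1) *\<^sub>R y)"
      proof -
        have "1/2 + (1/2) * (2 * s - 1) = s" by (simp add: field_simps)
        then have "(1/2) *\<^sub>R y + ((1/2) * (2 * s - 1)) *\<^sub>R y = s *\<^sub>R y"
          unfolding scaleR_left_distrib[symmetric] by (rule arg_cong)
        moreover have "contr y ((1 - (2 * s - 1)) *\<^sub>R x + (2 * s - 1) *\<^sub>R y)
          = ((1/2) * (1 - (2 * s - 1))) *\<^sub>R x + ((1/2) *\<^sub>R y + ((1/2) * (2 * s - 1)) *\<^sub>R y)"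
          by (simp add: contr_def scaleR_add_right)
        moreover have "(1/2) * (1 - (2 * s - 1)) = 1 - s" by (simp add: field_simps)
        ultimately show ?thesis by simp
      qed
      with False Suc.prems y show ?thesis by (intro bexI[of _ y] exI[of _ "2 * s - 1"]) auto
    qed
    then obtain p s' where p: "p \<in> A" and s': "0 \<le> s'" "s' \<le> 1"
      and eq: "(1 - s) *\<^sub>R x + s *\<^sub>R y = contr p ((1 - s') *\<^sub>R x + s' *\<^sub>R y)" by blast
    define z where "z = (1 - s') *\<^sub>R x + s' *\<^sub>R y"
    obtain y' where y': "y' \<in> A" "\<And>i. i < n \<Longrightarrow> \<bar>t i (z - y')\<bar> \<le> 2 * 2 ^ q * (1/2) ^ m + 2 * r"
      using Suc.IH[OF s'] by (auto simp: near_def z_def)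
    obtain y'' where y'': "y'' \<in> A" "\<And>i. i < n \<Longrightarrow> \<bar>t i (contr p y' - y'')\<bar> \<le> r"
      using near_midpoint[OF k p y'(1)] by (auto simp: near_def r_def)
    have "\<bar>t i (contr p z - y'')\<bar> \<le> 2 * 2 ^ q * (1/2) ^ Suc m + 2 * r" if i: "i < n" for i
    proof -
      have "t i (contr p z - y'') = t i (z - y') / 2 + t i (contr p y' - y'')"
        using i by (simp add: t_simps t_contr field_simps)
      also have "\<bar>\<dots>\<bar> \<le> (2 * 2 ^ q * (1/2) ^ m + 2 * r) / 2 + r"
        by (rule order_trans[OF abs_triangle_ineq])
           (use y'(2)[OF i] y''(2)[OF i] in \<open>auto intro!: add_mono divide_right_mono\<close>)
      also have "\<dots> = 2 * 2 ^ q * (1/2) ^ Suc m + 2 * r" by (simp add: field_simps)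
      finally show ?thesis .
    qed
    with y''(1) eq show ?case by (auto simp: near_def z_def)
  qed
  \<comment> \<open>After \<open>k\<close> steps the initial error has shrunk to
    \<open>2 * r\<close> as well.\<close>
  from this[of k] show ?thesis by (simp add: r_def algebra_simps)
qed

text \<open>Joining one more point costs one application of \<open>near_segment\<close>; the error
  already present is multiplied by a weight of at most 1.\<close>

lemma near_hull_finite:
  assumes k: "2 * d < (1/2) ^ (n * (k + 1))" and S: "finite S" "S \<subseteq> A" and z: "z \<in> convex hull S"
  shows "near (real (card S) * (4 * (2 ^ q * (1/2) ^ k))) z"
  using S z
proof (induction S arbitrary: z rule: finite_induct)
  case (insert x S)
  define r where "r = 4 * (2 ^ q * (1/2 :: real) ^ k)"
  have r: "0 < r" by (simp add: r_def)
  show ?case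
  proof (cases "S = {}")
    case True
    with insert have "z = x" by simp
    then have "\<forall>i<n. \<bar>t i (z - x)\<bar> \<le> r" using r by (simp add: t_simps)
    moreover have "x \<in> A" "real (card (insert x S)) * r = r" using insert True by auto
    ultimately show ?thesis unfolding near_def r_def[symmetric] by metis
  next
    case False
    then obtain c s y where cs: "0 \<le> c" "0 \<le> s" "c + s = 1" and y: "y \<in> convex hull S"
      and zeq: "z = c *\<^sub>R x + s *\<^sub>R y"
      using insert.prems by (auto simp: convex_hull_insert)
    have c: "c = 1 - s" using cs by simp
    obtain y' where y': "y' \<in> A" "\<And>i. i < n \<Longrightarrow> \<bar>t i (y - y')\<bar> \<le> real (card S) * r"
      using insert.IH[OF _ y] insert.prems by (auto simp: near_def r_def)
    obtain y'' where y'': "y'' \<in> A" "\<And>i. i < n \<Longrightarrow> \<bar>t i ((1 - s) *\<^sub>R x + s *\<^sub>R y' - y'')\<bar> \<le> r"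
      using near_segment[OF k _ y'(1), of x s] insert.prems cs by (auto simp: near_def r_def)
    have "\<bar>t i (z - y'')\<bar> \<le> real (card (insert x S)) * r" if i: "i < n" for i
    proof -
      have "t i (z - y'') = s * t i (y - y') + t i ((1 - s) *\<^sub>R x + s *\<^sub>R y' - y'')"
        using i by (simp add: zeq c t_simps algebra_simps)
      also have "\<bar>\<dots>\<bar> \<le> \<bar>s * t i (y - y')\<bar> + r" using y''(2)[OF i] by linarith
      also have "\<bar>s * t i (y - y')\<bar> \<le> 1 * (real (card S) * r)"
        unfolding abs_mult using y'(2)[OF i] cs by (intro mult_mono) auto
      finally show ?thesis using insert by (simp add: algebra_simps)
    qed
    with y'' show ?thesis by (auto simp: near_def r_def)
  qed
qed simp

lemma near_hull:
  assumes k: "2 * d < (1/2) ^ (n * (k + 1))" and z: "z \<in> convex hull A"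
  shows "near (real (n + 1) * (4 * (2 ^ q * (1/2) ^ k))) z"
proof -
  have "A \<subseteq> span (u ` {..<n})"
  proof
    fix x assume "x \<in> A"
    then have "x = (\<Sum>i<n. t i x *\<^sub>R u i)" using A_space by (intro expansion) auto
    moreover have "(\<Sum>i<n. t i x *\<^sub>R u i) \<in> span (u ` {..<n})"
      by (intro span_sum span_scale span_base) auto
    ultimately show "x \<in> span (u ` {..<n})" by simp
  qed
  from caratheodory_span[OF _ this z] obtain S where S: "finite S" "S \<subseteq> A"
    "card S \<le> card (u ` {..<n}) + 1" "z \<in> convex hull S" by auto
  have "card (u ` {..<n}) \<le> n" using card_image_le[of "{..<n}" u] by simp
  with S have "card S \<le> n + 1" by simp
  then have "real (card S) * (4 * (2 ^ q * (1/2) ^ k)) \<le> real (n + 1) * (4 * (2 ^ q * (1/2) ^ k))"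
    by (intro mult_right_mono) auto
  moreover have "near (real (card S) * (4 * (2 ^ q * (1/2) ^ k))) z"
    by (rule near_hull_finite[OF k S(1,2,4)])
  ultimately show ?thesis unfolding near_def by (meson order_trans)
qed

text \<open>\<open>A0\<close> fits into a cube of side \<open>2 ^ (q + 2)\<close> in frame
  coordinates. This turns errors proportional to \<open>a\<close> into fractions of the volume of
  \<open>Q\<close>.\<close>

lemma a_le_Q: "a \<le> 2 ^ (n * (q + 2)) * measure M Q"
proof -
  define v where "v = - ((2 ^ (q + 1)) *\<^sub>R (\<Sum>i<n. u i))"
  have v: "v \<in> space M" unfolding v_def using u_space by (intro uminus_space scale_space sum_space) auto
  have tv: "t i v = - (2 ^ (q + 1))" if "i < n" for i
    using that by (simp add: v_def t_simps t_sum_u)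
  let ?C = "{x \<in> space M. \<forall>i<n. t i v \<le> t i x \<and> t i x < t i v + 2 ^ (q + 2)}"
  have "A0 \<subseteq> ?C"
  proof
    fix x assume x: "x \<in> A0"
    have "t i v \<le> t i x \<and> t i x < t i v + 2 ^ (q + 2)" if i: "i < n" for i
    proof -
      have "\<bar>t i x\<bar> \<le> 2 ^ q" using t_bound[of x i] x A0_sub i by auto
      moreover have "(0::real) < 2 ^ q" by simp
      moreover have "(2::real) ^ (q + 1) = 2 * 2 ^ q" "(2::real) ^ (q + 2) = 4 * 2 ^ q" by simp_all
      ultimately show ?thesis unfolding tv[OF i] by linarith
    qed
    with x show "x \<in> ?C" using A0_sub A_space by auto
  qed
  then have "a \<le> measure M ?C"
    using measure_cube(1)[OF v, of "2 ^ (q + 2)"] by (intro measure_mono_fmeasurable) auto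
  also have "\<dots> = (2 ^ (q + 2)) ^ n * measure M Q"
    by (rule measure_cube(2)[OF v]) simp
  finally show ?thesis by (simp only: power_mult[symmetric] mult.commute)
qed

text \<open>Near a point of the hull there is a point \<^term>\<open>y\<close> of \<^term>\<open>A\<close>, and a small copy of \<^term>\<open>Q\<close>
  towards \<^term>\<open>y\<close> is mostly filled by \<^term>\<open>A0\<close>, so its central points are midpoints.\<close>

lemma shrunk_hull_midpoints:
  assumes d: "d * 2 ^ (n * l + n * (q + 2 * n + 5) + 7) \<le> 1" and z: "z \<in> convex hull A"
  defines "\<rho> \<equiv> (1/2 :: real) ^ l"
  shows "\<exists>x\<in>A. \<exists>y\<in>A. (1 - \<rho>) *\<^sub>R z + \<rho> *\<^sub>R ((1/2) *\<^sub>R (\<Sum>i<n. u i)) = contr x y"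
proof -
  \<comment> \<open>Makes the distance \<open>r\<close> from \<open>near_hull\<close> at most
    \<open>\<tau> * \<rho>\<close>: the summand \<open>2 * n + 4\<close> absorbs the factor
    \<open>16 * n * (n + 1)\<close>.\<close>
  define k where "k = l + q + 2 * n + 4"
  define o' where "o' = (1/2) *\<^sub>R (\<Sum>i<n. u i)"
  define r where "r = real (n + 1) * (4 * (2 ^ q * (1/2) ^ k))"
  \<comment> \<open>With this margin, Bernoulli's inequality leaves the cube of side
    \<open>1 - 2 * \<tau>\<close> at least half the volume of \<open>Q\<close>.\<close>
  define \<tau> where "\<tau> = 1 / (4 * real n)"
  have \<rho>: "0 < \<rho>" "\<rho> \<le> 1" by (auto simp: \<rho>_def power_le_one)
  have dpow: "d * 2 ^ m \<le> 1" if "m \<le> n * l + n * (q + 2 * n + 5) + 7" for m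
  proof -
    have "d * 2 ^ m \<le> d * 2 ^ (n * l + n * (q + 2 * n + 5) + 7)"
      using that d_nonneg by (intro mult_left_mono power_increasing) auto
    with d show ?thesis by simp
  qed
  have k_cond: "2 * d < (1/2) ^ (n * (k + 1))"
  proof -
    have "d * 2 ^ (n * (k + 1) + 2) \<le> 1" by (rule dpow) (simp add: k_def algebra_simps)
    then have "2 * d * 2 ^ (n * (k + 1)) < 1" using d_nonneg by simp
    then show ?thesis by (simp add: power_one_over field_simps)
  qed
  have Q16: "measure M (Q - A0) \<le> measure M Q / 16"
    by (rule Q_dense, rule dpow) (use n_pos in \<open>simp add: algebra_simps\<close>)
  have Q_pos: "0 < measure M Q"
    using a_le_Q A0_pos by (metis less_le_trans zero_less_mult_pos zero_less_numeral zero_less_power)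
  have copy: "2 ^ (n * l) * (2 * d * a) \<le> measure M Q / 16"
  proof -
    have "n \<le> n * n" by simp
    then have "d * 2 ^ (n * l + n * (q + 2) + 5) \<le> 1" by (intro dpow) (simp add: algebra_simps)
    then have le: "(d * 2 ^ (n * l + n * (q + 2) + 5)) * measure M Q \<le> measure M Q"
      by (intro mult_left_le_one_le) (use d_nonneg in auto)
    have "16 * (2 ^ (n * l) * (2 * d * a)) = (d * 2 ^ (n * l) * 32) * a" by simp
    also have "\<dots> \<le> (d * 2 ^ (n * l) * 32) * (2 ^ (n * (q + 2)) * measure M Q)"
      using a_le_Q d_nonneg by (intro mult_left_mono) auto
    also have "\<dots> = (d * 2 ^ (n * l + n * (q + 2) + 5)) * measure M Q"
      by (simp only: power_add) simp
    finally show ?thesis using le by simp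
  qed
  have r_le: "r \<le> \<tau> * \<rho>"
  proof -
    have "n * (n + 1) \<le> 2 ^ n * 2 ^ n"
      using less_exp[of n] by (intro mult_le_mono) (auto simp: Suc_le_eq)
    then have "real (n * (n + 1)) \<le> 2 ^ (2 * n)"
      by (metis mult_2 of_nat_le_iff of_nat_numeral of_nat_power power_add)
    then have "16 * (real n * real (n + 1)) \<le> 2 ^ (2 * n + 4)"
      by (simp add: power_add algebra_simps)
    then have *: "16 * (real n * real (n + 1)) * (1/2) ^ (2 * n + 4) \<le> 1"
      by (simp add: power_one_over field_simps)
    have "(2 ^ q * (1/2) ^ k :: real) = \<rho> * (1/2) ^ (2 * n + 4)"
    proof -
      have "(1/2 :: real) ^ k = (1/2) ^ q * ((1/2) ^ l * (1/2) ^ (2 * n + 4))"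
        unfolding k_def power_add by simp
      then show ?thesis by (simp add: \<rho>_def power_one_over)
    qed
    then have "4 * real n * r = \<rho> * (16 * (real n * real (n + 1)) * (1/2) ^ (2 * n + 4))"
      by (simp add: r_def algebra_simps)
    also have "\<dots> \<le> \<rho> * 1" using * \<rho> by (intro mult_left_mono) auto
    finally show ?thesis using n_pos by (simp add: \<tau>_def field_simps)
  qed
  have r_pos: "0 < r" by (simp add: r_def)
  obtain y where y: "y \<in> A" "\<And>i. i < n \<Longrightarrow> \<bar>t i (z - y)\<bar> \<le> r"
    using near_hull[OF k_cond z] by (auto simp: near_def r_def)
  have ys: "y \<in> space M" using y A_space by auto
  have zs: "z \<in> space M"
    using z A_space hull_minimal[of A "space M" convex] subspace_imp_convex[OF subspace_space] by auto
  have o's: "o' \<in> space M" unfolding o'_def using u_space by (intro scale_space sum_space) auto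
  \<comment> \<open>Solves \<open>(1 - \<rho>) *\<^sub>R y + \<rho> *\<^sub>R w = (1 - \<rho>)
    *\<^sub>R z + \<rho> *\<^sub>R o'\<close>. Since \<open>y\<close> is within
    \<open>\<tau> * \<rho>\<close> of \<open>z\<close>, \<open>w\<close> is within
    \<open>\<tau>\<close> of the centre of \<open>Q\<close>.\<close>
  define w where "w = o' + ((1 - \<rho>) / \<rho>) *\<^sub>R (z - y)"
  have ws: "w \<in> space M" using o's zs ys by (auto simp: w_def)
  have tw: "\<bar>t i w - 1/2\<bar> < \<tau>" if i: "i < n" for i
  proof -
    have "t i w - 1/2 = (1 - \<rho>) / \<rho> * t i (z - y)"
      using i by (simp add: w_def o'_def t_simps t_sum_u)
    also have "\<bar>\<dots>\<bar> = (1 - \<rho>) / \<rho> * \<bar>t i (z - y)\<bar>" using \<rho> by (simp add: abs_mult)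
    also have "\<dots> \<le> (1 - \<rho>) / \<rho> * r" using y(2)[OF i] \<rho> by (intro mult_left_mono) auto
    also have "\<dots> < 1 / \<rho> * r" using \<rho> r_pos by (intro mult_strict_right_mono divide_strict_right_mono) auto
    also have "\<dots> \<le> \<tau>" using r_le \<rho> by (simp add: field_simps)
    finally show ?thesis .
  qed
  define g where "g p = (1 - \<rho>) *\<^sub>R y + \<rho> *\<^sub>R p" for p
  have g_fold: "g p = foldr contr (replicate l y) p" for p
    by (simp only: foldr_contr_replicate g_def \<rho>_def)
  have ly: "set (replicate l y) \<subseteq> A" "set (replicate l y) \<subseteq> space M" using y ys by auto
  have g_meas [measurable]: "g \<in> measurable M M"
    using measurable_foldr_contr[OF ly(2)] by (simp add: g_fold[abs_def])
  define N where "N = {p \<in> Q. g p \<notin> A0}"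
  have N_sets: "N \<in> sets M"
  proof -
    have "N = {p \<in> space M. p \<in> Q \<and> g p \<notin> A0}" using Q_space by (auto simp: N_def)
    then show ?thesis by simp
  qed
  have N_fmeas: "N \<in> fmeasurable M"
    using Q_fmeas by (rule fmeasurableI2) (use N_sets in \<open>auto simp: N_def\<close>)
  \<comment> \<open>A point of \<open>Q\<close> is bad if it is outside \<open>A0\<close>, or is in
    \<open>A0\<close> but moved out by the contraction towards \<open>y\<close>; each set takes at
    most 1/16 of \<open>Q\<close>.\<close>
  have N_le: "measure M N \<le> measure M Q / 8"
  proof -
    let ?G = "{p \<in> A0. foldr contr (replicate l y) p \<notin> A0}"
    have G: "?G \<in> sets M" "measure M ?G \<le> 2 ^ (n * l) * (2 * d * a)"
      using measure_foldr_contr_bad[OF ly(1)] by auto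
    have Gf: "?G \<in> fmeasurable M" using A0_fmeas by (rule fmeasurableI2) (use G in auto)
    have "measure M N \<le> measure M ((Q - A0) \<union> ?G)"
      using Q_fmeas Gf N_sets
      by (intro measure_mono_fmeasurable fmeasurable.Un fmeasurable_Diff) (auto simp: N_def g_fold)
    also have "\<dots> \<le> measure M (Q - A0) + measure M ?G"
      using G by (intro measure_Un_le) auto
    finally show ?thesis using Q16 G(2) copy by simp
  qed
  have \<tau>: "0 < \<tau>" "2 * real n * \<tau> = 1/2" using n_pos by (auto simp: \<tau>_def field_simps)
  have \<tau>_le: "\<tau> \<le> 1/4" using n_pos by (simp add: \<tau>_def field_simps)
  define v where "v = - ((1/2 - \<tau>) *\<^sub>R (\<Sum>i<n. u i))"
  have v: "v \<in> space M" unfolding v_def using u_space by (intro uminus_space scale_space sum_space) auto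
  have tv: "t i v = - (1/2 - \<tau>)" if "i < n" for i
    using that by (simp add: v_def t_simps t_sum_u)
  define C where "C = {x \<in> space M. \<forall>i<n. t i v \<le> t i x \<and> t i x < t i v + (1 - 2 * \<tau>)}"
  have C: "C \<in> fmeasurable M" "measure M C = (1 - 2 * \<tau>) ^ n * measure M Q"
    unfolding C_def using measure_cube[OF v, of "1 - 2 * \<tau>"] \<tau>_le by auto
  have "1 + real n * (- (2 * \<tau>)) \<le> (1 + - (2 * \<tau>)) ^ n"
    using \<tau>_le by (intro Bernoulli_inequality) auto
  then have "1/2 \<le> (1 - 2 * \<tau>) ^ n" using \<tau>(2) by simp
  then have C_half: "measure M Q / 2 \<le> measure M C" using C(2) mult_right_mono[of "1/2" "(1 - 2 * \<tau>) ^ n" "measure M Q"] by simp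
  have C_t: "\<bar>t i p\<bar> \<le> 1/2 - \<tau>" if "p \<in> C" "i < n" for p i
    using that tv[OF that(2)] by (force simp: C_def)
  have CQ: "w + p \<in> Q" "w + (-1) *\<^sub>R p \<in> Q" if p: "p \<in> C" for p
  proof -
    have ps: "p \<in> space M" using p by (simp add: C_def)
    have "0 \<le> t i (w + p) \<and> t i (w + p) < 1" "0 \<le> t i (w + (-1) *\<^sub>R p) \<and> t i (w + (-1) *\<^sub>R p) < 1"
      if i: "i < n" for i
      using tw[OF i] C_t[OF p i] i by (auto simp: t_simps)
    then show "w + p \<in> Q" "w + (-1) *\<^sub>R p \<in> Q" using ws ps by (auto simp: Q_def)
  qed
  define N1 where "N1 = {p \<in> space M. w + 1 *\<^sub>R p \<in> N}"
  define N2 where "N2 = {p \<in> space M. w + (-1) *\<^sub>R p \<in> N}"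
  have N12: "N1 \<in> fmeasurable M" "measure M N1 = measure M N"
    "N2 \<in> fmeasurable M" "measure M N2 = measure M N"
  proof -
    show "N1 \<in> fmeasurable M" "N2 \<in> fmeasurable M"
      unfolding N1_def N2_def by (rule affine_preimage_fmeasurable; use ws N_fmeas in simp)+
    show "measure M N1 = measure M N" "measure M N2 = measure M N"
      unfolding N1_def N2_def using measure_affine_preimage[OF _ ws N_sets, of 1]
        measure_affine_preimage[OF _ ws N_sets, of "-1"] by auto
  qed
  \<comment> \<open>The points \<open>w + p\<close> and \<open>w - p\<close> are bad for at most 1/8
    of the volume of \<open>Q\<close> each, while \<open>C\<close> has at least half of it. For a
    remaining \<open>p\<close>, both images under \<open>g\<close> lie in \<open>A\<close> and their
    midpoint is \<open>g w\<close>.\<close>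
  have "\<not> C \<subseteq> N1 \<union> N2"
  proof
    assume "C \<subseteq> N1 \<union> N2"
    then have "measure M C \<le> measure M (N1 \<union> N2)"
      using C(1) N12 by (intro measure_mono_fmeasurable) auto
    also have "\<dots> \<le> measure M N1 + measure M N2" using N12 by (intro measure_Un_le) auto
    finally show False using N12 N_le C_half Q_pos by simp
  qed
  then obtain p where p: "p \<in> C" "p \<notin> N1" "p \<notin> N2" by blast
  have ps: "p \<in> space M" using p by (simp add: C_def)
  have "w + p \<notin> N" "w + (-1) *\<^sub>R p \<notin> N" using p ps by (auto simp: N1_def N2_def)
  then have in_A: "g (w + p) \<in> A" "g (w + (-1) *\<^sub>R p) \<in> A"
    using CQ[OF p(1)] A0_sub by (auto simp: N_def)
  have "contr (g (w + p)) (g (w + (-1) *\<^sub>R p)) = (1 - \<rho>) *\<^sub>R y + \<rho> *\<^sub>R w"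
  proof -
    have "g (w + p) + g (w + (-1) *\<^sub>R p)
      = ((1 - \<rho>) *\<^sub>R y + \<rho> *\<^sub>R w) + ((1 - \<rho>) *\<^sub>R y + \<rho> *\<^sub>R w)"
      by (simp add: g_def scaleR_add_right scaleR_diff_right)
    then show ?thesis unfolding contr_def by (simp only: scaleR_half_double)
  qed
  also have "\<dots> = (1 - \<rho>) *\<^sub>R z + \<rho> *\<^sub>R o'"
    using \<rho> by (simp add: w_def scaleR_add_right scaleR_diff_right)
  finally show ?thesis using in_A unfolding o'_def by metis
qed

end

section \<open>Finding the corners, and the volume of the hull\<close>

context small_doubling
begin

text \<open>Each of the \<open>2 ^ n\<close> words \<open>p s\<close> has length \<open>n\<close>
  and fails on at most \<open>2 ^ (n * n) * (2 * d * a)\<close>; together this is less than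
  \<open>a\<close>, so one \<open>y\<close> works for all of them. Its images are the vertices of a
  parallelepiped, and the image for empty \<open>s\<close> is moved to the origin.\<close>

lemma cornered_translate:
  assumes d: "d * 2 ^ (n * n + n + 2) \<le> 1"
  obtains c u t where "c \<in> space M"
    "cornered M n X e ((\<lambda>x. - c + 1 *\<^sub>R x) ` A) ((\<lambda>x. - c + 1 *\<^sub>R x) ` A0)
      ((\<lambda>x. - c + 1 *\<^sub>R x) ` B) d u t (3 * n + 2)"
proof -
  obtain x0 u t where x0: "x0 \<in> A" and fr: "partial_frame x0 u t n"
    and expand: "\<And>x. x \<in> space M \<Longrightarrow> x = (\<Sum>i<n. t i x *\<^sub>R u i)"
    using frame_exists by blast
  have u: "x0 + u i \<in> A" "u i \<in> space M" and t: "linear (t i)" "t i \<in> borel_measurable M"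
    if "i < n" for i
    using fr that by (auto simp: partial_frame_def)
  have tu: "t i (u j) = (if i = j then 1 else 0)" if "i < n" "j < n" for i j
    using fr that by (auto simp: partial_frame_def)
  have bd: "\<bar>t i (x - x0)\<bar> \<le> 2 * 3 ^ n" if "i < n" "x \<in> A" for i x
    using fr that by (auto simp: partial_frame_def)
  define p where "p s = map (\<lambda>j. if j \<in> s then x0 + u j else x0) [0..<n]" for s
  have p_A: "set (p s) \<subseteq> A" for s using x0 u by (auto simp: p_def)
  define bad where "bad s = {y \<in> A0. foldr contr (p s) y \<notin> A0}" for s
  have bad: "bad s \<in> sets M" "measure M (bad s) \<le> 2 ^ (n * n) * (2 * d * a)" for s
    using measure_foldr_contr_bad[OF p_A[of s]] by (auto simp: bad_def p_def)
  have "\<not> A0 \<subseteq> (\<Union>s\<in>Pow {..<n}. bad s)"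
  proof
    assume "A0 \<subseteq> (\<Union>s\<in>Pow {..<n}. bad s)"
    moreover have "(\<Union>s\<in>Pow {..<n}. bad s) \<subseteq> A0" by (auto simp: bad_def)
    ultimately have "a = measure M (\<Union>s\<in>Pow {..<n}. bad s)" by (metis subset_antisym)
    also have "\<dots> \<le> (\<Sum>s\<in>Pow {..<n}. measure M (bad s))"
      using bad by (intro measure_UNION_le) auto
    also have "\<dots> \<le> (\<Sum>s\<in>Pow {..<n}. 2 ^ (n * n) * (2 * d * a))" by (intro sum_mono bad)
    also have "\<dots> = (d * 2 ^ (n * n + n + 2)) * a / 2" by (simp add: card_Pow power_add)
    also have "\<dots> \<le> 1 * a / 2" using d A0_pos by (intro divide_right_mono mult_right_mono) auto
    finally show False using A0_pos by simp
  qed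
  then obtain y where y: "y \<in> A0" "\<And>s. s \<subseteq> {..<n} \<Longrightarrow> foldr contr (p s) y \<in> A0"
    by (auto simp: bad_def)
  define c where "c = foldr contr (p {}) y"
  have c_A: "c \<in> A" using y(2)[of "{}"] A0_sub by (auto simp: c_def)
  then have c: "c \<in> space M" using A_space by auto
  \<comment> \<open>The shift caused by switching the letter \<open>j\<close> from \<open>x0\<close>
    to \<open>x0 + u j\<close>. The dual functionals grow by \<open>2 ^ (i + 1)\<close>, which
    together with \<open>4 * 3 ^ n\<close> gives the coordinate bound
    \<open>2 ^ (3 * n + 2)\<close>.\<close>
  define v where "v j = (1/2) ^ (j + 1) *\<^sub>R u j" for j
  define r where "r i x = 2 ^ (i + 1) * t i x" for i x
  have p_c: "foldr contr (p s) y = c + (\<Sum>j\<in>s. v j)" if s: "s \<subseteq> {..<n}" for s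
  proof -
    have "(\<Sum>j<n. (1/2) ^ (j + 1) *\<^sub>R (if j \<in> s then x0 + u j else x0))
      = (\<Sum>j<n. (1/2) ^ (j + 1) *\<^sub>R x0 + (if j \<in> s then v j else 0))"
      by (intro sum.cong) (auto simp: v_def scaleR_add_right)
    also have "\<dots> = (\<Sum>j<n. (1/2) ^ (j + 1) *\<^sub>R x0) + (\<Sum>j\<in>s. v j)"
      using s by (simp add: sum.distrib sum.inter_restrict[symmetric] Int_absorb1)
    finally show ?thesis
      unfolding c_def p_def foldr_contr_map by simp
  qed
  let ?T = "\<lambda>x. - c + 1 *\<^sub>R x"
  have T_space: "?T x \<in> space M" if "x \<in> space M" for x using that c by auto
  have contr_T: "contr (?T x) (?T y) = ?T (contr x y)" for x y
    by (simp add: contr_def scaleR_add_right scaleR_half_double algebra_simps flip: scaleR_left_distrib)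
  interpret T: small_doubling M n X e "?T ` A" "?T ` A0" "?T ` B" d
  proof
    show "?T ` A \<subseteq> space M" using A_space T_space by blast
    show "?T ` A0 \<in> fmeasurable M" by (rule affine_fmeasurable) (use c A0_fmeas in auto)
    show "?T ` B \<in> fmeasurable M" by (rule affine_fmeasurable) (use c B_fmeas in auto)
    show "?T ` A0 \<subseteq> ?T ` A" using A0_sub by (rule image_mono)
    have m: "measure M (?T ` S) = measure M S" if "S \<in> sets M" for S
      using that c measure_affine[of 1 "- c" S] by simp
    show "0 < measure M (?T ` A0)" using A0_pos by (subst m) auto
    show "measure M (?T ` B) \<le> (1 + d) * measure M (?T ` A0)"
      using measure_B B_fmeas by (subst (1 2) m) auto
    show "contr x y \<in> ?T ` B" if xy: "x \<in> ?T ` A" "y \<in> ?T ` A" for x y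
    proof -
      obtain x' y' where "x' \<in> A" "y' \<in> A" "x = ?T x'" "y = ?T y'" using xy by blast
      then show ?thesis using contr_T contr_B by (metis imageI)
    qed
  qed
  have "cornered M n X e (?T ` A) (?T ` A0) (?T ` B) d v r (3 * n + 2)"
  proof (intro cornered.intro cornered_axioms.intro T.small_doubling_axioms)
    show "v i \<in> space M" "r i \<in> borel_measurable M" if "i < n" for i
      using u t that by (auto simp: v_def r_def[abs_def])
    show "linear (r i)" if "i < n" for i
      using t(1)[OF that] by (intro linearI) (auto simp: r_def linear_add linear_scale algebra_simps)
    show "r i (v j) = (if i = j then 1 else 0)" if "i < n" "j < n" for i j
      using that t(1)[of i] tu[OF that] by (auto simp: r_def v_def linear_scale power_one_over)
    show "x = (\<Sum>i<n. r i x *\<^sub>R v i)" if "x \<in> space M" for x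
    proof -
      have "(\<Sum>i<n. r i x *\<^sub>R v i) = (\<Sum>i<n. t i x *\<^sub>R u i)"
        by (intro sum.cong) (auto simp: r_def v_def power_one_over)
      then show ?thesis using expand[OF that] by simp
    qed
    show "(\<Sum>i\<in>s. v i) \<in> ?T ` A" if "s \<subseteq> {..<n}" for s
      using y(2)[OF that] p_c[OF that] A0_sub by (intro image_eqI[of _ _ "c + (\<Sum>i\<in>s. v i)"]) auto
    show "\<bar>r i x\<bar> \<le> 2 ^ (3 * n + 2)" if x: "x \<in> ?T ` A" and i: "i < n" for x i
    proof -
      obtain x' where x': "x' \<in> A" "x = x' - c" using x by auto
      have "t i x = t i (x' - x0) - t i (c - x0)"
        using t(1)[OF i] x' by (simp add: linear_diff)
      then have "\<bar>t i x\<bar> \<le> 4 * 3 ^ n" using bd[OF i x'(1)] bd[OF i c_A] by linarith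
      moreover have "(2::real) ^ (i + 1) \<le> 2 ^ n" using i by (intro power_increasing) auto
      ultimately have "\<bar>r i x\<bar> \<le> 2 ^ n * (4 * 3 ^ n)"
        unfolding r_def abs_mult by (intro mult_mono) auto
      also have "\<dots> \<le> 2 ^ n * (4 * 4 ^ n)" by (intro mult_left_mono power_mono) auto
      also have "\<dots> = 2 ^ (3 * n + 2)"
        by (simp add: power_add power_mult numeral_3_eq_3 flip: power_mult_distrib)
      finally show ?thesis .
    qed
  qed
  with c show ?thesis by (rule that)
qed

lemma shrunk_hull_in_B:
  assumes d: "d * 2 ^ (n * l + 5 * n * n + 7 * n + 7) \<le> 1"
  shows "\<exists>v\<in>space M. \<forall>z \<in> convex hull A. (1/2) ^ l *\<^sub>R v + (1 - (1/2) ^ l) *\<^sub>R z \<in> B"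
proof -
  have "d * 2 ^ (n * n + n + 2) \<le> d * 2 ^ (n * l + 5 * n * n + 7 * n + 7)"
    using d_nonneg by (intro mult_left_mono power_increasing) auto
  with d have "d * 2 ^ (n * n + n + 2) \<le> 1" by simp
  then obtain c u t where c: "c \<in> space M"
    and corn: "cornered M n X e ((\<lambda>x. - c + 1 *\<^sub>R x) ` A) ((\<lambda>x. - c + 1 *\<^sub>R x) ` A0)
      ((\<lambda>x. - c + 1 *\<^sub>R x) ` B) d u t (3 * n + 2)"
    by (rule cornered_translate)
  interpret C: cornered M n X e "(\<lambda>x. - c + 1 *\<^sub>R x) ` A" "(\<lambda>x. - c + 1 *\<^sub>R x) ` A0"
    "(\<lambda>x. - c + 1 *\<^sub>R x) ` B" d u t "3 * n + 2" by (rule corn)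
  define w where "w = (1/2) *\<^sub>R (\<Sum>i<n. u i)"
  define \<rho> where "\<rho> = (1/2 :: real) ^ l"
  have exp_eq: "n * l + n * (3 * n + 2 + 2 * n + 5) + 7 = n * l + 5 * n * n + 7 * n + 7"
    by (simp add: algebra_simps)
  have "\<rho> *\<^sub>R (c + w) + (1 - \<rho>) *\<^sub>R z \<in> B" if z: "z \<in> convex hull A" for z
  proof -
    have "- c + z \<in> convex hull ((\<lambda>x. - c + 1 *\<^sub>R x) ` A)"
      using z convex_hull_translation[of "- c" A] by auto
    from C.shrunk_hull_midpoints[OF _ this, of l] d
    have "\<exists>x\<in>A. \<exists>y\<in>A. (1 - \<rho>) *\<^sub>R (- c + z) + \<rho> *\<^sub>R w = contr (- c + x) (- c + y)"
      unfolding exp_eq by (auto simp: w_def \<rho>_def)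
    then obtain x y where xy: "x \<in> A" "y \<in> A"
      "(1 - \<rho>) *\<^sub>R (- c + z) + \<rho> *\<^sub>R w = contr (- c + x) (- c + y)" by blast
    have "contr (- c + x) (- c + y) = - c + contr x y"
      by (simp add: contr_def scaleR_add_right scaleR_diff_right) (simp add: scaleR_half_double[symmetric] algebra_simps flip: scaleR_left_distrib)
    with xy have "contr x y = \<rho> *\<^sub>R (c + w) + (1 - \<rho>) *\<^sub>R z"
      by (simp add: algebra_simps)
    with contr_B[OF xy(1,2)] show ?thesis by simp
  qed
  moreover have "c + w \<in> space M"
    unfolding w_def using c C.u_space by (intro add_space scale_space sum_space) auto
  ultimately show ?thesis unfolding \<rho>_def by blast
qed

text \<open>The cover is the preimage of \<open>B\<close> under the shrinking map, so it is
  measurable although the hull itself is not assumed to be.\<close>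

lemma hull_cover:
  assumes d: "d * 2 ^ (n * l + 5 * n * n + 7 * n + 7) \<le> 1" and l: "0 < l"
  shows "\<exists>H\<in>fmeasurable M. convex hull A \<subseteq> H \<and> measure M H \<le> (1 + d) * a / (1 - (1/2) ^ l) ^ n"
proof -
  define \<rho> where "\<rho> = (1/2 :: real) ^ l"
  have \<rho>: "0 < \<rho>" "\<rho> < 1" using l by (auto simp: \<rho>_def power_less_one_iff)
  obtain v where v: "v \<in> space M" "\<forall>z \<in> convex hull A. \<rho> *\<^sub>R v + (1 - \<rho>) *\<^sub>R z \<in> B"
    using shrunk_hull_in_B[OF d] by (auto simp: \<rho>_def)
  define H where "H = {x \<in> space M. \<rho> *\<^sub>R v + (1 - \<rho>) *\<^sub>R x \<in> B}"
  have "H \<in> fmeasurable M"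
    unfolding H_def using \<rho> v B_fmeas by (intro affine_preimage_fmeasurable) auto
  moreover have "convex hull A \<subseteq> H"
    using v(2) A_space hull_minimal[of A "space M" convex] subspace_imp_convex[OF subspace_space]
    by (auto simp: H_def)
  moreover have "measure M H = measure M B / (1 - \<rho>) ^ n"
    unfolding H_def using \<rho> v B_fmeas by (subst measure_affine_preimage) auto
  then have "measure M H \<le> (1 + d) * a / (1 - \<rho>) ^ n"
    using measure_B \<rho> by (simp add: divide_right_mono)
  ultimately show ?thesis unfolding \<rho>_def by blast
qed

end

subsection \<open>Lebesgue measure on the coordinate spaces\<close>

lemma lookup_scaleR: "Poly_Mapping.lookup (c *\<^sub>R x) i = c *\<^sub>R Poly_Mapping.lookup x i"
  for x :: "nat \<Rightarrow>\<^sub>0 real"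
  by (simp add: scaleR_poly_mapping_def)

lemma space_borel_lebesgue:
  "space (borel_lebesgue n) = {x. \<forall>i\<ge>n. Poly_Mapping.lookup x i = 0}"
  using space_lebesgue_space[of n] by (simp add: lebesgue_space_def)

lemma measurable_borel_lebesgueI:
  assumes sp: "\<And>x. x \<in> space N \<Longrightarrow> f x \<in> space (borel_lebesgue n)"
    and co: "\<And>i. i < n \<Longrightarrow> (\<lambda>x. Poly_Mapping.lookup (f x) i) \<in> borel_measurable N"
  shows "f \<in> measurable N (borel_lebesgue n)"
proof -
  let ?g = "\<lambda>x. restrict (Poly_Mapping.lookup (f x)) {..<n}"
  have "?g \<in> measurable N (\<Pi>\<^sub>M i\<in>{..<n}. lborel)"
    using co by (intro measurable_restrict) (simp add: measurable_lborel1)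
  moreover have "vec_of n \<in> measurable (\<Pi>\<^sub>M i\<in>{..<n}. lborel) (borel_lebesgue n)"
    unfolding borel_lebesgue_def by (rule measurable_embed_measure2'[OF inj_on_vec_of])
  ultimately have "(\<lambda>x. vec_of n (?g x)) \<in> measurable N (borel_lebesgue n)"
    by (rule measurable_compose)
  moreover have "vec_of n (?g x) = f x" if "x \<in> space N" for x
    using sp[OF that] by (intro poly_mapping_eqI) (auto simp: lookup_vec_of space_borel_lebesgue)
  ultimately show ?thesis by (simp cong: measurable_cong)
qed

lemma measurable_lookup:
  assumes "i < n"
  shows "(\<lambda>x. Poly_Mapping.lookup x i) \<in> borel_measurable (borel_lebesgue n)"
  unfolding borel_lebesgue_def
proof (rule measurable_embed_measure1)
  have "(\<lambda>f. f i) \<in> measurable (\<Pi>\<^sub>M i\<in>{..<n}. (lborel :: real measure)) lborel"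
    using assms by (intro measurable_component_singleton) auto
  then show "(\<lambda>f. Poly_Mapping.lookup (vec_of n f) i) \<in> borel_measurable (\<Pi>\<^sub>M i\<in>{..<n}. lborel)"
    using assms by (simp add: lookup_vec_of measurable_lborel1)
qed

text \<open>The push-forward under \<open>T\<close>, scaled by \<open>\<bar>c\<bar> ^ n\<close>, has
  the right values on boxes by the one-dimensional formula in each coordinate; uniqueness of the
  product measure does the rest.\<close>

lemma emeasure_PiM_lborel_affine:
  fixes v :: "nat \<Rightarrow> real" and c :: real and n :: nat
  assumes c: "c \<noteq> 0"
  defines "P \<equiv> \<Pi>\<^sub>M i\<in>{..<n}. (lborel :: real measure)"
  defines "T \<equiv> (\<lambda>f. \<lambda>i\<in>{..<n}. v i + c * f i)"
  assumes Z: "Z \<in> sets P"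
  shows "emeasure P Z = ennreal (\<bar>c\<bar> ^ n) * emeasure P (T -` Z \<inter> space P)"
proof -
  interpret product_sigma_finite "\<lambda>_::nat. lborel :: real measure" by standard
  have T_meas: "T \<in> measurable P P"
    unfolding T_def P_def by measurable
  have "scale_measure (ennreal (\<bar>c\<bar> ^ n)) (distr P P T) = P"
    unfolding P_def
  proof (rule PiM_eqI)
    fix A :: "nat \<Rightarrow> real set" assume A: "\<And>i. i \<in> {..<n} \<Longrightarrow> A i \<in> sets lborel"
    have box: "Pi\<^sub>E {..<n} A \<in> sets P" unfolding P_def using A by (intro sets_PiM_I_finite) auto
    let ?A = "\<lambda>i. (\<lambda>x. v i + c * x) -` A i"
    have A': "?A i \<in> sets lborel" if "i < n" for i
      using measurable_sets[of "\<lambda>x. v i + c * x" borel borel "A i"] A[of i] that by simp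
    have pre: "T -` Pi\<^sub>E {..<n} A \<inter> space P = Pi\<^sub>E {..<n} ?A"
      by (auto simp: T_def P_def space_PiM PiE_iff extensional_def)
    have aff: "emeasure lborel (A i) = ennreal \<bar>c\<bar> * emeasure lborel (?A i)" if "i < n" for i
    proof -
      have [measurable]: "A i \<in> sets borel" using A[of i] that by simp
      have "emeasure lborel (A i)
        = emeasure (density (distr lborel borel (\<lambda>x. v i + c * x)) (\<lambda>_. ennreal \<bar>c\<bar>)) (A i)"
        using lborel_real_affine[OF c, of "v i"] by simp
      also have "\<dots> = ennreal \<bar>c\<bar> * emeasure (distr lborel borel (\<lambda>x. v i + c * x)) (A i)"
        by (subst emeasure_density) (auto simp: nn_integral_cmult_indicator)
      also have "emeasure (distr lborel borel (\<lambda>x. v i + c * x)) (A i) = emeasure lborel (?A i)"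
        by (subst emeasure_distr) auto
      finally show ?thesis .
    qed
    have "emeasure (scale_measure (ennreal (\<bar>c\<bar> ^ n)) (distr P P T)) (Pi\<^sub>E {..<n} A)
      = ennreal (\<bar>c\<bar> ^ n) * emeasure P (Pi\<^sub>E {..<n} ?A)"
      using T_meas box by (simp add: emeasure_distr pre)
    also have "emeasure P (Pi\<^sub>E {..<n} ?A) = (\<Prod>i<n. emeasure lborel (?A i))"
      unfolding P_def using A' by (intro emeasure_PiM) auto
    also have "ennreal (\<bar>c\<bar> ^ n) * (\<Prod>i<n. emeasure lborel (?A i))
      = (\<Prod>i<n. ennreal \<bar>c\<bar> * emeasure lborel (?A i))"
      by (simp add: prod.distrib ennreal_power)
    also have "\<dots> = (\<Prod>i<n. emeasure lborel (A i))" by (intro prod.cong) (auto simp: aff)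
    finally show "emeasure (scale_measure (ennreal (\<bar>c\<bar> ^ n))
        (distr (\<Pi>\<^sub>M i\<in>{..<n}. lborel) (\<Pi>\<^sub>M i\<in>{..<n}. lborel) T)) (Pi\<^sub>E {..<n} A)
      = (\<Prod>i<n. emeasure lborel (A i))" unfolding P_def .
  qed (auto simp: P_def)
  then have "emeasure P Z = emeasure (scale_measure (ennreal (\<bar>c\<bar> ^ n)) (distr P P T)) Z" by simp
  then show ?thesis using T_meas Z by (simp add: emeasure_distr)
qed

lemma affine_image_borel_lebesgue:
  fixes v :: "nat \<Rightarrow>\<^sub>0 real"
  assumes c: "c \<noteq> 0" and v: "v \<in> space (borel_lebesgue n)" and S: "S \<in> sets (borel_lebesgue n)"
  shows "(\<lambda>x. v + c *\<^sub>R x) ` S \<in> sets (borel_lebesgue n)"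
    and "emeasure (borel_lebesgue n) ((\<lambda>x. v + c *\<^sub>R x) ` S)
      = ennreal (\<bar>c\<bar> ^ n) * emeasure (borel_lebesgue n) S"
proof -
  let ?M = "borel_lebesgue n" and ?P = "\<Pi>\<^sub>M i\<in>{..<n}. (lborel :: real measure)"
  let ?S' = "(\<lambda>x. v + c *\<^sub>R x) ` S"
  have S_sp: "S \<subseteq> space ?M" by (rule sets.sets_into_space[OF S])
  define g where "g y = (1/c) *\<^sub>R (y - v)" for y
  have g: "g \<in> measurable ?M ?M"
  proof (rule measurable_borel_lebesgueI)
    fix x assume "x \<in> space ?M"
    then show "g x \<in> space ?M"
      using v by (simp add: g_def space_borel_lebesgue lookup_scaleR lookup_minus)
  next
    fix i assume "i < n"
    note measurable_lookup[OF this, measurable]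
    show "(\<lambda>x. Poly_Mapping.lookup (g x) i) \<in> borel_measurable ?M"
      by (simp add: g_def lookup_scaleR lookup_minus)
  qed
  have S'_eq: "?S' = g -` S \<inter> space ?M"
  proof (intro subset_antisym subsetI)
    fix y assume "y \<in> ?S'"
    then obtain x where "x \<in> S" "y = v + c *\<^sub>R x" by blast
    then show "y \<in> g -` S \<inter> space ?M"
      using c v S_sp by (auto simp: g_def space_borel_lebesgue lookup_scaleR lookup_add)
  next
    fix y assume y: "y \<in> g -` S \<inter> space ?M"
    then show "y \<in> ?S'" using c by (intro image_eqI[of _ _ "g y"]) (auto simp: g_def)
  qed
  show S': "?S' \<in> sets ?M" unfolding S'_eq by (rule measurable_sets[OF g S])
  let ?T = "\<lambda>f. \<lambda>i\<in>{..<n}. Poly_Mapping.lookup v i + c * f i"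
  have vec: "vec_of n \<in> measurable ?P ?M"
    unfolding borel_lebesgue_def by (rule measurable_embed_measure2'[OF inj_on_vec_of])
  have em: "emeasure ?M U = emeasure ?P (vec_of n -` U \<inter> space ?P)" if "U \<in> sets ?M" for U
    using that unfolding borel_lebesgue_def by (rule emeasure_embed_measure'[OF inj_on_vec_of])
  have vT: "vec_of n (?T f) = v + c *\<^sub>R vec_of n f" for f
    using v by (intro poly_mapping_eqI)
      (auto simp: lookup_vec_of lookup_add lookup_scaleR space_borel_lebesgue)
  have inj: "v + c *\<^sub>R x \<in> ?S' \<longleftrightarrow> x \<in> S" for x using c by auto
  have "emeasure ?M ?S' = emeasure ?P (vec_of n -` ?S' \<inter> space ?P)" by (rule em[OF S'])
  also have "\<dots> = ennreal (\<bar>c\<bar> ^ n) * emeasure ?P (?T -` (vec_of n -` ?S' \<inter> space ?P) \<inter> space ?P)"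
    by (rule emeasure_PiM_lborel_affine[OF c measurable_sets[OF vec S']])
  also have "?T -` (vec_of n -` ?S' \<inter> space ?P) \<inter> space ?P = vec_of n -` S \<inter> space ?P"
    using inj by (auto simp: vT space_PiM)
  also have "emeasure ?P (vec_of n -` S \<inter> space ?P) = emeasure ?M S" by (rule em[OF S, symmetric])
  finally show "emeasure ?M ?S' = ennreal (\<bar>c\<bar> ^ n) * emeasure ?M S" .
qed

lemma emeasure_box_borel_lebesgue:
  "{x \<in> space (borel_lebesgue n). \<forall>i<n. \<bar>Poly_Mapping.lookup x i\<bar> \<le> r} \<in> sets (borel_lebesgue n)"
  "emeasure (borel_lebesgue n)
    {x \<in> space (borel_lebesgue n). \<forall>i<n. \<bar>Poly_Mapping.lookup x i\<bar> \<le> r} < \<infinity>"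
proof -
  let ?M = "borel_lebesgue n"
  let ?B = "\<lambda>r. {x \<in> space ?M. \<forall>i<n. \<bar>Poly_Mapping.lookup x i\<bar> \<le> r}"
  have B: "?B r \<in> sets ?M" for r
  proof -
    have "{x \<in> space ?M. \<forall>i\<in>{..<n}. \<bar>Poly_Mapping.lookup x i\<bar> \<le> r} \<in> sets ?M"
    proof (rule sets.sets_Collect_finite_All)
      fix i assume "i \<in> {..<n}"
      then have "i < n" by simp
      note measurable_lookup[OF this, measurable]
      show "{x \<in> space ?M. \<bar>Poly_Mapping.lookup x i\<bar> \<le> r} \<in> sets ?M" by measurable
    qed simp
    then show ?thesis by (simp only: Ball_def lessThan_iff)
  qed
  then show "?B r \<in> sets ?M" .
  have "?B r \<subseteq> ?B \<bar>r\<bar>" by auto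
  then have "emeasure ?M (?B r) \<le> emeasure ?M (?B \<bar>r\<bar>)" by (intro emeasure_mono B)
  also have "\<dots> = vol n (?B \<bar>r\<bar>)" by (rule vol_borel[OF B, symmetric])
  also have "?B \<bar>r\<bar> = {x \<in> space (lebesgue_space n). \<forall>i<n. Poly_Mapping.lookup x i \<in> {- \<bar>r\<bar>..\<bar>r\<bar>}}"
    by (auto simp: lebesgue_space_def abs_le_iff)
  also have "vol n \<dots> = ennreal (\<Prod>i<n. \<bar>r\<bar> - (- \<bar>r\<bar>))" by (rule vol_box) simp
  finally show "emeasure ?M (?B r) < \<infinity>" by (simp add: order_le_less_trans)
qed

lemma finite_dim_volume_borel_lebesgue:
  assumes n: "0 < n"
  shows "finite_dim_volume (borel_lebesgue n) n (\<lambda>i x. Poly_Mapping.lookup x i)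
    (\<lambda>i. Poly_Mapping.single i 1)"
proof (intro finite_dim_volume.intro finite_dim_volume_axioms.intro n)
  let ?M = "borel_lebesgue n"
  show "sigma_finite_measure ?M"
  proof
    let ?B = "\<lambda>r::nat. {x \<in> space ?M. \<forall>i<n. \<bar>Poly_Mapping.lookup x i\<bar> \<le> real r}"
    have "space ?M \<subseteq> \<Union> (range ?B)"
    proof
      fix x assume x: "x \<in> space ?M"
      obtain r where r: "(\<Sum>i<n. \<bar>Poly_Mapping.lookup x i\<bar>) \<le> real r" using real_arch_simple by blast
      have "\<bar>Poly_Mapping.lookup x i\<bar> \<le> real r" if "i < n" for i
        by (rule order_trans[OF member_le_sum r]) (use that in auto)
      with x show "x \<in> \<Union> (range ?B)" by auto
    qed
    then have "\<Union> (range ?B) = space ?M" by blast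
    moreover have "range ?B \<subseteq> sets ?M" using emeasure_box_borel_lebesgue(1) by blast
    moreover have "emeasure ?M S \<noteq> \<infinity>" if S: "S \<in> range ?B" for S
    proof -
      obtain r where "S = ?B r" using S by blast
      then show ?thesis by (simp only:) (rule less_imp_neq, rule emeasure_box_borel_lebesgue(2))
    qed
    moreover have "countable (range ?B)" by simp
    ultimately show "\<exists>A. countable A \<and> A \<subseteq> sets ?M \<and> \<Union> A = space ?M \<and> (\<forall>a\<in>A. emeasure ?M a \<noteq> \<infinity>)"
      by meson
  qed
  show "subspace (space ?M)"
    by (auto simp: subspace_def space_borel_lebesgue lookup_add lookup_scaleR)
  show "linear (\<lambda>x. Poly_Mapping.lookup x i :: real)" for i :: nat
    by (rule linearI) (auto simp: lookup_add lookup_scaleR)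
  show "(\<lambda>x. Poly_Mapping.lookup x i) \<in> borel_measurable ?M" if "i < n" for i
    by (rule measurable_lookup[OF that])
  show "Poly_Mapping.single i 1 \<in> space ?M" if "i < n" for i
    using that by (auto simp: space_borel_lebesgue lookup_single)
  show "Poly_Mapping.lookup (Poly_Mapping.single j 1) i = (if i = j then 1 else 0)"
    if "i < n" "j < n" for i j
    by (auto simp: lookup_single)
  show "x = 0" if "x \<in> space ?M" "\<And>i. i < n \<Longrightarrow> Poly_Mapping.lookup x i = 0" for x
    using that by (intro poly_mapping_eqI) (auto simp: space_borel_lebesgue not_less[symmetric])
  show "f \<in> measurable ?M ?M" if "\<And>x. x \<in> space ?M \<Longrightarrow> f x \<in> space ?M"
    "\<And>i. i < n \<Longrightarrow> (\<lambda>x. Poly_Mapping.lookup (f x) i) \<in> borel_measurable ?M" for f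
    using that by (rule measurable_borel_lebesgueI)
  show "(\<lambda>(x, y). x + y) \<in> measurable (?M \<Otimes>\<^sub>M ?M) ?M"
  proof (rule measurable_borel_lebesgueI)
    fix i assume "i < n"
    note measurable_lookup[OF this, measurable]
    show "(\<lambda>z. Poly_Mapping.lookup (case z of (x, y) \<Rightarrow> x + y) i) \<in> borel_measurable (?M \<Otimes>\<^sub>M ?M)"
      by (simp add: case_prod_beta' lookup_add)
  qed (auto simp: space_pair_measure space_borel_lebesgue lookup_add)
  show "emeasure ?M ((\<lambda>x. v + c *\<^sub>R x) ` S) = ennreal (\<bar>c\<bar> ^ n) * emeasure ?M S"
    if "c \<noteq> 0" "v \<in> space ?M" "S \<in> sets ?M" for c v S
    by (rule affine_image_borel_lebesgue(2)[OF that])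
  show "emeasure ?M {x \<in> space ?M. \<forall>i<n. \<bar>Poly_Mapping.lookup x i\<bar> \<le> r} < \<infinity>" for r
    by (rule emeasure_box_borel_lebesgue)
qed

subsection \<open>Computability of the constants\<close>

text \<open>In the step function of \<open>PrimRec\<close>, \<open>Proj 0\<close> is the counter,
  \<open>Proj 1\<close> the previous value and \<open>Proj 2\<close> the parameter.\<close>

definition recf_add where "recf_add = PrimRec (Proj 0) (Comp Succ [Proj 1])"

definition recf_mult where "recf_mult = PrimRec Zero (Comp recf_add [Proj 1, Proj 2])"

definition recf_pow2 where "recf_pow2 = PrimRec (Comp Succ [Zero]) (Comp recf_add [Proj 1, Proj 1])"

lemma recf_eval_Proj: "i < length xs \<Longrightarrow> y = xs ! i \<Longrightarrow> recf_eval (Proj i) xs y"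
  by (simp add: recf_eval.Proj)

lemma recf_eval_Comp1:
  "recf_eval g xs y \<Longrightarrow> recf_eval f [y] z \<Longrightarrow> recf_eval (Comp f [g]) xs z"
  by (rule recf_eval.Comp[of _ _ "[y]"]) auto

lemma recf_eval_Comp2:
  "recf_eval g xs y \<Longrightarrow> recf_eval h xs y' \<Longrightarrow> recf_eval f [y, y'] z \<Longrightarrow> recf_eval (Comp f [g, h]) xs z"
  by (rule recf_eval.Comp[of _ _ "[y, y']"]) auto

lemma recf_eval_add: "recf_eval recf_add [m, x] (m + x)"
  unfolding recf_add_def
proof (induction m)
  case 0
  show ?case by (intro recf_eval.PrimRec_0 recf_eval_Proj) auto
next
  case (Suc m)
  have "recf_eval (Comp Succ [Proj 1]) [m, m + x, x] (Suc (m + x))"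
    by (rule recf_eval_Comp1[OF recf_eval_Proj recf_eval.Succ]) auto
  with Suc show ?case by (simp add: recf_eval.PrimRec_Suc)
qed

lemma recf_eval_mult: "recf_eval recf_mult [m, x] (m * x)"
  unfolding recf_mult_def
proof (induction m)
  case 0
  show ?case by (simp add: recf_eval.PrimRec_0 recf_eval.Zero)
next
  case (Suc m)
  have "recf_eval (Comp recf_add [Proj 1, Proj 2]) [m, m * x, x] (m * x + x)"
    by (rule recf_eval_Comp2[OF recf_eval_Proj recf_eval_Proj recf_eval_add]) auto
  with Suc have "recf_eval (PrimRec Zero (Comp recf_add [Proj 1, Proj 2])) [Suc m, x] (m * x + x)"
    by (rule recf_eval.PrimRec_Suc)
  then show ?case by (simp add: add.commute)
qed

lemma recf_eval_pow2: "recf_eval recf_pow2 [m] (2 ^ m)"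
  unfolding recf_pow2_def
proof (induction m)
  case 0
  have "recf_eval (Comp Succ [Zero]) [] (Suc 0)"
    by (rule recf_eval_Comp1[OF recf_eval.Zero recf_eval.Succ])
  then show ?case by (simp add: recf_eval.PrimRec_0)
next
  case (Suc m)
  have "recf_eval (Comp recf_add [Proj 1, Proj 1]) [m, 2 ^ m] (2 ^ m + 2 ^ m)"
    by (rule recf_eval_Comp2[OF recf_eval_Proj recf_eval_Proj recf_eval_add]) auto
  with Suc have "recf_eval (PrimRec (Comp Succ [Zero]) (Comp recf_add [Proj 1, Proj 1])) [Suc m]
      (2 ^ m + 2 ^ m)"
    by (rule recf_eval.PrimRec_Suc)
  then show ?case by (simp add: mult_2)
qed

text \<open>Serves as both \<delta> and c. The successor in the denominator matches
  \<open>computable_real_seq\<close>, so the approximation is exact. The square is an easily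
  computed bound for the two exponents that occur, \<open>6 * n * n + 8 * n + 7\<close> and
  \<open>5 * n * n + 9 * n + 10\<close>.\<close>

definition stab_const :: "nat \<Rightarrow> real" where
  "stab_const n = 1 / real (Suc (2 ^ ((3 * Suc n) * (3 * Suc n))))"

lemma stab_const_bounds:
  "0 < stab_const n" "stab_const n \<le> 1"
  "stab_const n * 2 ^ ((3 * Suc n) * (3 * Suc n)) \<le> 1"
proof -
  have *: "0 < 1 / real (Suc k)" "1 / real (Suc k) \<le> 1" "1 / real (Suc k) * real k \<le> 1" for k
    by (auto simp: field_simps)
  show "0 < stab_const n" "stab_const n \<le> 1" unfolding stab_const_def by (rule *)+
  show "stab_const n * 2 ^ ((3 * Suc n) * (3 * Suc n)) \<le> 1"
    using *(3)[of "2 ^ ((3 * Suc n) * (3 * Suc n))"] unfolding stab_const_def of_nat_power of_nat_numeral .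
qed

lemma computable_stab_const: "computable_real_seq stab_const"
proof -
  define S where "S = Comp Succ [Proj 0]"
  define S3 where "S3 = Comp recf_add [S, Comp recf_add [S, S]]"
  have S: "recf_eval S [n, k] (Suc n)" for n k
    unfolding S_def by (rule recf_eval_Comp1[OF recf_eval_Proj recf_eval.Succ]) auto
  have "recf_eval S3 [n, k] (Suc n + (Suc n + Suc n))" for n k
    unfolding S3_def
    by (rule recf_eval_Comp2[OF S recf_eval_Comp2[OF S S recf_eval_add] recf_eval_add])
  then have S3: "recf_eval S3 [n, k] (3 * Suc n)" for n k by (simp add: numeral_3_eq_3)
  have "recf_eval (Comp recf_pow2 [Comp recf_mult [S3, S3]]) [n, k] (2 ^ ((3 * Suc n) * (3 * Suc n)))"
    for n k
    by (rule recf_eval_Comp1[OF recf_eval_Comp2[OF S3 S3 recf_eval_mult] recf_eval_pow2])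
  then have "computable2 (\<lambda>n k. 2 ^ ((3 * Suc n) * (3 * Suc n)))"
    unfolding computable2_def by blast
  moreover have "computable2 (\<lambda>n k. 0)"
    unfolding computable2_def using recf_eval.Zero by blast
  moreover have "computable2 (\<lambda>n k. 1)"
    unfolding computable2_def
    using recf_eval_Comp1[OF recf_eval.Zero recf_eval.Succ] by (metis One_nat_def)
  ultimately show ?thesis
    unfolding computable_real_seq_def
    by (intro exI[of _ "\<lambda>n k. 1"] exI[of _ "\<lambda>n k. 0"]
        exI[of _ "\<lambda>n k. 2 ^ ((3 * Suc n) * (3 * Suc n))"])
       (simp add: stab_const_def)
qed

subsection \<open>Choice of the scale\<close>

text \<open>For \<open>x = real n * \<rho>\<close> Bernoulli gives
  \<open>1 - x \<le> (1 - \<rho>) ^ n\<close>, and \<open>1 / (1 - x) \<le> 1 + 2 * x\<close> up to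
  \<open>x = 1/2\<close>. The mixed term \<open>2 * d * x\<close> is absorbed by
  \<open>2 * x\<close>.\<close>

lemma inverse_power_bound:
  fixes d \<rho> :: real
  assumes "0 \<le> d" "d \<le> 1" "0 < \<rho>" "real n * \<rho> \<le> 1/2"
  shows "(1 + d) / (1 - \<rho>) ^ n - 1 \<le> d + 4 * real n * \<rho>"
proof (cases "n = 0")
  case False
  define x where "x = real n * \<rho>"
  have x: "0 \<le> x" "x \<le> 1/2" using assms by (auto simp: x_def)
  have "1 * \<rho> \<le> real n * \<rho>" using False assms by (intro mult_right_mono) auto
  with assms(4) have "\<rho> \<le> 1" by linarith
  then have "1 + real n * (- \<rho>) \<le> (1 + - \<rho>) ^ n" by (intro Bernoulli_inequality) simp
  then have le: "1 - x \<le> (1 - \<rho>) ^ n" by (simp add: x_def)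
  have "1 \<le> (1 - x) * (1 + 2 * x)" using mult_nonneg_nonneg[of x "1 - 2 * x"] x
    by (simp add: algebra_simps)
  also have "\<dots> \<le> (1 - \<rho>) ^ n * (1 + 2 * x)" using le x by (intro mult_right_mono) auto
  finally have "(1 + d) * 1 \<le> (1 + d) * ((1 - \<rho>) ^ n * (1 + 2 * x))"
    using assms by (intro mult_left_mono) auto
  moreover have "0 < (1 - \<rho>) ^ n" using le x by linarith
  ultimately have "(1 + d) / (1 - \<rho>) ^ n \<le> (1 + d) * (1 + 2 * x)" by (simp add: field_simps)
  moreover have "d * x \<le> 1 * x" using assms x by (intro mult_right_mono)
  ultimately show ?thesis by (simp add: x_def algebra_simps)
qed simp

text \<open>Connects the stated exponent with the rate \<open>1 / n\<close>: for
  \<open>0 < d \<le> 1\<close> it yields \<open>d \<le> (d powr alpha n) ^ n\<close>.\<close>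

lemma alpha_le: "2 \<le> n \<Longrightarrow> 0 < alpha n \<and> alpha n * real n \<le> 1"
proof -
  assume n: "2 \<le> n"
  let ?D = "8 * 16 ^ (n - 2) * fact n * fact (n - 1) :: real"
  have "real n \<le> fact n" using fact_ge_self[of n] by (metis of_nat_fact of_nat_le_iff)
  also have "\<dots> = 1 * 1 * fact n * 1" by simp
  also have "\<dots> \<le> ?D" by (intro mult_mono) (auto simp: one_le_power fact_ge_1 mult_ge1_I)
  finally have "real n \<le> ?D" .
  moreover have "0 < ?D" by simp
  ultimately show ?thesis by (simp add: alpha_def field_simps)
qed

text \<open>The best scale is the last admissible one: failure at \<open>Suc l\<close> bounds
  \<open>2 ^ -(n * l)\<close> by a constant times \<open>d\<close>, and taking \<open>n\<close>-th
  roots bounds \<open>2 ^ -l\<close> by a constant times \<open>d powr alpha n\<close>. For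
  \<open>d = 0\<close> every scale is admissible and \<open>r \<le> 0\<close> in the limit.\<close>

lemma scale_choice:
  fixes d r :: real
  assumes n: "2 \<le> n" and d: "0 \<le> d" "d \<le> stab_const n"
    and bound: "\<And>l. n < l \<Longrightarrow> d * 2 ^ (n * l + 5 * n * n + 7 * n + 7) \<le> 1 \<Longrightarrow>
      r \<le> d + 4 * real n * (1/2) ^ l"
  shows "stab_const n * r \<le> d powr alpha n"
proof (cases "d = 0")
  case True
  have "r \<le> 0"
  proof (rule LIMSEQ_le_const)
    show "(\<lambda>l. 4 * real n * (1/2) ^ l) \<longlonglongrightarrow> 0"
      by (rule tendsto_mult_right_zero) (simp add: LIMSEQ_power_zero)
    show "\<exists>N. \<forall>l\<ge>N. r \<le> 4 * real n * (1/2) ^ l"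
      using bound True by (intro exI[of _ "Suc n"]) auto
  qed
  then have "stab_const n * r \<le> 0"
    using stab_const_bounds(1)[of n] by (simp add: mult_nonneg_nonpos)
  then show ?thesis using True by simp
next
  case False
  define W where "W = 5 * n * n + 7 * n + 7"
  define E where "E = (3 * Suc n) * (3 * Suc n)"
  define x where "x = d powr alpha n"
  have dpos: "0 < d" using d False by simp
  have st: "stab_const n \<le> 1 / 2 ^ E" "0 < stab_const n"
    using stab_const_bounds[of n] unfolding E_def[symmetric] by (auto simp: field_simps)
  then have "d \<le> 1 / 2 ^ E" using d(2) by simp
  then have dE: "d * 2 ^ E \<le> 1" by (simp add: field_simps)
  have "d * 1 \<le> d * 2 ^ E" using dpos by (intro mult_left_mono) auto
  with dE have d1: "d \<le> 1" by simp
  have W_eq: "n * l + 5 * n * n + 7 * n + 7 = n * l + W" for l by (simp add: W_def)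
  define P where "P l \<longleftrightarrow> d * 2 ^ (n * l + W) \<le> 1" for l
  have P0: "P (Suc n)"
  proof -
    have "n * Suc n + W \<le> E" by (simp add: W_def E_def algebra_simps)
    then have "d * 2 ^ (n * Suc n + W) \<le> d * 2 ^ E"
      using dpos by (intro mult_left_mono power_increasing) auto
    with dE show ?thesis by (simp add: P_def)
  qed
  have "\<exists>m. \<not> P m"
  proof -
    obtain m where m: "1 / d < 2 ^ m" using real_arch_pow[of 2 "1/d"] by auto
    have "1 * m \<le> n * m" using n by (intro mult_le_mono1) simp
    then have "m \<le> n * m + W" by linarith
    then have "(2::real) ^ m \<le> 2 ^ (n * m + W)" by (rule power_increasing) simp
    with m have "1 / d < 2 ^ (n * m + W)" by (rule less_le_trans)
    then have "\<not> P m" using dpos by (simp add: P_def field_simps)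
    then show ?thesis by blast
  qed
  then obtain m where m: "\<not> P m" by blast
  \<comment> \<open>\<open>P\<close> holds at \<open>Suc n\<close>, as
    \<open>d \<le> stab_const n\<close>, and fails for some \<open>m\<close>; without a last
    admissible scale induction would carry it past \<open>m\<close>.\<close>
  have "\<exists>l>n. P l \<and> \<not> P (Suc l)"
  proof (rule ccontr)
    assume "\<not> ?thesis"
    then have step: "P l \<Longrightarrow> P (Suc l)" if "n < l" for l using that by blast
    have all: "P l" if "Suc n \<le> l" for l
      using that
    proof (induction l rule: dec_induct)
      case base
      show ?case by (rule P0)
    next
      case (step k)
      then show ?case using \<open>\<And>l. n < l \<Longrightarrow> P l \<Longrightarrow> P (Suc l)\<close> by simp
    qed
    have "P (max m (Suc n))" by (rule all) simp
    moreover have "d * 2 ^ (n * m + W) \<le> d * 2 ^ (n * max m (Suc n) + W)"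
      using dpos by (intro mult_left_mono power_increasing) auto
    ultimately show False using m by (simp add: P_def)
  qed
  then obtain l where l: "n < l" "P l" "\<not> P (Suc l)" by blast
  have xpos: "0 < x" using dpos by (simp add: x_def)
  have a: "0 < alpha n" "alpha n * real n \<le> 1" using alpha_le[OF n] by auto
  have "alpha n * 1 \<le> alpha n * real n" using a(1) n by (intro mult_left_mono) auto
  with a(2) have a1: "alpha n \<le> 1" by linarith
  have "d = d powr 1" using dpos by simp
  also have "\<dots> \<le> x" unfolding x_def using d1 d a1 by (intro powr_mono') auto
  finally have dx: "d \<le> x" .
  have "d = d powr 1" using dpos by simp
  also have "\<dots> \<le> d powr (alpha n * real n)" using d1 d a by (intro powr_mono') auto
  also have "\<dots> = x ^ n" using xpos by (simp add: x_def powr_powr flip: powr_realpow)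
  finally have dxn: "d \<le> x ^ n" .
  have "((1/2) ^ l) ^ n \<le> (2 ^ (n + W) * x) ^ n"
  proof -
    have "1 < d * 2 ^ (n * Suc l + W)" using l(3) by (simp add: P_def not_le)
    also have "n * Suc l + W = n * l + (n + W)" by simp
    finally have "1 < d * (2 ^ (n * l) * 2 ^ (n + W))" by (simp only: power_add)
    then have "(1/2) ^ (n * l) \<le> 2 ^ (n + W) * d" by (simp add: power_one_over field_simps)
    also have "\<dots> \<le> (2 ^ (n + W)) ^ n * x ^ n"
      using dxn n dpos by (intro mult_mono self_le_power) auto
    finally show ?thesis by (simp add: power_mult_distrib power_mult mult.commute[of n])
  qed
  then have rho: "(1/2) ^ l \<le> 2 ^ (n + W) * x"
    by (rule power_le_imp_le_base[of _ "n - 1", unfolded Suc_diff_1[OF less_le_trans[OF pos2 n]]])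
       (use xpos in auto)
  have "r \<le> d + 4 * real n * (1/2) ^ l"
    using l by (intro bound) (auto simp: P_def W_eq)
  also have "\<dots> \<le> x + 4 * real n * (2 ^ (n + W) * x)"
    using dx rho by (intro add_mono mult_left_mono) auto
  also have "\<dots> = (1 + 4 * (real n * 2 ^ (n + W))) * x" by (simp add: algebra_simps)
  also have "\<dots> \<le> 2 ^ E * x"
  proof (rule mult_right_mono)
    have "real n \<le> 2 ^ n" using of_nat_less_two_power[of n] by (simp add: less_imp_le)
    then have "real n * 2 ^ (n + W) \<le> 2 ^ n * 2 ^ (n + W)" by (intro mult_right_mono) auto
    also have "\<dots> = 2 ^ (2 * n + W)" by (simp add: power_add mult_2)
    finally have "4 * (real n * 2 ^ (n + W)) \<le> 4 * 2 ^ (2 * n + W)" by simp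
    moreover have "(1::real) \<le> 2 ^ (2 * n + W)" by (rule one_le_power) simp
    moreover have "(2::real) ^ (2 * n + W + 3) = 8 * 2 ^ (2 * n + W)" by (simp add: power_add)
    moreover have "(2::real) ^ (2 * n + W + 3) \<le> 2 ^ E"
      using n by (intro power_increasing) (auto simp: W_def E_def algebra_simps)
    ultimately show "1 + 4 * (real n * 2 ^ (n + W)) \<le> 2 ^ E" by linarith
  qed (use xpos in simp)
  finally have rE: "r \<le> 2 ^ E * x" .
  have "stab_const n * r \<le> stab_const n * (2 ^ E * x)" using rE st by (intro mult_left_mono) auto
  also have "\<dots> \<le> 1 / 2 ^ E * (2 ^ E * x)" using st xpos by (intro mult_right_mono) auto
  also have "\<dots> = x" by simp
  finally show ?thesis by (simp add: x_def)
qed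

text \<open>Passage from Lebesgue to Borel sets: \<open>A0\<close> is the Borel main part of
  \<open>A\<close>, and \<open>B\<close> a Borel set attaining the outer measure of the midpoint
  set. The difference of hull and \<open>A\<close> need not be shown measurable, since it is
  contained in \<open>H - A0\<close>.\<close>

lemma hull_diff_volume:
  assumes n: "2 \<le> n" and A: "A \<in> sets (lebesgue_space n)"
    and pos: "0 < vol n A" and fin: "vol n A < \<infinity>"
    and def: "deficit n A \<le> ennreal (stab_const n)"
    and l: "n < l" "enn2real (deficit n A) * 2 ^ (n * l + 5 * n * n + 7 * n + 7) \<le> 1"
  shows "vol n (convex hull A - A) / vol n A
    \<le> ennreal (enn2real (deficit n A) + 4 * real n * (1/2) ^ l)"
proof -
  let ?M = "borel_lebesgue n"
  define d where "d = enn2real (deficit n A)"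
  have defd: "deficit n A = ennreal d"
    using def by (simp add: d_def ennreal_enn2real order_le_less_trans)
  have d0: "0 \<le> d" by (simp add: d_def)
  interpret V: finite_dim_volume ?M n "\<lambda>i x. Poly_Mapping.lookup x i" "\<lambda>i. Poly_Mapping.single i 1"
    by (rule finite_dim_volume_borel_lebesgue) (use n in simp)
  have Ac: "A \<in> sets (completion ?M)" using A by (simp add: lebesgue_space_def)
  have A_space: "A \<subseteq> space ?M" using sets.sets_into_space[OF Ac] by simp
  define A0 where "A0 = main_part ?M A"
  have A0: "A0 \<in> sets ?M" "A0 \<subseteq> A"
    using Ac main_part_null_part_Un[OF Ac] unfolding A0_def by blast+
  have A0_em: "emeasure ?M A0 = vol n A"
    using vol_measurable[OF A] emeasure_completion[OF Ac] by (simp add: A0_def lebesgue_space_def)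
  have A0_f: "A0 \<in> fmeasurable ?M" using A0 A0_em fin by (simp add: fmeasurable_def)
  define a where "a = measure ?M A0"
  have a: "vol n A = ennreal a" using A0_f A0_em by (simp add: a_def emeasure_eq_measure2)
  have a_pos: "0 < a" using pos a by simp
  let ?S = "(*\<^sub>R) (1/2) ` (A + A)"
  have S_space: "?S \<subseteq> space (completion ?M)"
    using A_space by (auto simp: set_plus_def)
  obtain B1 where B1: "B1 \<in> sets (completion ?M)" "?S \<subseteq> B1" "vol n ?S = emeasure (completion ?M) B1"
    using outer_measure_of_attain[OF S_space] by (auto simp: vol_def lebesgue_space_def)
  obtain B where B: "B \<in> sets ?M" "B1 \<subseteq> B" "emeasure (completion ?M) B1 = emeasure ?M B"
    using completion_upper[OF B1(1)] by blast
  \<comment> \<open>Truncation of the subtraction in \<open>deficit\<close> does no harm here, as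
    only an upper bound for the quotient is wanted.\<close>
  have "vol n ?S / vol n A \<le> 1 + ennreal d"
    using defd ennreal_minus_le_iff[of "vol n ?S / vol n A" 1 "ennreal d"] by (simp add: deficit_def)
  then have "vol n ?S / vol n A * vol n A \<le> ennreal (1 + d) * vol n A"
    using d0 by (intro mult_right_mono) (auto simp: ennreal_plus)
  also have "vol n ?S / vol n A * vol n A = vol n ?S"
    using pos fin by (simp add: ennreal_divide_times ennreal_times_divide)
  also have "ennreal (1 + d) * vol n A = ennreal ((1 + d) * a)"
    using d0 a_pos by (simp add: a ennreal_mult)
  finally have B_em: "emeasure ?M B \<le> ennreal ((1 + d) * a)" using B1 B by simp
  then have B_f: "B \<in> fmeasurable ?M"
    using B by (auto simp: fmeasurable_def order_le_less_trans)
  interpret small_doubling ?M n "\<lambda>i x. Poly_Mapping.lookup x i" "\<lambda>i. Poly_Mapping.single i 1" A A0 B d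
  proof (intro small_doubling.intro small_doubling_axioms.intro V.finite_dim_volume_axioms
      A_space A0_f A0(2) B_f)
    show "0 < measure ?M A0" using a_pos by (simp add: a_def)
    show "contr x y \<in> B" if "x \<in> A" "y \<in> A" for x y
      using that B1 B by (auto simp: contr_def set_plus_def)
    show "measure ?M B \<le> (1 + d) * measure ?M A0"
      using B_em B_f d0 a_pos by (simp add: emeasure_eq_measure2 a_def)
  qed
  obtain H where H: "H \<in> fmeasurable ?M" "convex hull A \<subseteq> H"
    "measure ?M H \<le> (1 + d) * a / (1 - (1/2) ^ l) ^ n"
    using hull_cover[of l] l by (auto simp: d_def a_def)
  have A0H: "A0 \<subseteq> H" using A0(2) H(2) hull_subset[of A convex] by blast
  have "vol n (convex hull A - A) \<le> vol n (H - A0)"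
    unfolding vol_def using A0(2) H(2) by (intro outer_measure_of_mono) auto
  also have "\<dots> = emeasure ?M (H - A0)" using H A0 by (intro vol_borel) auto
  also have "\<dots> = ennreal (measure ?M (H - A0))"
    using H A0 by (intro emeasure_eq_measure2 fmeasurable_Diff) auto
  also have "measure ?M (H - A0) = measure ?M H - a"
    unfolding a_def using H A0 A0H by (intro measure_Diff) (auto simp: fmeasurable_def)
  finally have "vol n (convex hull A - A) / vol n A \<le> ennreal (measure ?M H - a) / ennreal a"
    unfolding a by (rule divide_right_mono_ennreal)
  also have "\<dots> = ennreal ((measure ?M H - a) / a)"
  proof (rule divide_ennreal)
    show "0 \<le> measure ?M H - a"
      unfolding a_def using H A0H A0 by (simp add: measure_mono_fmeasurable)
  qed (rule a_pos)
  also have "\<dots> \<le> ennreal (d + 4 * real n * (1/2) ^ l)"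
  proof (rule ennreal_leI)
    have "real n * (1/2) ^ l \<le> real n * (1/2) ^ Suc n"
      using l by (intro mult_left_mono power_decreasing) auto
    also have "\<dots> \<le> 2 ^ n * (1/2) ^ Suc n"
      using of_nat_less_two_power[of n] by (intro mult_right_mono) (auto simp: less_imp_le)
    also have "\<dots> = 1/2" by (simp add: power_one_over)
    finally have half: "real n * (1/2) ^ l \<le> 1/2" .
    have "d \<le> stab_const n" using def stab_const_bounds(1)[of n] by (simp add: defd)
    also have "\<dots> \<le> 1" by (rule stab_const_bounds)
    finally have d1: "d \<le> 1" .
    have "(measure ?M H - a) / a = measure ?M H / a - 1" using a_pos by (simp add: field_simps)
    also have "\<dots> \<le> ((1 + d) * a / (1 - (1/2) ^ l) ^ n) / a - 1"
      using H(3) a_pos by (intro diff_right_mono divide_right_mono) auto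
    also have "\<dots> = (1 + d) / (1 - (1/2) ^ l) ^ n - 1" using a_pos by simp
    also have "\<dots> \<le> d + 4 * real n * (1/2) ^ l"
      by (rule inverse_power_bound[OF d0 d1 _ half]) simp
    finally show "(measure ?M H - a) / a \<le> d + 4 * real n * (1/2) ^ l" .
  qed
  finally show ?thesis by (simp only: d_def)
qed

theorem theorem1p2:
  shows "\<exists>\<delta> c :: nat \<Rightarrow> real. computable_real_seq \<delta> \<and> computable_real_seq c \<and>
    (\<forall>n\<ge>2. \<delta> n > 0 \<and> c n > 0 \<and>
      (\<forall>A \<in> sets (lebesgue_space n).
         vol n A > 0 \<and> deficit n A \<le> ennreal (\<delta> n) \<longrightarrow>
         ennreal (enn2real (deficit n A) powr alpha n)
           \<ge> ennreal (c n) * (vol n (convex hull A - A) / vol n A)))"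
proof (intro exI[of _ stab_const] conjI computable_stab_const allI impI ballI)
  fix n :: nat and A assume n: "2 \<le> n"
  show "0 < stab_const n" "0 < stab_const n" by (rule stab_const_bounds)+
  assume A: "A \<in> sets (lebesgue_space n)" and "vol n A > 0 \<and> deficit n A \<le> ennreal (stab_const n)"
  then have pos: "0 < vol n A" and def: "deficit n A \<le> ennreal (stab_const n)" by auto
  let ?R = "vol n (convex hull A - A) / vol n A"
  show "ennreal (stab_const n) * ?R \<le> ennreal (enn2real (deficit n A) powr alpha n)"
  proof (cases "vol n A = \<infinity>")
    \<comment> \<open>Division by infinity makes the quotient 0.\<close>
    case True
    then show ?thesis by simp
  next
    case False
    define d where "d = enn2real (deficit n A)"
    define r where "r = enn2real ?R"
    have d: "0 \<le> d" "d \<le> stab_const n"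
      using enn2real_mono[OF def] stab_const_bounds(1)[of n] by (auto simp: d_def)
    note bound = hull_diff_volume[OF n A pos _ def, folded d_def]
    have fin: "vol n A < \<infinity>" using False by (simp add: less_top)
    \<comment> \<open>Before \<open>?R\<close> can be replaced by a real number it must be finite;
      the smallest scale permitted by \<open>bound\<close>, \<open>Suc n\<close>, shows
      this.\<close>
    have "?R < \<infinity>"
    proof -
      have "(6 * n * n + 8 * n + 7) \<le> (3 * Suc n) * (3 * Suc n)" by (simp add: algebra_simps)
      then have "(2::real) ^ (n * Suc n + 5 * n * n + 7 * n + 7) \<le> 2 ^ ((3 * Suc n) * (3 * Suc n))"
        by (intro power_increasing) (auto simp: algebra_simps)
      then have "d * 2 ^ (n * Suc n + 5 * n * n + 7 * n + 7)
          \<le> stab_const n * 2 ^ ((3 * Suc n) * (3 * Suc n))"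
        using d by (intro mult_mono) auto
      also have "\<dots> \<le> 1" by (rule stab_const_bounds)
      finally show ?thesis using bound[OF fin, of "Suc n"] by (simp add: order_le_less_trans)
    qed
    then have R: "?R = ennreal r" by (simp add: r_def)
    have "stab_const n * r \<le> d powr alpha n"
    proof (rule scale_choice[OF n d])
      fix l assume "n < l" "d * 2 ^ (n * l + 5 * n * n + 7 * n + 7) \<le> 1"
      from bound[OF fin this] show "r \<le> d + 4 * real n * (1/2) ^ l"
        unfolding R using d by (subst (asm) ennreal_le_iff) auto
    qed
    then show ?thesis unfolding R d_def[symmetric]
      using stab_const_bounds(1)[of n]
      by (subst ennreal_mult[symmetric]) (auto simp: r_def intro: ennreal_leI)
  qed
qed

end
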